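(* Let $G=(V,E)$ be a nontrivial 2-connected series–parallel graph (a 2-sp-graph) with $n$ edges and $k+1$ vertices. For a positive edge weighting $W=\operatorname{diag}(w_e)_{e\in E}$ (all $w_e>0$), the following are equivalent: (1) $$\alpha_G(W)=\max_{\substack{I\subseteq E\\ |I|=k}}\lambda_{\min}P_I(W)=\frac1n.$$ (2) The weights are graph-induced, up to multiplication by a common positive scalar.
   Context: Graphs are finite multigraphs. A 2-cycle is a pair of parallel edges joining two distinct vertices. A 2-sp-graph (2-connected series–parallel graph) is a graph obtained from a 2-cycle by a finite sequence of series extensions (subdivisions of edges) and parallel extensions (duplications of edges). For a graph $\Gamma$, $|\Gamma|$ denotes its number of edges. Choose arbitrary directions of the edges and let $B\in\mathbb{R}^{(k+1)\times n}$ be the incidence matrix (rows indexed by vertices, columns by edges, the column of $e$ having entries $\pm1$ of opposite sign at the two ends of $e$, zeros elsewhere). Then $P(W)=W^{1/2}B^T(BWB^T)^+BW^{1/2}$ is the orthogonal projection onto $\operatorname{col}(W^{1/2}B^T)\subset\mathbb{R}^n$ ($^+$ is the Moore–Penrose inverse). $P_I(W)$ is the principal $k\times k$ submatrix of $P(W)$ with rows and columns indexed by $I$, and $\lambda_{\min}$ is the smallest eigenvalue. Two-terminal series–parallel graphs with ordered terminals $(l,r)$: a single edge joining $l$ and $r$; or a parallel composition $\Gamma_1\parallel\cdots\parallel\Gamma_p$ of such graphs (all left terminals identified, all right terminals identified); or a series composition $\Gamma_1\circ\cdots\circ\Gamma_s$ (the right terminal of $\Gamma_i$ identified with the left terminal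 of $\Gamma_{i+1}$; the left terminal is that of $\Gamma_1$, the right terminal is that of $\Gamma_s$). Admissible decomposition tree of a 2-sp-graph $G$: choose terminals $(l,r)$ for which $G$ is a two-terminal series–parallel graph. The tree is rooted, its root is $G$, and the children of each non-leaf node are the parts of a series or parallel composition forming that node. Leaves are single edges. Along every root-to-leaf chain, the decompositions alternate in type, starting with a parallel decomposition at the root (into proper subgraphs) and ending with a series decomposition; below the root, one-part ("dummy") decompositions are allowed, in particular to make every chain end with a series decomposition. Thus each edge $e$ has a root-to-leaf chain $G\supset\Gamma_1\supseteq\Gamma_2\supseteq\cdots\supseteq\Gamma_{2d}=\{e\}$. Graph-induced weights: put $\varphi(x)=x(n-x)$. Given terminals and an admissible decomposition tree, the graph-induced weight of $e$ is $$w_e=\frac{\varphi(|\Gamma_1|)}{\varphi(|\Gamma_2|)}\frac{\varphi(|\Gamma_3|)}{\varphi(|\Gamma_4|)}\cdots\frac{\varphi(|\Gamma_{2d-1}|)}{\varphi(|\Gamma_{2d}|)},$$ where $G\supset\Gamma_1\supseteq\cdots\supseteq\Gamma_{2d}=\{e\}$ is the chain of $e$. The terminals and the admissible tree may be chosen arbitrarily. *)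

theory Defs
  imports
    "Jordan_Normal_Form.Spectral_Radius"
    "Jordan_Normal_Form.DL_Submatrix"
begin

section \<open>Multigraphs and 2-connected series--parallel graphs\<close>

text \<open>
  Undirected multigraphs; \<open>ends H e\<close> is the set of the two end vertices of \<open>e\<close> and is
  irrelevant for \<open>e \<notin> edges H\<close>.
\<close>
record ('v, 'e) mgraph =
  verts :: "'v set"
  edges :: "'e set"
  ends  :: "'e \<Rightarrow> 'v set"

definition two_cycle :: "('v, 'e) mgraph \<Rightarrow> bool" where
  "two_cycle G \<longleftrightarrow> (\<exists>u v e f. u \<noteq> v \<and> e \<noteq> f \<and>
     verts G = {u, v} \<and> edges G = {e, f} \<and> ends G e = {u, v} \<and> ends G f = {u, v})"

text \<open>
  \<open>G'\<close> arises from \<open>G\<close> by replacing the edge \<open>e\<close> by a path with edges \<open>f, g\<close> through a new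
  vertex \<open>x\<close>. One of \<open>f, g\<close> may reuse the name \<open>e\<close>.
\<close>
definition series_extension :: "('v, 'e) mgraph \<Rightarrow> ('v, 'e) mgraph \<Rightarrow> bool" where
  "series_extension G G' \<longleftrightarrow> (\<exists>e u v x f g. e \<in> edges G \<and> ends G e = {u, v} \<and> x \<notin> verts G \<and>
     f \<noteq> g \<and> f \<notin> edges G - {e} \<and> g \<notin> edges G - {e} \<and>
     verts G' = insert x (verts G) \<and> edges G' = (edges G - {e}) \<union> {f, g} \<and>
     ends G' f = {u, x} \<and> ends G' g = {x, v} \<and>
     (\<forall>d \<in> edges G - {e}. ends G' d = ends G d))"

definition parallel_extension :: "('v, 'e) mgraph \<Rightarrow> ('v, 'e) mgraph \<Rightarrow> bool" where
  "parallel_extension G G' \<longleftrightarrow> (\<exists>e f. e \<in> edges G \<and> f \<notin> edges G \<and>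
     verts G' = verts G \<and> edges G' = insert f (edges G) \<and> ends G' f = ends G e \<and>
     (\<forall>d \<in> edges G. ends G' d = ends G d))"

inductive two_sp :: "('v, 'e) mgraph \<Rightarrow> bool" where
  base: "two_cycle G \<Longrightarrow> two_sp G"
| series: "two_sp G \<Longrightarrow> series_extension G G' \<Longrightarrow> two_sp G'"
| parallel: "two_sp G \<Longrightarrow> parallel_extension G G' \<Longrightarrow> two_sp G'"


section \<open>The projection matrix and \<open>\<alpha>\<close>\<close>

text \<open>
  An orientation selects one of the two ends of every edge as its head. The lists \<open>vs\<close> and \<open>es\<close>
  below enumerate the vertices and the edges, and thereby order rows and columns.
\<close>
definition orientation :: "('v, 'e) mgraph \<Rightarrow> ('e \<Rightarrow> 'v) \<Rightarrow> bool" where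
  "orientation G h \<longleftrightarrow> (\<forall>e \<in> edges G. h e \<in> ends G e)"

definition incidence_mat ::
    "('v, 'e) mgraph \<Rightarrow> ('e \<Rightarrow> 'v) \<Rightarrow> 'v list \<Rightarrow> 'e list \<Rightarrow> real mat" where
  "incidence_mat G h vs es = mat (length vs) (length es) (\<lambda>(i, j).
     if vs ! i \<notin> ends G (es ! j) then 0 else if vs ! i = h (es ! j) then 1 else - 1)"

text \<open>The Moore--Penrose inverse of a real matrix, through the four Penrose equations.\<close>
definition moore_penrose :: "real mat \<Rightarrow> real mat" where
  "moore_penrose A = (THE X. X \<in> carrier_mat (dim_col A) (dim_row A) \<and>
     A * X * A = A \<and> X * A * X = X \<and>
     transpose_mat (A * X) = A * X \<and> transpose_mat (X * A) = X * A)"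

definition weight_mat :: "('e \<Rightarrow> real) \<Rightarrow> 'e list \<Rightarrow> real mat" where
  "weight_mat w es = mat_diag (length es) (\<lambda>j. w (es ! j))"

definition weight_sqrt_mat :: "('e \<Rightarrow> real) \<Rightarrow> 'e list \<Rightarrow> real mat" where
  "weight_sqrt_mat w es = mat_diag (length es) (\<lambda>j. sqrt (w (es ! j)))"

definition proj_mat ::
    "('v, 'e) mgraph \<Rightarrow> ('e \<Rightarrow> 'v) \<Rightarrow> 'v list \<Rightarrow> 'e list \<Rightarrow> ('e \<Rightarrow> real) \<Rightarrow> real mat" where
  "proj_mat G h vs es w =
    (let B = incidence_mat G h vs es; W = weight_mat w es; S = weight_sqrt_mat w es
     in S * transpose_mat B * moore_penrose (B * W * transpose_mat B) * B * S)"

definition principal_submat :: "'e list \<Rightarrow> real mat \<Rightarrow> 'e set \<Rightarrow> real mat" where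
  "principal_submat es P I =
    (let J = {j. j < length es \<and> es ! j \<in> I} in submatrix P J J)"

definition lambda_min :: "real mat \<Rightarrow> real" where
  "lambda_min A = Min (spectrum A)"

text \<open>
  The maximum over edge sets of size \<open>k\<close>, where the graph has \<open>k + 1\<close> vertices.
\<close>
definition alpha ::
    "('v, 'e) mgraph \<Rightarrow> ('e \<Rightarrow> 'v) \<Rightarrow> 'v list \<Rightarrow> 'e list \<Rightarrow> ('e \<Rightarrow> real) \<Rightarrow> real" where
  "alpha G h vs es w =
    Max ((\<lambda>I. lambda_min (principal_submat es (proj_mat G h vs es w) I)) `
      {I. I \<subseteq> edges G \<and> card I = card (verts G) - 1})"


section \<open>Decomposition trees\<close>

text \<open>
  A node is represented by its decomposition; \<open>leaf_edges t\<close> is the edge set of the subgraph that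
  sits at the node \<open>t\<close>.
\<close>
datatype (leaf_edges: 'e) dtree = Leaf 'e | Ser "'e dtree list" | Par "'e dtree list"

definition union_of_parts :: "('v, 'e) mgraph list \<Rightarrow> ('v, 'e) mgraph \<Rightarrow> bool" where
  "union_of_parts Hs H \<longleftrightarrow>
     verts H = (\<Union>K \<in> set Hs. verts K) \<and> edges H = (\<Union>K \<in> set Hs. edges K) \<and>
     (\<forall>K \<in> set Hs. \<forall>e \<in> edges K. ends H e = ends K e) \<and>
     (\<forall>j < length Hs. \<forall>i < j. edges (Hs ! i) \<inter> edges (Hs ! j) = {})"

text \<open>
  \<open>decomposes t H l r\<close>: \<open>H\<close> is a two-terminal series--parallel graph with ordered terminals
  \<open>(l, r)\<close>, composed as prescribed by \<open>t\<close>. Identifying terminals is expressed by the parts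
  sharing exactly the vertices to be identified. In a series composition, \<open>xs\<close> lists the
  successive terminals of the parts.
\<close>
inductive decomposes :: "'e dtree \<Rightarrow> ('v, 'e) mgraph \<Rightarrow> 'v \<Rightarrow> 'v \<Rightarrow> bool" where
  single_edge:
    "l \<noteq> r \<Longrightarrow> verts H = {l, r} \<Longrightarrow> edges H = {e} \<Longrightarrow> ends H e = {l, r} \<Longrightarrow>
     decomposes (Leaf e) H l r"
| parallel_composition:
    "ts \<noteq> [] \<Longrightarrow> length Hs = length ts \<Longrightarrow> union_of_parts Hs H \<Longrightarrow>
     (\<forall>i < length ts. decomposes (ts ! i) (Hs ! i) l r) \<Longrightarrow>
     (\<forall>j < length ts. \<forall>i < j. verts (Hs ! i) \<inter> verts (Hs ! j) = {l, r}) \<Longrightarrow>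
     decomposes (Par ts) H l r"
| series_composition:
    "ts \<noteq> [] \<Longrightarrow> length Hs = length ts \<Longrightarrow> union_of_parts Hs H \<Longrightarrow>
     length xs = length ts + 1 \<Longrightarrow> hd xs = l \<Longrightarrow> last xs = r \<Longrightarrow>
     (\<forall>i < length ts. decomposes (ts ! i) (Hs ! i) (xs ! i) (xs ! (i + 1))) \<Longrightarrow>
     (\<forall>j < length ts. \<forall>i < j. verts (Hs ! i) \<inter> verts (Hs ! j) =
        (if j = i + 1 then {xs ! j} else {})) \<Longrightarrow>
     decomposes (Ser ts) H l r"

text \<open>
  Alternation of types: every child of a parallel node is a series node, and every child of a
  series node is a parallel node or a leaf. A node with one child is a dummy decomposition.
\<close>
fun alternating_par :: "'e dtree \<Rightarrow> bool" and alternating_ser :: "'e dtree \<Rightarrow> bool" where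
  "alternating_par (Par ts) \<longleftrightarrow> (\<forall>t \<in> set ts. alternating_ser t)"
| "alternating_par (Ser ts) \<longleftrightarrow> False"
| "alternating_par (Leaf e) \<longleftrightarrow> False"
| "alternating_ser (Ser ts) \<longleftrightarrow> (\<forall>t \<in> set ts. (\<exists>e. t = Leaf e) \<or> alternating_par t)"
| "alternating_ser (Par ts) \<longleftrightarrow> False"
| "alternating_ser (Leaf e) \<longleftrightarrow> False"

text \<open>
  The root has at least two parts; as every part has an edge, these are proper subgraphs.
\<close>
definition admissible_tree :: "('v, 'e) mgraph \<Rightarrow> 'v \<Rightarrow> 'v \<Rightarrow> 'e dtree \<Rightarrow> bool" where
  "admissible_tree G l r t \<longleftrightarrow>
     decomposes t G l r \<and> alternating_par t \<and> (\<exists>ts. t = Par ts \<and> 2 \<le> length ts)"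


section \<open>Graph-induced weights\<close>

text \<open>
  \<open>chain t e [\<Gamma>\<^sub>1, \<dots>, \<Gamma>\<^sub>m]\<close>: the nodes strictly below \<open>t\<close> on the way from \<open>t\<close> to the leaf \<open>e\<close>.
\<close>
inductive chain :: "'e dtree \<Rightarrow> 'e \<Rightarrow> 'e dtree list \<Rightarrow> bool" where
  "chain (Leaf e) e []"
| "t \<in> set ts \<Longrightarrow> chain t e cs \<Longrightarrow> chain (Ser ts) e (t # cs)"
| "t \<in> set ts \<Longrightarrow> chain t e cs \<Longrightarrow> chain (Par ts) e (t # cs)"

definition phi :: "nat \<Rightarrow> nat \<Rightarrow> real" where
  "phi n x = real x * (real n - real x)"

text \<open>
  List positions start at 0, so \<open>\<Gamma>\<^sub>2\<^sub>i\<^sub>+\<^sub>1\<close> is \<open>cs ! (2 * i)\<close>. The chain of an edge of an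
  admissible tree is unique.
\<close>
definition induced_weight :: "'e dtree \<Rightarrow> 'e \<Rightarrow> real" where
  "induced_weight t e =
    (let n = card (leaf_edges t); cs = (THE cs. chain t e cs)
     in \<Prod>i < length cs div 2.
          phi n (card (leaf_edges (cs ! (2 * i)))) /
          phi n (card (leaf_edges (cs ! (2 * i + 1)))))"

definition proportional_to_induced ::
    "('v, 'e) mgraph \<Rightarrow> 'e dtree \<Rightarrow> ('e \<Rightarrow> real) \<Rightarrow> bool" where
  "proportional_to_induced G t w \<longleftrightarrow>
     (\<exists>c > 0. \<forall>e \<in> edges G. w e = c * induced_weight t e)"

end

theory Submission
  imports Defs
begin

text \<open>
  For a potential \<open>p\<close> on the vertices let \<open>E\<^sub>J(p)\<close> be the sum of \<open>w e * (p u - p v)\<^sup>2\<close> over the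
  edges \<open>e = uv\<close> in \<open>J\<close>. The vectors \<open>W\<^sup>1\<^sup>/\<^sup>2 B\<^sup>T p\<close> form the range of the projection \<open>P(W)\<close>;
  the squared norm of such a vector is \<open>E\<^sub>E(p)\<close>, that of its restriction to \<open>I\<close> is \<open>E\<^sub>I(p)\<close>. As
  the range has dimension \<open>k = card I\<close>, the least eigenvalue of \<open>P\<^sub>I(W)\<close> exceeds \<open>1/n\<close> exactly if
  the surplus \<open>n E\<^sub>I(p) - E\<^sub>E(p)\<close> is positive for every nonconstant \<open>p\<close>
  (\<open>lambda_min_le\<close>, \<open>lambda_min_certified\<close>). The theorem is thus about the sign of the surplus.

  The surplus is additive over the parts of a decomposition, and a part meets the rest of the
  graph in its terminals only. What counts about a part with terminals \<open>l, r\<close> and a chosen edge set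
  is therefore the best \<open>a\<close> in \<open>surplus \<ge> a (p l - p r)\<^sup>2\<close>. This \<open>a\<close> behaves like a conductance:
  conductances add in parallel compositions, their reciprocals add in series compositions. Each part
  is used in two ways: with a spanning tree, of conductance \<open>a\<close>, or with a spanning forest that
  separates \<open>l\<close> from \<open>r\<close>, of conductance \<open>- b < 0\<close>. A tree of a parallel composition is a tree in one
  part and a forest in the others; a forest of a series composition is a forest in one part and a tree
  in the others. Choosing that part by averaging (\<open>composition_choice\<close>), induction gives trees and
  forests with \<open>a / b \<ge> (n - m) / m\<close> for parts with \<open>m\<close> edges. For the whole graph \<open>m = n\<close>, so \<open>a \<ge> 0\<close>
  and \<open>\<alpha> \<ge> 1/n\<close> for all weights (\<open>spanning_set_with_certificate\<close>).

  If \<open>\<alpha> = 1/n\<close>, then all averages are attained by every part: \<open>b / m\<close> is the same for the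
  parts of a parallel composition, and \<open>a m\<close> is the same for the parts of a series composition. This
  determines the weights from the root downwards up to a factor (\<open>calibrated\<close>), and solving the
  recursion along the chain of an edge gives the graph-induced weights (\<open>calibrated_iff_induced\<close>).
  Conversely, for these weights the two composition laws bound the conductances of edge sets of
  the size of a tree or a forest from above by \<open>c (n - m)\<close> and \<open>- c m\<close>, so no set of \<open>k\<close> edges has a
  positive definite surplus (\<open>calibrated_no_certificate\<close>). Both arguments start from an arbitrary admissible tree; one exists
  because every series or parallel extension can be carried out at a leaf of the tree
  (\<open>two_sp_admissible_tree\<close>).
\<close>

section \<open>Two-terminal decompositions\<close>

lemma union_of_parts_nth:
  assumes "union_of_parts Hs H" "length Hs = m"
  shows "verts H = (\<Union>i<m. verts (Hs ! i))" "edges H = (\<Union>i<m. edges (Hs ! i))"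
    "\<And>i e. i < m \<Longrightarrow> e \<in> edges (Hs ! i) \<Longrightarrow> ends H e = ends (Hs ! i) e"
    "\<And>i j. i < m \<Longrightarrow> j < m \<Longrightarrow> i \<noteq> j \<Longrightarrow> edges (Hs ! i) \<inter> edges (Hs ! j) = {}"
proof -
  show "edges (Hs ! i) \<inter> edges (Hs ! j) = {}" if "i < m" "j < m" "i \<noteq> j" for i j
    using assms that unfolding union_of_parts_def by (cases i j rule: linorder_cases) blast+
qed (use assms in \<open>auto simp: union_of_parts_def set_conv_nth\<close>)

text \<open>
  Finite and nonempty, without loops or dangling edges: the part of being a two-terminal
  series-parallel graph that passes to unions without any condition on the terminals.
\<close>
definition proper_mgraph :: "('v, 'e) mgraph \<Rightarrow> bool" where
  "proper_mgraph H \<longleftrightarrow> finite (verts H) \<and> finite (edges H) \<and> edges H \<noteq> {} \<and>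
     (\<forall>e\<in>edges H. \<exists>u v. u \<noteq> v \<and> u \<in> verts H \<and> v \<in> verts H \<and> ends H e = {u, v})"

lemma proper_mgraph_union:
  assumes "union_of_parts Hs H" "length Hs = m" "0 < m" and IH: "\<And>i. i < m \<Longrightarrow> proper_mgraph (Hs ! i)"
  shows "proper_mgraph H"
  unfolding proper_mgraph_def
proof (intro conjI ballI)
  note u = union_of_parts_nth[OF assms(1,2)]
  show "finite (verts H)" "finite (edges H)" unfolding u(1,2) using IH by (auto simp: proper_mgraph_def)
  show "edges H \<noteq> {}" unfolding u(2) using IH[OF assms(3)] assms(3) by (auto simp: proper_mgraph_def)
  fix e assume "e \<in> edges H"
  then obtain i where i: "i < m" "e \<in> edges (Hs ! i)" unfolding u(2) by blast
  then obtain x y where "x \<noteq> y" "x \<in> verts (Hs ! i)" "y \<in> verts (Hs ! i)" "ends (Hs ! i) e = {x, y}"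
    using IH[OF i(1)] unfolding proper_mgraph_def by metis
  then show "\<exists>u v. u \<noteq> v \<and> u \<in> verts H \<and> v \<in> verts H \<and> ends H e = {u, v}"
    using u(1) u(3)[OF i] i(1) by (metis UN_I lessThan_iff)
qed

text \<open>
  The only delicate claim is that the terminals of a series composition differ: they lie in
  the first and the last part, which share at most one inner terminal.
\<close>
lemma decomposes_basic:
  assumes "decomposes t H l r"
  shows "proper_mgraph H \<and> l \<in> verts H \<and> r \<in> verts H \<and> l \<noteq> r \<and> leaf_edges t = edges H"
  using assms
proof (induction rule: decomposes.induct)
  case (single_edge l r H e)
  then show ?case unfolding proper_mgraph_def by auto
next
  case (parallel_composition ts Hs H l r)
  note IH = parallel_composition.IH and u = union_of_parts_nth[OF parallel_composition(3,2)]
  have 0: "0 < length ts" using parallel_composition(1) by simp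
  have "proper_mgraph H" by (rule proper_mgraph_union[OF parallel_composition(3,2) 0]) (use IH in blast)
  moreover have "leaf_edges (Par ts) = (\<Union>i<length ts. leaf_edges (ts ! i))" by (auto simp: set_conv_nth)
  then have "leaf_edges (Par ts) = edges H" unfolding u(2) using IH by auto
  ultimately show ?case unfolding u(1) using IH[rule_format, OF 0] 0 by blast
next
  case (series_composition ts Hs H xs l r)
  note IH = series_composition.IH and u = union_of_parts_nth[OF series_composition(3,2)]
  have 0: "0 < length ts" using series_composition(1) by simp
  have xs0: "l = xs ! 0" and xsm: "r = xs ! length ts"
    using series_composition(4-6) by (auto simp: hd_conv_nth last_conv_nth simp flip: length_greater_0_conv)
  have "proper_mgraph H" by (rule proper_mgraph_union[OF series_composition(3,2) 0]) (use IH in blast)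
  moreover have "leaf_edges (Ser ts) = (\<Union>i<length ts. leaf_edges (ts ! i))" by (auto simp: set_conv_nth)
  then have "leaf_edges (Ser ts) = edges H" unfolding u(2) using IH by auto
  moreover have lin: "l \<in> verts (Hs ! 0)" "xs ! 0 \<noteq> xs ! 1" unfolding xs0 using IH[rule_format, OF 0] by auto
  moreover have rin: "r \<in> verts (Hs ! (length ts - 1))"
    unfolding xsm using IH[rule_format, of "length ts - 1"] 0 by auto
  moreover have "l \<in> verts H" "r \<in> verts H" unfolding u using lin(1) rin 0
    by (auto intro: bexI[of _ 0] bexI[of _ "length ts - 1"])
  moreover have "l \<noteq> r"
  proof
    assume eq: "l = r"
    show False
    proof (cases "length ts = 1")
      case True then show ?thesis using lin eq xs0 xsm by simp
    next
      case False
      then have j: "0 < length ts - 1" "length ts - 1 < length ts" using 0 by linarith+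
      have "verts (Hs ! 0) \<inter> verts (Hs ! (length ts - 1)) = (if length ts - 1 = 0 + 1 then {xs ! (length ts - 1)} else {})"
        using series_composition.hyps j by blast
      then show ?thesis using lin rin eq xs0 by (auto split: if_splits)
    qed
  qed
  ultimately show ?case by blast
qed

lemma decomposes_finite:
    "decomposes t H l r \<Longrightarrow> finite (verts H)" "decomposes t H l r \<Longrightarrow> finite (edges H)"
  and decomposes_nonempty: "decomposes t H l r \<Longrightarrow> edges H \<noteq> {}"
  using decomposes_basic unfolding proper_mgraph_def by metis+

lemma decomposes_terminals:
    "decomposes t H l r \<Longrightarrow> l \<in> verts H" "decomposes t H l r \<Longrightarrow> r \<in> verts H" "decomposes t H l r \<Longrightarrow> l \<noteq> r"
  and decomposes_leaf_edges: "decomposes t H l r \<Longrightarrow> leaf_edges t = edges H"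
  by (drule decomposes_basic, elim conjE, assumption)+

lemma decomposes_ends:
  assumes "decomposes t H l r" "e \<in> edges H"
  obtains u v where "u \<noteq> v" "u \<in> verts H" "v \<in> verts H" "ends H e = {u, v}"
  using decomposes_basic[OF assms(1)] assms(2) unfolding proper_mgraph_def by blast

lemma decomposes_card_edges_pos: "decomposes t H l r \<Longrightarrow> 0 < card (edges H)"
  by (simp add: card_gt_0_iff decomposes_nonempty decomposes_finite)

lemma decomposes_card_verts: "decomposes t H l r \<Longrightarrow> 2 \<le> card (verts H)"
  using card_mono[of "verts H" "{l, r}"] decomposes_terminals[of t H l r] decomposes_finite[of t H l r] by auto

text \<open>
  The data of a parallel or series composition, with the parts indexed by \<open>i < m\<close> and with the
  terminals \<open>a i, b i\<close> of part \<open>i\<close>. What concerns edges does not depend on the kind of composition; the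
  two extensions add which terminals are shared.
\<close>

locale parts =
  fixes m :: nat and ts :: "nat \<Rightarrow> 'e dtree" and Hs :: "nat \<Rightarrow> ('v, 'e) mgraph" and H :: "('v, 'e) mgraph"
    and a b :: "nat \<Rightarrow> 'v"
  assumes pos: "0 < m"
    and verts: "verts H = (\<Union>i<m. verts (Hs i))"
    and edges: "edges H = (\<Union>i<m. edges (Hs i))"
    and ends: "\<And>i e. i < m \<Longrightarrow> e \<in> edges (Hs i) \<Longrightarrow> ends H e = ends (Hs i) e"
    and disj: "\<And>i j. i < m \<Longrightarrow> j < m \<Longrightarrow> i \<noteq> j \<Longrightarrow> edges (Hs i) \<inter> edges (Hs j) = {}"
    and dec: "\<And>i. i < m \<Longrightarrow> decomposes (ts i) (Hs i) (a i) (b i)"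

locale parallel_parts = parts m ts Hs H "\<lambda>_. l" "\<lambda>_. r"
  for m :: nat and ts :: "nat \<Rightarrow> 'e dtree" and Hs :: "nat \<Rightarrow> ('v, 'e) mgraph" and H and l r +
  assumes meet: "\<And>i j. i < m \<Longrightarrow> j < m \<Longrightarrow> i \<noteq> j \<Longrightarrow> verts (Hs i) \<inter> verts (Hs j) = {l, r}"

locale series_parts = parts m ts Hs H x "\<lambda>i. x (Suc i)"
  for m :: nat and ts :: "nat \<Rightarrow> 'e dtree" and Hs :: "nat \<Rightarrow> ('v, 'e) mgraph" and H and x +
  assumes meet: "\<And>i j. i < j \<Longrightarrow> j < m \<Longrightarrow>
    verts (Hs i) \<inter> verts (Hs j) = (if j = Suc i then {x j} else {})"

lemma parallel_partsI:
  assumes "ts \<noteq> []" "length Hs = length ts" "union_of_parts Hs H"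
    "\<forall>i<length ts. decomposes (ts ! i) (Hs ! i) l r"
    "\<forall>j<length ts. \<forall>i<j. verts (Hs ! i) \<inter> verts (Hs ! j) = {l, r}"
  shows "parallel_parts (length ts) ((!) ts) ((!) Hs) H l r"
proof unfold_locales
  show "verts (Hs ! i) \<inter> verts (Hs ! j) = {l, r}" if "i < length ts" "j < length ts" "i \<noteq> j" for i j
    using assms(5) that by (cases i j rule: linorder_cases) blast+
qed (use assms union_of_parts_nth[OF assms(3,2)] in auto)

lemma series_partsI:
  assumes "ts \<noteq> []" "length Hs = length ts" "union_of_parts Hs H"
    "\<forall>i<length ts. decomposes (ts ! i) (Hs ! i) (xs ! i) (xs ! (i + 1))"
    "\<forall>j<length ts. \<forall>i<j. verts (Hs ! i) \<inter> verts (Hs ! j) = (if j = i + 1 then {xs ! j} else {})"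
  shows "series_parts (length ts) ((!) ts) ((!) Hs) H ((!) xs)"
  by unfold_locales (use assms union_of_parts_nth[OF assms(3,2)] in auto)

text \<open>
  The rule behind all later inductions on decompositions: it delivers the locales above
  instead of lists, and writes the terminals of a series composition as \<open>x 0\<close> and
  \<open>x (length ts)\<close>.
\<close>
lemma decomposes_induct [consumes 1, case_names leaf par ser]:
  assumes "decomposes t H l r"
    and leaf: "\<And>l r H e. l \<noteq> r \<Longrightarrow> verts H = {l, r} \<Longrightarrow> edges H = {e} \<Longrightarrow> ends H e = {l, r} \<Longrightarrow>
      P (Leaf e) H l r"
    and par: "\<And>ts Hs H l r. parallel_parts (length ts) ((!) ts) Hs H l r \<Longrightarrow>
      (\<And>i. i < length ts \<Longrightarrow> P (ts ! i) (Hs i) l r) \<Longrightarrow> P (Par ts) H l r"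
    and ser: "\<And>ts Hs H x. series_parts (length ts) ((!) ts) Hs H x \<Longrightarrow>
      (\<And>i. i < length ts \<Longrightarrow> P (ts ! i) (Hs i) (x i) (x (Suc i))) \<Longrightarrow> P (Ser ts) H (x 0) (x (length ts))"
  shows "P t H l r"
  using assms(1)
proof (induction rule: decomposes.induct)
  case (single_edge l r H e)
  then show ?case by (rule leaf)
next
  case (parallel_composition ts Hs H l r)
  then have "parallel_parts (length ts) ((!) ts) ((!) Hs) H l r"
    by (intro parallel_partsI) auto
  then show ?case by (rule par) (use parallel_composition in auto)
next
  case (series_composition ts Hs H xs l r)
  then have "series_parts (length ts) ((!) ts) ((!) Hs) H ((!) xs)"
    by (intro series_partsI) auto
  then have "P (Ser ts) H (xs ! 0) (xs ! length ts)" by (rule ser) (use series_composition in auto)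
  moreover have "l = xs ! 0" "r = xs ! length ts"
    using series_composition(4-6) by (auto simp: hd_conv_nth last_conv_nth simp flip: length_greater_0_conv)
  ultimately show ?case by simp
qed

context parts
begin

lemma finite_part: "i < m \<Longrightarrow> finite (verts (Hs i))" "i < m \<Longrightarrow> finite (edges (Hs i))"
  using decomposes_finite[OF dec] by auto

lemma card_part: "i < m \<Longrightarrow> 2 \<le> card (verts (Hs i))" "i < m \<Longrightarrow> 0 < card (edges (Hs i))"
  using decomposes_card_verts[OF dec] decomposes_card_edges_pos[OF dec] by auto

lemma sum_edges: "(\<Sum>e\<in>edges H. f e) = (\<Sum>i<m. \<Sum>e\<in>edges (Hs i). f e)"
  unfolding edges by (rule sum.UNION_disjoint) (use finite_part disj in blast)+

lemma card_edges: "card (edges H) = (\<Sum>i<m. card (edges (Hs i)))"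
  using sum_edges[of "\<lambda>_. 1::nat"] by simp

lemma card_inter_edges: "card (I \<inter> edges H) = (\<Sum>i<m. card (I \<inter> edges (Hs i)))"
proof -
  have "card (\<Union>i<m. I \<inter> edges (Hs i)) = (\<Sum>i<m. card (I \<inter> edges (Hs i)))"
    by (rule card_UN_disjoint) (use disj finite_part in blast)+
  moreover have "(\<Union>i<m. I \<inter> edges (Hs i)) = I \<inter> edges H" unfolding edges by auto
  ultimately show ?thesis by simp
qed

lemma card_part_le: "i < m \<Longrightarrow> card (edges (Hs i)) \<le> card (edges H)"
  unfolding card_edges using member_le_sum[of i "{..<m}" "\<lambda>i. card (edges (Hs i))"] by simp

text \<open>
  A vertex may lie in several parts; any choice of one of them gives the same value.
\<close>
lemma glue:
  assumes "\<And>i j v. i < m \<Longrightarrow> j < m \<Longrightarrow> i < j \<Longrightarrow> v \<in> verts (Hs i) \<inter> verts (Hs j) \<Longrightarrow> P i v = P j v"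
  obtains p where "\<And>i v. i < m \<Longrightarrow> v \<in> verts (Hs i) \<Longrightarrow> p v = P i v"
proof -
  define p where "p v = P (SOME i. i < m \<and> v \<in> verts (Hs i)) v" for v
  have "p v = P i v" if i: "i < m" "v \<in> verts (Hs i)" for i v
  proof -
    define k where "k = (SOME i. i < m \<and> v \<in> verts (Hs i))"
    have k: "k < m \<and> v \<in> verts (Hs k)" unfolding k_def by (rule someI[of _ i]) (use i in simp)
    have "P k v = P i v"
    proof (cases i k rule: linorder_cases)
      case less
      then show ?thesis using assms[of i k v] i k by simp
    next
      case greater
      then show ?thesis using assms[of k i v] i k by simp
    qed simp
    then show ?thesis unfolding p_def k_def .
  qed
  then show thesis by (rule that)
qed

end

text \<open>
  The two terminals are counted once, all other vertices belong to one part only.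
\<close>
lemma (in parallel_parts) card_verts:
  "int (card (verts H)) = 2 + (\<Sum>i<m. int (card (verts (Hs i))) - 2)"
proof -
  have lr: "l \<noteq> r" "\<And>i. i < m \<Longrightarrow> l \<in> verts (Hs i)" "\<And>i. i < m \<Longrightarrow> r \<in> verts (Hs i)"
    using decomposes_terminals[OF dec] pos by simp_all
  have eq: "verts H = {l, r} \<union> (\<Union>i<m. verts (Hs i) - {l, r})"
  proof (intro equalityI subsetI)
    fix v assume "v \<in> {l, r} \<union> (\<Union>i<m. verts (Hs i) - {l, r})"
    then show "v \<in> verts H" unfolding verts using lr(2,3)[OF pos] pos by blast
  qed (use verts in blast)
  have "card (verts H) = card {l, r} + card (\<Union>i<m. verts (Hs i) - {l, r})"
    unfolding eq by (rule card_Un_disjoint) (use finite_part(1) in blast)+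
  moreover have "card (\<Union>i<m. verts (Hs i) - {l, r}) = (\<Sum>i<m. card (verts (Hs i) - {l, r}))"
  proof (rule card_UN_disjoint)
    show "\<forall>i\<in>{..<m}. finite (verts (Hs i) - {l, r})" using finite_part(1) by blast
    show "\<forall>i\<in>{..<m}. \<forall>j\<in>{..<m}. i \<noteq> j \<longrightarrow> (verts (Hs i) - {l, r}) \<inter> (verts (Hs j) - {l, r}) = {}"
    proof (intro ballI impI)
      fix i j assume "i \<in> {..<m}" "j \<in> {..<m}" "i \<noteq> j"
      then have "verts (Hs i) \<inter> verts (Hs j) = {l, r}" by (intro meet) auto
      then show "(verts (Hs i) - {l, r}) \<inter> (verts (Hs j) - {l, r}) = {}" by blast
    qed
  qed simp
  moreover have "(\<Sum>i<m. int (card (verts (Hs i) - {l, r}))) = (\<Sum>i<m. int (card (verts (Hs i))) - 2)"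
  proof (rule sum.cong[OF refl])
    fix i assume "i \<in> {..<m}"
    then have i: "i < m" by simp
    then have "card (verts (Hs i) - {l, r}) = card (verts (Hs i)) - card {l, r}"
      using lr by (intro card_Diff_subset) auto
    then show "int (card (verts (Hs i) - {l, r})) = int (card (verts (Hs i))) - 2"
      using card_part(1)[OF i] lr(1) by simp
  qed
  ultimately show ?thesis using lr(1) by simp
qed

text \<open>
  Each part contributes its vertices except its left terminal, which is the right terminal of
  the part before; the left terminal of the first part is counted separately.
\<close>
lemma (in series_parts) card_verts:
  "int (card (verts H)) = 1 + (\<Sum>i<m. int (card (verts (Hs i))) - 1)"
proof -
  have x: "x i \<in> verts (Hs i)" "x (Suc i) \<in> verts (Hs i)" "x i \<noteq> x (Suc i)" if "i < m" for i
    using decomposes_terminals[OF dec[OF that]] by simp_all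
  have x0: "x 0 \<in> verts H" using x(1)[OF pos] pos verts by auto
  have cov: "v \<in> insert (x 0) (\<Union>i<m. verts (Hs i) - {x i})" if v: "v \<in> verts H" for v
  proof -
    obtain i where i: "i < m" "v \<in> verts (Hs i)" using v unfolding verts by blast
    show ?thesis
    proof (cases "v = x i")
      case False
      then show ?thesis using i by blast
    next
      case True
      show ?thesis
      proof (cases i)
        case 0
        then show ?thesis using True by simp
      next
        case (Suc j)
        then have "v \<in> verts (Hs j) - {x j}" "j < m" using x(2,3)[of j] i True by auto
        then show ?thesis by blast
      qed
    qed
  qed
  have eq: "verts H = insert (x 0) (\<Union>i<m. verts (Hs i) - {x i})"
  proof (intro equalityI subsetI)
    fix v assume "v \<in> insert (x 0) (\<Union>i<m. verts (Hs i) - {x i})"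
    then show "v \<in> verts H" using x0 verts by auto
  qed (rule cov)
  have notin: "x 0 \<notin> (\<Union>i<m. verts (Hs i) - {x i})"
  proof
    assume "x 0 \<in> (\<Union>i<m. verts (Hs i) - {x i})"
    then obtain i where i: "i < m" "x 0 \<in> verts (Hs i)" "x 0 \<noteq> x i" by blast
    then have "0 < i" by (cases i) auto
    have "x 0 \<in> verts (Hs 0) \<inter> verts (Hs i)" using i(2) x(1)[OF pos] by simp
    then have "x 0 \<in> (if i = Suc 0 then {x i} else {})"
      unfolding meet[OF \<open>0 < i\<close> i(1)] .
    then show False using i(3) by (simp split: if_splits)
  qed
  have "finite (\<Union>i<m. verts (Hs i) - {x i})" using finite_part(1) by blast
  then have A: "card (verts H) = Suc (card (\<Union>i<m. verts (Hs i) - {x i}))"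
    unfolding eq using notin by (rule card_insert_disjoint)
  have B: "card (\<Union>i<m. verts (Hs i) - {x i}) = (\<Sum>i<m. card (verts (Hs i) - {x i}))"
  proof (rule card_UN_disjoint)
    have dis: "(verts (Hs i) - {x i}) \<inter> (verts (Hs j) - {x j}) = {}" if "i < j" "j < m" for i j
    proof -
      have "verts (Hs i) \<inter> verts (Hs j) \<subseteq> {x j}" unfolding meet[OF that] by simp
      then show ?thesis by blast
    qed
    show "\<forall>i\<in>{..<m}. \<forall>j\<in>{..<m}. i \<noteq> j \<longrightarrow> (verts (Hs i) - {x i}) \<inter> (verts (Hs j) - {x j}) = {}"
    proof (intro ballI impI)
      fix i j assume ij: "i \<in> {..<m}" "j \<in> {..<m}" "i \<noteq> j"
      then consider "i < j" | "j < i" by linarith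
      then show "(verts (Hs i) - {x i}) \<inter> (verts (Hs j) - {x j}) = {}"
        using dis[of i j] dis[of j i] ij by cases auto
    qed
    show "\<forall>i\<in>{..<m}. finite (verts (Hs i) - {x i})" using finite_part(1) by blast
    show "finite {..<m}" by simp
  qed
  have C: "(\<Sum>i<m. int (card (verts (Hs i) - {x i}))) = (\<Sum>i<m. int (card (verts (Hs i))) - 1)"
  proof (rule sum.cong[OF refl])
    fix i assume "i \<in> {..<m}"
    then have "x i \<in> verts (Hs i)" "2 \<le> card (verts (Hs i))" 
      using x(1) card_part by auto
    then show "int (card (verts (Hs i) - {x i})) = int (card (verts (Hs i))) - 1"
      by (subst card_Diff_singleton) auto
  qed
  show ?thesis unfolding A B using C by simp
qed

section \<open>The surplus and its certificates\<close>

text \<open>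
  The potential difference along an edge up to sign, from its unordered set of ends.
\<close>
definition gap :: "('v \<Rightarrow> real) \<Rightarrow> 'v set \<Rightarrow> real" where
  "gap p S = Max (p ` S) - Min (p ` S)"

lemma gap_pair_square: "(gap p {u, v})\<^sup>2 = (p u - p v)\<^sup>2"
  by (cases "p u \<le> p v") (auto simp: gap_def max_def min_def power2_commute)

text \<open>
  This is \<open>n E\<^sub>I(p) - E\<^sub>H(p)\<close>. In the applications to parts, \<open>n\<close> remains the number of edges of
  the whole graph, which is what makes the surplus additive.
\<close>
definition surplus :: "nat \<Rightarrow> ('e \<Rightarrow> real) \<Rightarrow> ('v, 'e) mgraph \<Rightarrow> 'e set \<Rightarrow> ('v \<Rightarrow> real) \<Rightarrow> real" where
  "surplus n w H I p = (\<Sum>e\<in>edges H. (if e \<in> I then real n - 1 else - 1) * (w e * (gap p (ends H e))\<^sup>2))"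

lemma surplus_cong_potential:
  assumes "decomposes t H l r" "\<And>v. v \<in> verts H \<Longrightarrow> p v = q v"
  shows "surplus n w H I p = surplus n w H I q"
  unfolding surplus_def
proof (rule sum.cong[OF refl])
  fix e assume "e \<in> edges H"
  then obtain u v where "u \<in> verts H" "v \<in> verts H" "ends H e = {u, v}"
    using decomposes_ends[OF assms(1)] by metis
  then show "(if e \<in> I then real n - 1 else - 1) * (w e * (gap p (ends H e))\<^sup>2) =
      (if e \<in> I then real n - 1 else - 1) * (w e * (gap q (ends H e))\<^sup>2)"
    using assms(2) by (simp add: gap_def)
qed

lemma surplus_const:
  assumes "decomposes t H l r"
  shows "surplus n w H I (\<lambda>_. s) = 0"
  unfolding surplus_def
proof (rule sum.neutral, rule ballI)
  fix e assume "e \<in> edges H"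
  then obtain u v where "ends H e = {u, v}"
    using decomposes_ends[OF assms(1)] by metis
  then show "(if e \<in> I then real n - 1 else - 1) * (w e * (gap (\<lambda>_. s) (ends H e))\<^sup>2) = 0"
    by (simp add: gap_def)
qed

lemma (in parts) surplus_parts: "surplus n w H I p = (\<Sum>i<m. surplus n w (Hs i) I p)"
  unfolding surplus_def sum_edges by (intro sum.cong refl) (simp add: ends)

lemma surplus_restrict: "edges H \<inter> I = edges H \<inter> J \<Longrightarrow> surplus n w H I p = surplus n w H J p"
  unfolding surplus_def by (intro sum.cong refl) auto

text \<open>
  \<open>I\<close> has the size of a spanning forest with \<open>j\<close> components: \<open>j = 1\<close> for trees, \<open>j = 2\<close> for forests
  separating the terminals. The last condition is positive definiteness on the potentials with
  equal values at the terminals; it survives compositions, and with \<open>a > 0\<close> it yields positive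
  definiteness altogether.
\<close>
definition certifies ::
    "nat \<Rightarrow> ('e \<Rightarrow> real) \<Rightarrow> ('v, 'e) mgraph \<Rightarrow> 'v \<Rightarrow> 'v \<Rightarrow> 'e set \<Rightarrow> nat \<Rightarrow> real \<Rightarrow> bool" where
  "certifies n w H l r I j a \<longleftrightarrow> I \<subseteq> edges H \<and> card I + j = card (verts H) \<and>
     (\<forall>p. a * (p l - p r)\<^sup>2 \<le> surplus n w H I p) \<and>
     (\<forall>p. p l = p r \<longrightarrow> surplus n w H I p \<le> 0 \<longrightarrow> (\<forall>v\<in>verts H. p v = p l))"

lemma (in parts) certificates_union:
  assumes "\<And>i. i < m \<Longrightarrow> certifies n w (Hs i) (a i) (b i) (I i) (j i) (c i)"
  shows "(\<Union>i<m. I i) \<subseteq> edges H"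
    "int (card (\<Union>i<m. I i)) = (\<Sum>i<m. int (card (verts (Hs i))) - int (j i))"
    "surplus n w H (\<Union>i<m. I i) p = (\<Sum>i<m. surplus n w (Hs i) (I i) p)"
proof -
  have I: "I i \<subseteq> edges (Hs i)" "card (I i) + j i = card (verts (Hs i))" if "i < m" for i
    using assms[OF that] unfolding certifies_def by auto
  show "(\<Union>i<m. I i) \<subseteq> edges H" unfolding edges using I by blast
  have "card (\<Union>i<m. I i) = (\<Sum>i<m. card (I i))"
  proof (rule card_UN_disjoint)
    show "\<forall>i\<in>{..<m}. finite (I i)" using I(1) finite_part(2) finite_subset by blast
    show "\<forall>i\<in>{..<m}. \<forall>j\<in>{..<m}. i \<noteq> j \<longrightarrow> I i \<inter> I j = {}"
    proof (intro ballI impI)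
      fix i j assume "i \<in> {..<m}" "j \<in> {..<m}" "i \<noteq> j"
      then show "I i \<inter> I j = {}" using disj[of i j] I(1)[of i] I(1)[of j] by blast
    qed
  qed simp
  also have "int (\<Sum>i<m. card (I i)) = (\<Sum>i<m. int (card (verts (Hs i))) - int (j i))"
    using I(2)[symmetric] by simp
  finally show "int (card (\<Union>i<m. I i)) = (\<Sum>i<m. int (card (verts (Hs i))) - int (j i))" .
  show "surplus n w H (\<Union>i<m. I i) p = (\<Sum>i<m. surplus n w (Hs i) (I i) p)"
    unfolding surplus_parts
  proof (intro sum.cong refl surplus_restrict)
    fix i assume "i \<in> {..<m}"
    then have i: "i < m" by simp
    have "edges (Hs i) \<inter> I k \<subseteq> I i" if "k < m" for k
      using disj[OF i that] I(1)[OF that] by (cases "k = i") auto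
    then show "edges (Hs i) \<inter> (\<Union>i<m. I i) = edges (Hs i) \<inter> I i" using i by blast
  qed
qed

text \<open>
  All parts see the same potential difference, so conductances add.
\<close>
lemma (in parallel_parts) certifies_parallel:
  assumes cert: "\<And>i. i < m \<Longrightarrow> certifies n w (Hs i) l r (I i) (j i) (c i)"
    and j: "int J = 2 + (\<Sum>i<m. int (j i) - 2)"
  shows "certifies n w H l r (\<Union>i<m. I i) J (\<Sum>i<m. c i)"
  unfolding certifies_def
proof (intro conjI allI impI ballI)
  have u: "(\<Union>i<m. I i) \<subseteq> edges H"
    "int (card (\<Union>i<m. I i)) = (\<Sum>i<m. int (card (verts (Hs i))) - int (j i))"
    and u3: "surplus n w H (\<Union>i<m. I i) q = (\<Sum>i<m. surplus n w (Hs i) (I i) q)" for q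
    by (rule certificates_union[of n w I j c]; erule cert)+
  show "(\<Union>i<m. I i) \<subseteq> edges H" by (rule u(1))
  have "int (card (\<Union>i<m. I i)) + int J = int (card (verts H))"
    using u(2) unfolding j card_verts by (simp add: sum_subtractf)
  then show "card (\<Union>i<m. I i) + J = card (verts H)" by linarith
  fix p
  have low: "c i * (p l - p r)\<^sup>2 \<le> surplus n w (Hs i) (I i) p" if "i < m" for i
    using cert[OF that] unfolding certifies_def by blast
  then show "(\<Sum>i<m. c i) * (p l - p r)\<^sup>2 \<le> surplus n w H (\<Union>i<m. I i) p"
    unfolding u3 by (subst sum_distrib_right) (intro sum_mono, simp)
  fix v
  assume eq: "p l = p r" and le: "surplus n w H (\<Union>i<m. I i) p \<le> 0" and v: "v \<in> verts H"
  have nn: "0 \<le> surplus n w (Hs i) (I i) p" if "i < m" for i using low[OF that] eq by simp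
  obtain i where i: "i < m" "v \<in> verts (Hs i)" using v unfolding verts by blast
  have "surplus n w (Hs i) (I i) p \<le> (\<Sum>i<m. surplus n w (Hs i) (I i) p)"
    by (rule member_le_sum[of i "{..<m}" "\<lambda>i. surplus n w (Hs i) (I i) p"]) (use i nn in auto)
  then have "surplus n w (Hs i) (I i) p \<le> 0" using le unfolding u3 by simp
  then show "p v = p l" using cert[OF i(1)] eq i(2) unfolding certifies_def by blast
qed

text \<open>
  The parts see arbitrary differences \<open>d i\<close> with sum \<open>p l - p r\<close>. The two hypotheses on the
  diagonal form are established in the next section for the two sign patterns that occur.
\<close>
lemma (in series_parts) certifies_series:
  assumes cert: "\<And>i. i < m \<Longrightarrow> certifies n w (Hs i) (x i) (x (Suc i)) (I i) (j i) (c i)"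
    and j: "int J = 1 + (\<Sum>i<m. int (j i) - 1)"
    and form: "\<And>d :: nat \<Rightarrow> real. C * (\<Sum>i<m. d i)\<^sup>2 \<le> (\<Sum>i<m. c i * (d i)\<^sup>2)"
    and definite: "\<And>d :: nat \<Rightarrow> real. (\<Sum>i<m. d i) = 0 \<Longrightarrow> (\<Sum>i<m. c i * (d i)\<^sup>2) \<le> 0 \<Longrightarrow> \<forall>i<m. d i = 0"
  shows "certifies n w H (x 0) (x m) (\<Union>i<m. I i) J C"
  unfolding certifies_def
proof (intro conjI allI impI ballI)
  have u: "(\<Union>i<m. I i) \<subseteq> edges H"
    "int (card (\<Union>i<m. I i)) = (\<Sum>i<m. int (card (verts (Hs i))) - int (j i))"
    and u3: "surplus n w H (\<Union>i<m. I i) q = (\<Sum>i<m. surplus n w (Hs i) (I i) q)" for q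
    by (rule certificates_union[of n w I j c]; erule cert)+
  show "(\<Union>i<m. I i) \<subseteq> edges H" by (rule u(1))
  have "int (card (\<Union>i<m. I i)) + int J = int (card (verts H))"
    using u(2) unfolding j card_verts by (simp add: sum_subtractf)
  then show "card (\<Union>i<m. I i) + J = card (verts H)" by linarith
  fix p :: "'v \<Rightarrow> real"
  define d where "d i = p (x i) - p (x (Suc i))" for i
  have tele: "(\<Sum>i<k. d i) = p (x 0) - p (x k)" for k
    by (induction k) (auto simp: d_def)
  have low: "c i * (d i)\<^sup>2 \<le> surplus n w (Hs i) (I i) p" if "i < m" for i
    using cert[OF that] unfolding certifies_def d_def by blast
  then have sum_low: "(\<Sum>i<m. c i * (d i)\<^sup>2) \<le> surplus n w H (\<Union>i<m. I i) p"
    unfolding u3 by (intro sum_mono) simp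
  then show "C * (p (x 0) - p (x m))\<^sup>2 \<le> surplus n w H (\<Union>i<m. I i) p"
    using form[of d] unfolding tele by linarith
  fix v
  assume eq: "p (x 0) = p (x m)" and le: "surplus n w H (\<Union>i<m. I i) p \<le> 0" and v: "v \<in> verts H"
  have d0: "\<forall>i<m. d i = 0" by (rule definite) (use eq le sum_low tele[of m] in auto)
  have px: "p (x k) = p (x 0)" if "k \<le> m" for k
    using tele[of k] d0 that by simp
  have nn: "0 \<le> surplus n w (Hs i) (I i) p" if "i < m" for i using low[OF that] d0 that by simp
  obtain i where i: "i < m" "v \<in> verts (Hs i)" using v unfolding verts by blast
  have "surplus n w (Hs i) (I i) p \<le> (\<Sum>i<m. surplus n w (Hs i) (I i) p)"
    by (rule member_le_sum[of i "{..<m}" "\<lambda>i. surplus n w (Hs i) (I i) p"]) (use i nn in auto)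
  then have "surplus n w (Hs i) (I i) p \<le> 0" using le unfolding u3 by simp
  moreover have "p (x i) = p (x (Suc i))" using px[of i] px[of "Suc i"] i by simp
  ultimately have "p v = p (x i)" using cert[OF i(1)] i(2) unfolding certifies_def by blast
  then show "p v = p (x 0)" using px[of i] i by simp
qed

section \<open>Conductances in series\<close>

text \<open>
  For nonzero conductances of any sign, \<open>C\<close> with \<open>1 / C = (\<Sum>i. 1 / c i)\<close> is the stationary value of
  the energy at total difference \<open>1\<close>; the remainder is the energy of the deviation from the
  stationary distribution.
\<close>
lemma series_identity:
  fixes c :: "'i \<Rightarrow> real"
  assumes "finite S" "\<And>i. i \<in> S \<Longrightarrow> c i \<noteq> 0" "(\<Sum>i\<in>S. 1 / c i) = 1 / C" "C \<noteq> 0"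
  shows "(\<Sum>i\<in>S. c i * (d i)\<^sup>2) =
    C * (\<Sum>i\<in>S. d i)\<^sup>2 + (\<Sum>i\<in>S. c i * (d i - C * (\<Sum>i\<in>S. d i) / c i)\<^sup>2)"
proof -
  define D where "D = (\<Sum>i\<in>S. d i)"
  have "(\<Sum>i\<in>S. c i * (d i - C * D / c i)\<^sup>2) =
    (\<Sum>i\<in>S. c i * (d i)\<^sup>2 - 2 * C * D * d i + C\<^sup>2 * D\<^sup>2 * (1 / c i))"
    by (intro sum.cong refl) (use assms(2) in \<open>simp add: power2_eq_square field_simps\<close>)
  also have "\<dots> = (\<Sum>i\<in>S. c i * (d i)\<^sup>2) - 2 * C * D * (\<Sum>i\<in>S. d i) + C\<^sup>2 * D\<^sup>2 * (\<Sum>i\<in>S. 1 / c i)"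
    by (simp only: sum.distrib sum_subtractf sum_distrib_left)
  also have "\<dots> = (\<Sum>i\<in>S. c i * (d i)\<^sup>2) - C * D\<^sup>2"
    unfolding assms(3) D_def[symmetric] using assms(4) by (simp add: power2_eq_square)
  finally show ?thesis unfolding D_def by simp
qed

lemma series_form_lower:
  fixes c :: "'i \<Rightarrow> real"
  assumes "finite S" "\<And>i. i \<in> S \<Longrightarrow> 0 < c i" "(\<Sum>i\<in>S. 1 / c i) = 1 / C" "0 < C"
  shows "C * (\<Sum>i\<in>S. d i)\<^sup>2 \<le> (\<Sum>i\<in>S. c i * (d i)\<^sup>2)"
proof -
  have "0 \<le> (\<Sum>i\<in>S. c i * (d i - C * (\<Sum>i\<in>S. d i) / c i)\<^sup>2)"
    by (intro sum_nonneg) (use assms(2) in \<open>simp add: less_imp_le\<close>)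
  then show ?thesis
    using series_identity[OF assms(1) _ assms(3), of d] assms(2,4) by fastforce
qed

lemma positive_form_definite:
  fixes c :: "'i \<Rightarrow> real"
  assumes "finite S" "\<And>i. i \<in> S \<Longrightarrow> 0 < c i" "(\<Sum>i\<in>S. c i * (d i)\<^sup>2) \<le> 0"
  shows "\<forall>i\<in>S. d i = 0"
proof -
  have "(\<Sum>i\<in>S. c i * (d i)\<^sup>2) = 0"
    by (rule antisym[OF assms(3)]) (intro sum_nonneg, use assms(2) in \<open>simp add: less_imp_le\<close>)
  then have "\<forall>i\<in>S. c i * (d i)\<^sup>2 = 0"
    by (subst (asm) sum_nonneg_eq_0_iff) (use assms(1,2) in \<open>auto simp: less_imp_le\<close>)
  then show ?thesis using assms(2) by fastforce
qed

text \<open>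
  With the one negative conductance \<open>c k = - b\<close> moved to the other side, the claim reads
  \<open>b (d k)\<^sup>2 \<le> B D\<^sup>2 + (\<Sum>i\<noteq>k. c i (d i)\<^sup>2)\<close> with \<open>D\<close> the sum of all \<open>d i\<close>. This is the inequality for
  positive conductances in which a spring of conductance \<open>B\<close> replaces part \<open>k\<close>, since \<open>d k\<close> is \<open>D\<close>
  minus the other differences.
\<close>
lemma series_form_one_negative:
  fixes c :: "'i \<Rightarrow> real"
  assumes S: "finite S" "k \<in> S" and c: "\<And>i. i \<in> S - {k} \<Longrightarrow> 0 < c i" and b: "0 < b" "0 < B"
    and ck: "c k = - b" and inv: "1 / B = 1 / b - (\<Sum>i\<in>S - {k}. 1 / c i)"
  shows "- B * (\<Sum>i\<in>S. d i)\<^sup>2 \<le> (\<Sum>i\<in>S. c i * (d i)\<^sup>2)"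
    and "(\<Sum>i\<in>S. d i) = 0 \<Longrightarrow> (\<Sum>i\<in>S. c i * (d i)\<^sup>2) \<le> 0 \<Longrightarrow> \<forall>i\<in>S. d i = 0"
proof -
  let ?R = "S - {k}"
  define D where "D = (\<Sum>i\<in>S. d i)"
  have D: "D = d k + (\<Sum>i\<in>?R. d i)" unfolding D_def using S by (rule sum.remove)
  have Q: "(\<Sum>i\<in>S. c i * (d i)\<^sup>2) = - b * (d k)\<^sup>2 + (\<Sum>i\<in>?R. c i * (d i)\<^sup>2)"
    using sum.remove[OF S, of "\<lambda>i. c i * (d i)\<^sup>2"] ck by simp
  define c' where "c' = (\<lambda>i. if i = k then B else c i)"
  define d' where "d' = (\<lambda>i. if i = k then D else - d i)"
  have rR: "(\<Sum>i\<in>?R. f (c' i) (d' i)) = (\<Sum>i\<in>?R. f (c i) (- d i))" for f :: "real \<Rightarrow> real \<Rightarrow> real"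
    by (intro sum.cong refl) (auto simp: c'_def d'_def)
  have r: "(\<Sum>i\<in>S. f (c' i) (d' i)) = f B D + (\<Sum>i\<in>?R. f (c i) (- d i))" for f :: "real \<Rightarrow> real \<Rightarrow> real"
    unfolding sum.remove[OF S, of "\<lambda>i. f (c' i) (d' i)"] rR[of f] by (simp add: c'_def d'_def)
  have low: "b * (\<Sum>i\<in>S. d' i)\<^sup>2 \<le> (\<Sum>i\<in>S. c' i * (d' i)\<^sup>2)"
  proof (rule series_form_lower[OF S(1) _ _ b(1)])
    show "0 < c' i" if "i \<in> S" for i using that c[of i] b(2) by (auto simp: c'_def)
    show "(\<Sum>i\<in>S. 1 / c' i) = 1 / b" using r[of "\<lambda>x _. 1 / x"] inv by simp
  qed
  have "(\<Sum>i\<in>S. d' i) = d k" using r[of "\<lambda>_ x. x"] D by (simp add: sum_negf)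
  moreover have "(\<Sum>i\<in>S. c' i * (d' i)\<^sup>2) = B * D\<^sup>2 + (\<Sum>i\<in>?R. c i * (d i)\<^sup>2)"
    using r[of "\<lambda>x y. x * y\<^sup>2"] by simp
  ultimately show "- B * (\<Sum>i\<in>S. d i)\<^sup>2 \<le> (\<Sum>i\<in>S. c i * (d i)\<^sup>2)"
    using low unfolding Q D_def[symmetric] by simp
  assume "(\<Sum>i\<in>S. d i) = 0" and le: "(\<Sum>i\<in>S. c i * (d i)\<^sup>2) \<le> 0"
  then have D0: "D = 0" unfolding D_def by simp
  \<comment> \<open>slack: the other parts alone have resistance strictly below \<open>1/b\<close>\<close>
  show "\<forall>i\<in>S. d i = 0"
  proof (cases "?R = {}")
    case True
    have "d k = 0" using D0 D unfolding True by simp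
    then show ?thesis using True by blast
  next
    case False
    define u where "u = (\<Sum>i\<in>?R. 1 / c i)"
    have u: "0 < u" unfolding u_def by (rule sum_pos) (use S False c in auto)
    have "(1 / u) * (\<Sum>i\<in>?R. d i)\<^sup>2 \<le> (\<Sum>i\<in>?R. c i * (d i)\<^sup>2)"
      by (rule series_form_lower) (use S c u in \<open>auto simp: u_def\<close>)
    moreover have "(\<Sum>i\<in>?R. d i) = - d k" using D D0 by simp
    ultimately have "(1 / u) * (d k)\<^sup>2 \<le> (\<Sum>i\<in>?R. c i * (d i)\<^sup>2)" by simp
    then have "(1 / u - b) * (d k)\<^sup>2 \<le> 0" using le unfolding Q by (simp add: algebra_simps)
    moreover have "0 < 1 / B" using b(2) by simp
    then have "u < 1 / b" using inv unfolding u_def[symmetric] by linarith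
    then have "0 < 1 / u - b" using u b by (simp add: field_simps)
    ultimately have "(d k)\<^sup>2 \<le> 0" by (simp add: mult_le_0_iff)
    then have dk: "d k = 0" by simp
    then have "(\<Sum>i\<in>?R. c i * (d i)\<^sup>2) \<le> 0" using le unfolding Q by simp
    then have "\<forall>i\<in>?R. d i = 0" by (rule positive_form_definite[rotated 2]) (use S c in auto)
    then show ?thesis using dk by auto
  qed
qed

section \<open>Good certificates exist\<close>

text \<open>
  The recursion that characterises equality: weights with factor \<open>c\<close> make a part with \<open>m\<close> edges
  have conductances \<open>c (n - m)\<close> and \<open>- c m\<close>. Parallel parts need the same \<open>c\<close>. The parts of a series
  composition need the same \<open>c i * (n - m i) * m i\<close>, whose common value is \<open>c * phi n m\<close>.
\<close>
fun calibrated :: "nat \<Rightarrow> real \<Rightarrow> 'e dtree \<Rightarrow> ('e \<Rightarrow> real) \<Rightarrow> bool" where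
  "calibrated n c (Leaf e) w \<longleftrightarrow> w e = c"
| "calibrated n c (Par ts) w \<longleftrightarrow> (\<forall>t\<in>set ts. calibrated n c t w)"
| "calibrated n c (Ser ts) w \<longleftrightarrow>
     (\<forall>t\<in>set ts. calibrated n (c * phi n (card (leaf_edges (Ser ts))) / phi n (card (leaf_edges t))) t w)"

text \<open>
  The induction claim. In the case of equality the weights are calibrated with factor \<open>b / m\<close>.
\<close>
definition well_certified ::
    "nat \<Rightarrow> ('e \<Rightarrow> real) \<Rightarrow> 'e dtree \<Rightarrow> ('v, 'e) mgraph \<Rightarrow> 'v \<Rightarrow> 'v \<Rightarrow> bool" where
  "well_certified n w t H l r \<longleftrightarrow> (\<exists>T F a b.
     certifies n w H l r T 1 a \<and> certifies n w H l r F 2 (- b) \<and> 0 < b \<and>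
     (let m = real (card (edges H)) in
       b * (real n - m) < a * m \<or> b * (real n - m) = a * m \<and> calibrated n (b / m) t w))"

text \<open>
  Both compositions lead to this averaging argument: parallel compositions with \<open>x = b\<close>, \<open>y = a\<close>,
  series compositions with \<open>x = 1 / a\<close>, \<open>y = 1 / b\<close>, where \<open>\<mu> i\<close> is the number of edges of part \<open>i\<close>. If
  no part \<open>k\<close> is strictly better than the average, then \<open>x i / \<mu> i\<close> is at most its own average for
  every \<open>i\<close>, hence constant, and every inequality used on the way is an equality.
\<close>
lemma composition_choice:
  fixes x y \<mu> :: "'i \<Rightarrow> real" and n :: real
  assumes S: "finite S" "S \<noteq> {}" and pos: "\<And>i. i \<in> S \<Longrightarrow> 0 < x i" "\<And>i. i \<in> S \<Longrightarrow> 0 < \<mu> i" "0 < n"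
    and le: "\<And>i. i \<in> S \<Longrightarrow> n * x i \<le> (x i + y i) * \<mu> i"
  obtains k where "k \<in> S" "n * sum x S < (x k + y k) * sum \<mu> S"
  | k where "k \<in> S" "n * sum x S = (x k + y k) * sum \<mu> S"
      "\<And>i. i \<in> S \<Longrightarrow> (x i + y i) * \<mu> i = n * x i" "\<And>i. i \<in> S \<Longrightarrow> x i * sum \<mu> S = sum x S * \<mu> i"
proof (cases "\<exists>k\<in>S. n * sum x S < (x k + y k) * sum \<mu> S")
  case True
  then show thesis using that(1) by blast
next
  case False
  then have ub: "(x i + y i) * sum \<mu> S \<le> n * sum x S" if "i \<in> S" for i using that by force
  have M: "0 < sum \<mu> S" by (rule sum_pos) (use S pos in auto)
  have up: "x i * sum \<mu> S \<le> sum x S * \<mu> i" if i: "i \<in> S" for i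
  proof -
    have "n * (x i * sum \<mu> S) \<le> (x i + y i) * \<mu> i * sum \<mu> S"
      using mult_right_mono[OF le[OF i], of "sum \<mu> S"] M by (simp add: mult.assoc)
    also have "\<dots> \<le> n * (sum x S * \<mu> i)"
      using mult_right_mono[OF ub[OF i], of "\<mu> i"] pos(2)[OF i] by (simp add: algebra_simps)
    finally show ?thesis using pos(3) by simp
  qed
  have "(\<Sum>i\<in>S. sum x S * \<mu> i - x i * sum \<mu> S) = 0"
    by (simp add: sum_subtractf sum_distrib_left[symmetric] sum_distrib_right[symmetric])
  then have eq: "x i * sum \<mu> S = sum x S * \<mu> i" if "i \<in> S" for i
    using that up S(1) by (subst (asm) sum_nonneg_eq_0_iff) auto
  have eq2: "(x i + y i) * \<mu> i = n * x i" if i: "i \<in> S" for i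
  proof (rule antisym[OF _ le[OF i]])
    have "(x i + y i) * \<mu> i * sum \<mu> S \<le> n * (sum x S * \<mu> i)"
      using mult_right_mono[OF ub[OF i], of "\<mu> i"] pos(2)[OF i] by (simp add: algebra_simps)
    also have "\<dots> = n * x i * sum \<mu> S" by (simp add: eq[OF i, symmetric])
    finally show "(x i + y i) * \<mu> i \<le> n * x i" using M by simp
  qed
  obtain k where k: "k \<in> S" using S by auto
  have "n * (sum x S * \<mu> k) = (x k + y k) * sum \<mu> S * \<mu> k"
    by (simp add: eq[OF k, symmetric] eq2[OF k, symmetric])
  then have "n * sum x S = (x k + y k) * sum \<mu> S" using pos(2)[OF k] by simp
  then show thesis using that(2)[OF k] eq eq2 by blast
qed

lemma well_certified_leaf:
  assumes "l \<noteq> r" "verts H = {l, r}" "edges H = {e}" "ends H e = {l, r}" "0 < w e" "1 < n"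
  shows "well_certified n w (Leaf e) H l r"
proof -
  have "certifies n w H l r {e} 1 ((real n - 1) * w e)" "certifies n w H l r {} 2 (- w e)"
    using assms unfolding certifies_def surplus_def by (auto simp: gap_pair_square)
  then show ?thesis unfolding well_certified_def Let_def
    by (intro exI conjI) (use assms in auto)
qed

text \<open>
  Forest: forests in all parts. Tree: a tree in part \<open>k\<close> and forests elsewhere, with
  conductance \<open>a k - (\<Sum>i\<noteq>k. b i) = b k + a k - (\<Sum>i. b i)\<close>.
\<close>
lemma well_certified_parallel:
  assumes "parallel_parts (length ts) ((!) ts) Hs H l r" "0 < n"
    and good: "\<And>i. i < length ts \<Longrightarrow> well_certified n w (ts ! i) (Hs i) l r"
  shows "well_certified n w (Par ts) H l r"
proof -
  interpret parallel_parts "length ts" "(!) ts" Hs H l r by fact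
  let ?S = "{..<length ts}"
  define \<mu> where "\<mu> i = real (card (edges (Hs i)))" for i
  obtain T F a b where cert: "\<And>i. i < length ts \<Longrightarrow> certifies n w (Hs i) l r (T i) 1 (a i)"
      "\<And>i. i < length ts \<Longrightarrow> certifies n w (Hs i) l r (F i) 2 (- b i)"
    and b: "\<And>i. i < length ts \<Longrightarrow> 0 < b i"
    and ab: "\<And>i. i < length ts \<Longrightarrow> b i * (real n - \<mu> i) < a i * \<mu> i \<or>
      b i * (real n - \<mu> i) = a i * \<mu> i \<and> calibrated n (b i / \<mu> i) (ts ! i) w"
    using good unfolding well_certified_def Let_def \<mu>_def by metis
  have \<mu>: "0 < \<mu> i" if "i < length ts" for i using card_part(2)[OF that] by (simp add: \<mu>_def)
  have m: "real (card (edges H)) = sum \<mu> ?S" unfolding card_edges by (simp add: \<mu>_def)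
  have S: "finite ?S" "?S \<noteq> {}" using pos by auto
  have M: "0 < sum \<mu> ?S" by (rule sum_pos) (use S \<mu> in auto)
  have B: "0 < sum b ?S" by (rule sum_pos) (use S b in auto)
  have F: "certifies n w H l r (\<Union>i<length ts. F i) 2 (- sum b ?S)"
    using certifies_parallel[of n w F "\<lambda>_. 2" "\<lambda>i. - b i" 2] cert(2) by (simp add: sum_negf)
  have T: "\<exists>T'. certifies n w H l r T' 1 (b k + a k - sum b ?S)" if k: "k < length ts" for k
  proof -
    have k': "k \<in> ?S" using k by simp
    have s: "(\<Sum>i\<in>?S. if i = k then f else g i) = f - g k + sum g ?S" for f and g :: "nat \<Rightarrow> 'z :: ab_group_add"
      using sum.remove[OF S(1) k', of "\<lambda>i. if i = k then f else g i"] sum.remove[OF S(1) k', of g]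
      by (simp cong: sum.cong_simp)
    have "certifies n w H l r (\<Union>i<length ts. if i = k then T i else F i) 1 (\<Sum>i\<in>?S. if i = k then a k else - b i)"
    proof (rule certifies_parallel[where j = "\<lambda>i. if i = k then 1 else 2"])
      show "int 1 = 2 + (\<Sum>i<length ts. int (if i = k then 1 else 2) - 2)"
      proof -
        have e: "(\<lambda>i. int (if i = k then 1 else 2) - 2) = (\<lambda>i. if i = k then - 1 else 0)" by auto
        show ?thesis unfolding e using k by simp
      qed
    qed (use cert in auto)
    then show ?thesis unfolding s by (auto simp: sum_negf algebra_simps)
  qed
  have le: "real n * b i \<le> (b i + a i) * \<mu> i" if "i \<in> ?S" for i
    using ab[of i] that by (auto simp: algebra_simps)
  show ?thesis
  proof (rule composition_choice[OF S, of b \<mu> "real n" a])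
    show "0 < b i" "0 < \<mu> i" if "i \<in> ?S" for i using that b \<mu> by auto
    show "0 < real n" using assms(2) by simp
    show "real n * b i \<le> (b i + a i) * \<mu> i" if "i \<in> ?S" for i using that by (rule le)
  next
    fix k assume k: "k \<in> ?S" "real n * sum b ?S < (b k + a k) * sum \<mu> ?S"
    then obtain T' where "certifies n w H l r T' 1 (b k + a k - sum b ?S)" using T by auto
    then show ?thesis using F B k(2) unfolding well_certified_def m Let_def
      by (intro exI conjI disjI1) (auto simp: algebra_simps)
  next
    fix k assume k: "k \<in> ?S" "real n * sum b ?S = (b k + a k) * sum \<mu> ?S"
      and e1: "\<And>i. i \<in> ?S \<Longrightarrow> (b i + a i) * \<mu> i = real n * b i"
      and e2: "\<And>i. i \<in> ?S \<Longrightarrow> b i * sum \<mu> ?S = sum b ?S * \<mu> i"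
    obtain T' where T': "certifies n w H l r T' 1 (b k + a k - sum b ?S)" using T[of k] k(1) by blast
    have "calibrated n (sum b ?S / sum \<mu> ?S) (ts ! i) w" if i: "i < length ts" for i
    proof -
      have "b i / \<mu> i = sum b ?S / sum \<mu> ?S" using e2[of i] i \<mu>[OF i] M by (simp add: field_simps)
      moreover have "calibrated n (b i / \<mu> i) (ts ! i) w"
        using ab[OF i] e1[of i] i by (auto simp: algebra_simps)
      ultimately show ?thesis by simp
    qed
    then have "calibrated n (sum b ?S / sum \<mu> ?S) (Par ts) w" by (auto simp: in_set_conv_nth)
    moreover have "sum b ?S * (real n - sum \<mu> ?S) = (b k + a k - sum b ?S) * sum \<mu> ?S"
      using k(2) by (simp add: algebra_simps)
    ultimately show ?thesis using F B T' unfolding well_certified_def m Let_def by blast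
  qed
qed

text \<open>
  In terms of resistances \<open>u = 1 / a\<close> and \<open>v = 1 / b\<close> this is dual to the parallel case: trees
  in all parts have resistance \<open>\<Sum>i. u i\<close>, and a forest in part \<open>k\<close> with trees elsewhere gives
  \<open>1 / b = v k + u k - (\<Sum>i. u i)\<close>. Having fewer than \<open>n\<close> edges ensures \<open>a i > 0\<close>.
\<close>
lemma well_certified_series:
  assumes "series_parts (length ts) ((!) ts) Hs H x" "card (edges H) < n"
    and good: "\<And>i. i < length ts \<Longrightarrow> well_certified n w (ts ! i) (Hs i) (x i) (x (Suc i))"
  shows "well_certified n w (Ser ts) H (x 0) (x (length ts))"
proof -
  interpret series_parts "length ts" "(!) ts" Hs H x by fact
  let ?S = "{..<length ts}"
  define \<mu> where "\<mu> i = real (card (edges (Hs i)))" for i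
  obtain T F a b where cert: "\<And>i. i < length ts \<Longrightarrow> certifies n w (Hs i) (x i) (x (Suc i)) (T i) 1 (a i)"
      "\<And>i. i < length ts \<Longrightarrow> certifies n w (Hs i) (x i) (x (Suc i)) (F i) 2 (- b i)"
    and b: "\<And>i. i < length ts \<Longrightarrow> 0 < b i"
    and ab: "\<And>i. i < length ts \<Longrightarrow> b i * (real n - \<mu> i) < a i * \<mu> i \<or>
      b i * (real n - \<mu> i) = a i * \<mu> i \<and> calibrated n (b i / \<mu> i) (ts ! i) w"
    using good unfolding well_certified_def Let_def \<mu>_def by metis
  have \<mu>: "0 < \<mu> i" "\<mu> i < real n" if "i < length ts" for i
    using card_part(2)[OF that] card_part_le[OF that] assms(2) by (auto simp: \<mu>_def)
  have m: "real (card (edges H)) = sum \<mu> ?S" unfolding card_edges by (simp add: \<mu>_def)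
  have S: "finite ?S" "?S \<noteq> {}" using pos by auto
  have M: "0 < sum \<mu> ?S" "sum \<mu> ?S < real n" by (rule sum_pos) (use S \<mu> m assms(2) in auto)
  have a: "0 < a i" if i: "i < length ts" for i
  proof -
    have "0 < b i * (real n - \<mu> i)" using b[OF i] \<mu>[OF i] by simp
    then have "0 < a i * \<mu> i" using ab[OF i] by auto
    then show ?thesis using \<mu>(1)[OF i] by (simp add: zero_less_mult_iff)
  qed
  define u where "u i = 1 / a i" for i
  define v where "v i = 1 / b i" for i
  have U: "0 < sum u ?S" by (rule sum_pos) (use S a in \<open>auto simp: u_def\<close>)
  have T: "certifies n w H (x 0) (x (length ts)) (\<Union>i<length ts. T i) 1 (1 / sum u ?S)"
  proof (rule certifies_series[where j = "\<lambda>_. 1"])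
    fix d :: "nat \<Rightarrow> real"
    show "1 / sum u ?S * (\<Sum>i<length ts. d i)\<^sup>2 \<le> (\<Sum>i<length ts. a i * (d i)\<^sup>2)"
      by (rule series_form_lower) (use S a U in \<open>auto simp: u_def\<close>)
    show "\<forall>i<length ts. d i = 0" if "(\<Sum>i<length ts. a i * (d i)\<^sup>2) \<le> 0"
      using positive_form_definite[of ?S a d] a that by auto
  qed (use cert in auto)
  have F: "\<exists>F'. certifies n w H (x 0) (x (length ts)) F' 2 (- (1 / (u k + v k - sum u ?S)))"
    if k: "k < length ts" and B: "0 < u k + v k - sum u ?S" for k
  proof -
    define c where "c = (\<lambda>i. if i = k then - b k else a i)"
    have k': "k \<in> ?S" using k by simp
    have inv: "1 / (1 / (u k + v k - sum u ?S)) = 1 / b k - (\<Sum>i\<in>?S - {k}. 1 / c i)"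
      using sum.remove[OF S(1) k', of u] by (simp add: c_def u_def v_def cong: sum.cong_simp)
    have cp: "0 < c i" if "i \<in> ?S - {k}" for i using that a by (auto simp: c_def)
    have ck: "c k = - b k" by (simp add: c_def)
    note form = series_form_one_negative[OF S(1) k' cp b[OF k] _ ck inv]
    have "certifies n w H (x 0) (x (length ts)) (\<Union>i<length ts. if i = k then F i else T i) 2
      (- (1 / (u k + v k - sum u ?S)))"
    proof (rule certifies_series[where j = "\<lambda>i. if i = k then 2 else 1" and c = c])
      show "int 2 = 1 + (\<Sum>i<length ts. int (if i = k then 2 else 1) - 1)"
      proof -
        have e: "(\<lambda>i. int (if i = k then 2 else 1) - 1) = (\<lambda>i. if i = k then 1 else 0)" by auto
        show ?thesis unfolding e using k by simp
      qed
      fix d :: "nat \<Rightarrow> real"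
      show "- (1 / (u k + v k - sum u ?S)) * (\<Sum>i<length ts. d i)\<^sup>2 \<le> (\<Sum>i<length ts. c i * (d i)\<^sup>2)"
        by (rule form(1)) (use B in auto)
      show "\<forall>i<length ts. d i = 0" if "(\<Sum>i<length ts. d i) = 0" "(\<Sum>i<length ts. c i * (d i)\<^sup>2) \<le> 0"
        using form(2)[of d] B that by auto
    qed (use cert in \<open>auto simp: c_def\<close>)
    then show ?thesis by blast
  qed
  have nu: "real n * u i = (u i + u i * (real n - \<mu> i) / \<mu> i) * \<mu> i" if "i < length ts" for i
    using \<mu>[OF that] by (simp add: field_simps)
  have uv: "u i * (real n - \<mu> i) < v i * \<mu> i \<or>
      u i * (real n - \<mu> i) = v i * \<mu> i \<and> calibrated n (b i / \<mu> i) (ts ! i) w" if i: "i < length ts" for i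
    using ab[OF i] a[OF i] b[OF i] by (auto simp: u_def v_def field_simps)
  have good: ?thesis if k: "k < length ts" and ge: "real n * sum u ?S \<le> (u k + v k) * sum \<mu> ?S"
    and strict: "real n * sum u ?S = (u k + v k) * sum \<mu> ?S \<Longrightarrow>
      calibrated n ((1 / (u k + v k - sum u ?S)) / sum \<mu> ?S) (Ser ts) w" for k
  proof -
    define V where "V = u k + v k - sum u ?S"
    have "0 < (real n - sum \<mu> ?S) * sum u ?S" using M U by simp
    also have le: "(real n - sum \<mu> ?S) * sum u ?S \<le> V * sum \<mu> ?S" using ge by (simp add: V_def algebra_simps)
    finally have V: "0 < V" using M(1) by (simp add: zero_less_mult_iff)
    obtain F' where F': "certifies n w H (x 0) (x (length ts)) F' 2 (- (1 / V))"
      using F[OF k] V unfolding V_def by blast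
    have "1 / V * (real n - sum \<mu> ?S) < 1 / sum u ?S * sum \<mu> ?S \<or>
      1 / V * (real n - sum \<mu> ?S) = 1 / sum u ?S * sum \<mu> ?S \<and> calibrated n (1 / V / sum \<mu> ?S) (Ser ts) w"
    proof (cases "(real n - sum \<mu> ?S) * sum u ?S = V * sum \<mu> ?S")
      case True
      then have "calibrated n (1 / V / sum \<mu> ?S) (Ser ts) w"
        using strict unfolding V_def by (simp add: algebra_simps)
      then show ?thesis using True U V by (simp add: field_simps)
    next
      case False
      then have "(real n - sum \<mu> ?S) * sum u ?S < V * sum \<mu> ?S" using le by simp
      then show ?thesis using U V by (simp add: field_simps)
    qed
    moreover have "0 < 1 / V" using V by simp
    ultimately show ?thesis using F' T unfolding well_certified_def m Let_def by blast
  qed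
  show ?thesis
  proof (rule composition_choice[OF S, of u \<mu> "real n" v])
    show "0 < u i" "0 < \<mu> i" if "i \<in> ?S" for i using that a \<mu> by (auto simp: u_def)
    show "0 < real n" using assms(2) by simp
    show "real n * u i \<le> (u i + v i) * \<mu> i" if "i \<in> ?S" for i
      using uv[of i] that by (auto simp: algebra_simps)
  next
    fix k assume "k \<in> ?S" "real n * sum u ?S < (u k + v k) * sum \<mu> ?S"
    then show ?thesis by (intro good[of k]) auto
  next
    fix k assume k: "k \<in> ?S" "real n * sum u ?S = (u k + v k) * sum \<mu> ?S"
      and e1: "\<And>i. i \<in> ?S \<Longrightarrow> (u i + v i) * \<mu> i = real n * u i"
      and e2: "\<And>i. i \<in> ?S \<Longrightarrow> u i * sum \<mu> ?S = sum u ?S * \<mu> i"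
    show ?thesis
    proof (rule good[of k])
      define c where "c = (1 / (u k + v k - sum u ?S)) / sum \<mu> ?S"
      have c: "c = 1 / ((real n - sum \<mu> ?S) * sum u ?S)"
        using k(2) by (simp add: c_def algebra_simps)
      have leaf: "leaf_edges (ts ! i) = edges (Hs i)" if "i < length ts" for i
        using decomposes_leaf_edges[OF dec[OF that]] .
      have "leaf_edges (Ser ts) = edges H" unfolding edges using leaf by (auto simp: set_conv_nth)
      then have phiH: "phi n (card (leaf_edges (Ser ts))) = sum \<mu> ?S * (real n - sum \<mu> ?S)"
        by (simp add: phi_def m)
      have "calibrated n (c * phi n (card (leaf_edges (Ser ts))) / phi n (card (leaf_edges (ts ! i)))) (ts ! i) w"
        if i: "i < length ts" for i
      proof -
        have phii: "phi n (card (leaf_edges (ts ! i))) = \<mu> i * (real n - \<mu> i)"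
          by (simp add: phi_def leaf[OF i] \<mu>_def)
        have 1: "u i * (real n - \<mu> i) = v i * \<mu> i" using e1[of i] i by (simp add: algebra_simps)
        have ui: "0 < u i" "0 < v i" using a[OF i] b[OF i] by (auto simp: u_def v_def)
        have "c * phi n (card (leaf_edges (Ser ts))) = sum \<mu> ?S / sum u ?S"
          unfolding c phiH using M by simp
        also have "\<dots> = \<mu> i / u i" using e2[of i] i U ui by (simp add: field_simps)
        finally have "c * phi n (card (leaf_edges (Ser ts))) / phi n (card (leaf_edges (ts ! i))) =
          1 / (u i * (real n - \<mu> i))" unfolding phii using \<mu>[OF i] by simp
        also have "\<dots> = b i / \<mu> i" unfolding 1 by (simp add: v_def)
        finally have "c * phi n (card (leaf_edges (Ser ts))) / phi n (card (leaf_edges (ts ! i))) = b i / \<mu> i" .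
        moreover have "calibrated n (b i / \<mu> i) (ts ! i) w" using uv[OF i] 1 by simp
        ultimately show ?thesis by simp
      qed
      then show "calibrated n c (Ser ts) w" by (auto simp: in_set_conv_nth simp del: dtree.set)
    qed (use k in auto)
  qed
qed

lemma decomposes_well_certified:
  assumes "decomposes t H l r" "card (edges H) < n" "\<forall>e\<in>edges H. 0 < w e"
  shows "well_certified n w t H l r"
  using assms
proof (induction rule: decomposes_induct)
  case (leaf l r H e)
  then show ?case by (intro well_certified_leaf) auto
next
  case (par ts Hs H l r)
  interpret parallel_parts "length ts" "(!) ts" Hs H l r by fact
  have "well_certified n w (ts ! i) (Hs i) l r" if "i < length ts" for i
    by (rule par.IH[OF that]) (use par.prems card_part_le[OF that] that edges in \<open>auto simp: edges\<close>)
  then show ?case by (intro well_certified_parallel[OF par.hyps]) (use par.prems in auto)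
next
  case (ser ts Hs H x)
  interpret series_parts "length ts" "(!) ts" Hs H x by fact
  have "well_certified n w (ts ! i) (Hs i) (x i) (x (Suc i))" if "i < length ts" for i
    by (rule ser.IH[OF that]) (use ser.prems card_part_le[OF that] that edges in \<open>auto simp: edges\<close>)
  then show ?case by (intro well_certified_series[OF ser.hyps]) (use ser.prems in auto)
qed

lemma admissible_tree_parts:
  assumes "admissible_tree G l r t"
  obtains ts Hs where "t = Par ts" "parallel_parts (length ts) ((!) ts) Hs G l r"
    "\<And>i. i < length ts \<Longrightarrow> card (edges (Hs i)) < card (edges G)"
    "\<And>s. s \<in> set ts \<Longrightarrow> alternating_ser s"
proof -
  obtain ts where t: "t = Par ts" "2 \<le> length ts" "decomposes t G l r" "alternating_par t"
    using assms unfolding admissible_tree_def by blast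
  from t(3) obtain Hs where P: "parallel_parts (length ts) ((!) ts) Hs G l r"
    unfolding t(1)
  proof (cases rule: decomposes.cases)
    case (parallel_composition Hs)
    then show ?thesis using that[OF parallel_partsI] by blast
  qed
  interpret parallel_parts "length ts" "(!) ts" Hs G l r by (rule P)
  have "card (edges (Hs i)) < card (edges G)" if i: "i < length ts" for i
  proof -
    obtain j where j: "j < length ts" "j \<noteq> i" using t(2) i by (cases "i = 0") (auto intro: that[of 1] that[of 0])
    have "card (edges (Hs i)) + card (edges (Hs j)) = (\<Sum>k\<in>{i, j}. card (edges (Hs k)))" using j by simp
    also have "\<dots> \<le> card (edges G)" unfolding card_edges by (rule sum_mono2) (use i j in auto)
    finally show ?thesis using card_part(2)[OF j(1)] by linarith
  qed
  then show thesis using that[OF t(1) P] t by auto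
qed

text \<open>
  The root is a parallel composition with \<open>m = n\<close>, where \<open>b * (n - m) \<le> a * m\<close> says \<open>0 \<le> a\<close>; its
  parts are proper, so the previous lemma applies to them.
\<close>
theorem spanning_set_with_certificate:
  assumes "admissible_tree G l r t" "card (edges G) = n" "\<forall>e\<in>edges G. 0 < w e"
  obtains T a where "certifies n w G l r T 1 a" "0 < a"
  | T c where "certifies n w G l r T 1 0" "0 < c" "calibrated n c t w"
proof -
  obtain ts Hs where t: "t = Par ts" and P: "parallel_parts (length ts) ((!) ts) Hs G l r"
    and lt: "\<And>i. i < length ts \<Longrightarrow> card (edges (Hs i)) < card (edges G)"
    using admissible_tree_parts[OF assms(1)] by metis
  interpret parallel_parts "length ts" "(!) ts" Hs G l r by (rule P)
  have n: "0 < n" using lt[OF pos] assms(2) by simp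
  have "well_certified n w (ts ! i) (Hs i) l r" if i: "i < length ts" for i
    by (rule decomposes_well_certified[OF dec[OF i]]) (use lt[OF i] assms(2,3) i edges in auto)
  then have "well_certified n w t G l r" unfolding t by (intro well_certified_parallel[OF P n])
  then obtain T a b where T: "certifies n w G l r T 1 a" and b: "0 < b"
    and ab: "0 < a * real n \<or> 0 = a * real n \<and> calibrated n (b / real n) t w"
    unfolding well_certified_def Let_def assms(2) by auto
  from ab show thesis
  proof
    assume "0 < a * real n"
    then have "0 < a" using n by (simp add: zero_less_mult_iff)
    then show thesis using that(1)[OF T] by simp
  next
    assume "0 = a * real n \<and> calibrated n (b / real n) t w"
    then show thesis using that(2)[of T "b / real n"] T b n by simp
  qed
qed

section \<open>Calibrated weights admit no better edge set\<close>

text \<open>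
  The counterpart of a certificate: the surplus can be kept below \<open>a (s - t)\<^sup>2\<close> for any prescribed
  values at the terminals.
\<close>
definition caps ::
    "nat \<Rightarrow> ('e \<Rightarrow> real) \<Rightarrow> ('v, 'e) mgraph \<Rightarrow> 'v \<Rightarrow> 'v \<Rightarrow> 'e set \<Rightarrow> real \<Rightarrow> bool" where
  "caps n w H l r I a \<longleftrightarrow> (\<forall>s t. \<exists>p. p l = s \<and> p r = t \<and> surplus n w H I p \<le> a * (s - t)\<^sup>2)"

text \<open>
  Such a potential extends to the whole graph by a constant on all other parts, so it refutes
  positive definiteness at once. Edge sets that are too small or contain cycles are dealt with in
  this way.
\<close>
definition collapses ::
    "nat \<Rightarrow> ('e \<Rightarrow> real) \<Rightarrow> ('v, 'e) mgraph \<Rightarrow> 'v \<Rightarrow> 'v \<Rightarrow> 'e set \<Rightarrow> bool" where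
  "collapses n w H l r I \<longleftrightarrow> (\<exists>p. p l = p r \<and> surplus n w H I p \<le> 0 \<and> (\<exists>v\<in>verts H. p v \<noteq> p l))"

text \<open>
  The conductances of edge sets that do not collapse, by size: below the size of a spanning
  tree at most \<open>c (n - m)\<close>, below that of a forest with two components at most \<open>- c m\<close>, and still
  smaller sets always collapse. Sets exceeding the size of a tree are unconstrained; counting shows
  that some other part is then short of edges.
\<close>
definition dominated ::
    "nat \<Rightarrow> ('e \<Rightarrow> real) \<Rightarrow> ('v, 'e) mgraph \<Rightarrow> 'v \<Rightarrow> 'v \<Rightarrow> real \<Rightarrow> bool" where
  "dominated n w H l r c \<longleftrightarrow> (\<forall>I. \<not> collapses n w H l r I \<longrightarrow>
     card (verts H) \<le> card (I \<inter> edges H) + 2 \<and>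
     (card (I \<inter> edges H) + 1 \<le> card (verts H) \<longrightarrow>
       caps n w H l r I (c * (real n - real (card (edges H))))) \<and>
     (card (I \<inter> edges H) + 2 \<le> card (verts H) \<longrightarrow> caps n w H l r I (- (c * real (card (edges H))))))"

lemma (in parts) glue_surplus:
  assumes "\<And>i j v. i < m \<Longrightarrow> j < m \<Longrightarrow> i < j \<Longrightarrow> v \<in> verts (Hs i) \<inter> verts (Hs j) \<Longrightarrow> P i v = P j v"
  obtains p where "\<And>i v. i < m \<Longrightarrow> v \<in> verts (Hs i) \<Longrightarrow> p v = P i v"
    "surplus n w H I p = (\<Sum>i<m. surplus n w (Hs i) I (P i))"
proof -
  obtain p where p: "\<And>i v. i < m \<Longrightarrow> v \<in> verts (Hs i) \<Longrightarrow> p v = P i v"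
    using glue[of P] assms by metis
  have "surplus n w H I p = (\<Sum>i<m. surplus n w (Hs i) I (P i))"
    unfolding surplus_parts
  proof (intro sum.cong refl)
    fix i assume "i \<in> {..<m}"
    then have i: "i < m" by simp
    show "surplus n w (Hs i) I p = surplus n w (Hs i) I (P i)"
      by (rule surplus_cong_potential[OF dec[OF i]]) (rule p[OF i])
  qed
  then show thesis using that[OF p] by blast
qed

text \<open>
  The collapsing potential of part \<open>i\<close> is continued by its value at the terminals.
\<close>
lemma (in parts) collapse_part:
  assumes i: "i < m" and col: "collapses n w (Hs i) (a i) (b i) I"
    and meet: "\<And>j. j < m \<Longrightarrow> j \<noteq> i \<Longrightarrow> verts (Hs i) \<inter> verts (Hs j) \<subseteq> {a i, b i}"
  shows "\<exists>p s. (\<forall>j<m. p (a j) = s \<and> p (b j) = s) \<and> surplus n w H I p \<le> 0 \<and> (\<exists>v\<in>verts H. p v \<noteq> s)"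
proof -
  obtain q where q: "q (a i) = q (b i)" "surplus n w (Hs i) I q \<le> 0" "\<exists>v\<in>verts (Hs i). q v \<noteq> q (a i)"
    using col unfolding collapses_def by blast
  define P where "P j = (if j = i then q else (\<lambda>_. q (a i)))" for j
  have Pab: "P j (a j) = q (a i)" "P j (b j) = q (a i)" for j using q(1) by (auto simp: P_def)
  have "P j v = P k v" if "j < m" "k < m" "j < k" "v \<in> verts (Hs j) \<inter> verts (Hs k)" for j k v
  proof -
    consider "j = i" | "k = i" | "j \<noteq> i" "k \<noteq> i" by blast
    then show ?thesis
    proof cases
      case 1
      then have "v \<in> {a i, b i}" using meet[of k] that by blast
      then show ?thesis using 1 that q(1) by (auto simp: P_def)
    next
      case 2
      then have "v \<in> {a i, b i}" using meet[of j] that by blast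
      then show ?thesis using 2 that q(1) by (auto simp: P_def)
    qed (simp add: P_def)
  qed
  from glue_surplus[of P n w I, OF this]
  obtain p where p: "\<And>i v. i < m \<Longrightarrow> v \<in> verts (Hs i) \<Longrightarrow> p v = P i v"
    and sur: "surplus n w H I p = (\<Sum>i<m. surplus n w (Hs i) I (P i))" by blast
  have "surplus n w H I p \<le> 0" unfolding sur
  proof (rule sum_nonpos)
    fix j assume "j \<in> {..<m}"
    then show "surplus n w (Hs j) I (P j) \<le> 0"
      using q(2) surplus_const[OF dec[of j]] by (simp add: P_def)
  qed
  moreover have "p (a j) = q (a i) \<and> p (b j) = q (a i)" if "j < m" for j
    using p[OF that] decomposes_terminals(1,2)[OF dec[OF that]] Pab by simp
  moreover obtain v where "v \<in> verts (Hs i)" "q v \<noteq> q (a i)" using q(3) by blast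
  then have "\<exists>v\<in>verts H. p v \<noteq> q (a i)" 
    unfolding verts using p[OF i] i by (intro bexI[of _ v]) (auto simp: P_def)
  ultimately show ?thesis by blast
qed

lemma (in parallel_parts) collapses_parallel:
  assumes "i < m" "collapses n w (Hs i) l r I"
  shows "collapses n w H l r I"
proof -
  have "\<exists>p s. (\<forall>j<m. p l = s \<and> p r = s) \<and> surplus n w H I p \<le> 0 \<and> (\<exists>v\<in>verts H. p v \<noteq> s)"
    by (rule collapse_part[OF assms]) (use meet assms(1) in blast)
  then obtain p s where "p l = s" "p r = s" "surplus n w H I p \<le> 0" "\<exists>v\<in>verts H. p v \<noteq> s" using pos by blast
  then show ?thesis unfolding collapses_def by (intro exI[of _ p]) simp
qed

lemma (in series_parts) collapses_series:
  assumes "i < m" "collapses n w (Hs i) (x i) (x (Suc i)) I"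
  shows "collapses n w H (x 0) (x m) I"
proof -
  have "\<exists>p s. (\<forall>j<m. p (x j) = s \<and> p (x (Suc j)) = s) \<and> surplus n w H I p \<le> 0 \<and> (\<exists>v\<in>verts H. p v \<noteq> s)"
  proof (rule collapse_part[OF assms])
    fix j assume j: "j < m" "j \<noteq> i"
    then consider "i < j" | "j < i" by linarith
    then show "verts (Hs i) \<inter> verts (Hs j) \<subseteq> {x i, x (Suc i)}"
    proof cases
      case 1
      then show ?thesis using meet[OF 1 j(1)] by simp
    next
      case 2
      then show ?thesis using meet[OF 2 assms(1)] by (simp add: Int_commute)
    qed
  qed
  then obtain p s where p: "\<forall>j<m. p (x j) = s \<and> p (x (Suc j)) = s" "surplus n w H I p \<le> 0"
    "\<exists>v\<in>verts H. p v \<noteq> s" by blast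
  have "p (x 0) = s" "p (x m) = s" using p(1) pos by (metis, metis Suc_pred lessI)
  then show ?thesis using p(2,3) unfolding collapses_def by (intro exI[of _ p]) simp
qed

lemma (in parallel_parts) caps_parallel:
  assumes "\<And>i. i < m \<Longrightarrow> caps n w (Hs i) l r I (c i)"
  shows "caps n w H l r I (\<Sum>i<m. c i)"
  unfolding caps_def
proof (intro allI)
  fix s t
  have "\<forall>i. \<exists>p. i < m \<longrightarrow> p l = s \<and> p r = t \<and> surplus n w (Hs i) I p \<le> c i * (s - t)\<^sup>2"
    using assms unfolding caps_def by meson
  then obtain P where P: "\<And>i. i < m \<Longrightarrow> P i l = s \<and> P i r = t \<and> surplus n w (Hs i) I (P i) \<le> c i * (s - t)\<^sup>2"
    by metis
  have "P i v = P j v" if "i < m" "j < m" "i < j" "v \<in> verts (Hs i) \<inter> verts (Hs j)" for i j v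
    using meet[of i j] that P[of i] P[of j] by auto
  from glue_surplus[of P n w I, OF this]
  obtain p where p: "\<And>i v. i < m \<Longrightarrow> v \<in> verts (Hs i) \<Longrightarrow> p v = P i v"
    and sur: "surplus n w H I p = (\<Sum>i<m. surplus n w (Hs i) I (P i))" by blast
  have "surplus n w H I p \<le> (\<Sum>i<m. c i * (s - t)\<^sup>2)" unfolding sur by (intro sum_mono) (use P in simp)
  moreover have "p l = s" "p r = t"
    using p[OF pos] P[OF pos] decomposes_terminals(1,2)[OF dec[OF pos]] by auto
  ultimately show "\<exists>p. p l = s \<and> p r = t \<and> surplus n w H I p \<le> (\<Sum>i<m. c i) * (s - t)\<^sup>2"
    by (auto simp: sum_distrib_right)
qed

context series_parts
begin

lemma series_potential:
  assumes "\<And>i. i < m \<Longrightarrow> \<exists>p. p (x i) = s i \<and> p (x (Suc i)) = s (Suc i) \<and> surplus n w (Hs i) I p \<le> q i"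
  shows "\<exists>p. (\<forall>i\<le>m. p (x i) = s i) \<and> surplus n w H I p \<le> (\<Sum>i<m. q i)"
proof -
  obtain P where P: "\<And>i. i < m \<Longrightarrow> P i (x i) = s i \<and> P i (x (Suc i)) = s (Suc i) \<and> surplus n w (Hs i) I (P i) \<le> q i"
    using assms by metis
  have "P i v = P j v" if "i < m" "j < m" "i < j" "v \<in> verts (Hs i) \<inter> verts (Hs j)" for i j v
  proof -
    have "v \<in> (if j = Suc i then {x j} else {})" using meet[of i j] that by blast
    then have "j = Suc i" "v = x j" by (auto split: if_splits)
    then show ?thesis using P[of i] P[of j] that by auto
  qed
  from glue_surplus[of P n w I, OF this]
  obtain p where p: "\<And>i v. i < m \<Longrightarrow> v \<in> verts (Hs i) \<Longrightarrow> p v = P i v"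
    and sur: "surplus n w H I p = (\<Sum>i<m. surplus n w (Hs i) I (P i))" by blast
  have "p (x i) = s i" if "i \<le> m" for i
  proof (cases "i < m")
    case True
    then show ?thesis using p[OF True] P[OF True] decomposes_terminals(1)[OF dec[OF True]] by simp
  next
    case False
    then have "i = Suc (m - 1)" "m - 1 < m" using pos that by auto
    then obtain j where j: "i = Suc j" "j < m" by blast
    then show ?thesis using p[OF j(2)] P[OF j(2)] decomposes_terminals(2)[OF dec[OF j(2)]] by simp
  qed
  moreover have "surplus n w H I p \<le> (\<Sum>i<m. q i)" unfolding sur by (intro sum_mono) (use P in simp)
  ultimately show ?thesis by blast
qed

lemma caps_series:
  assumes caps: "\<And>i. i < m \<Longrightarrow> caps n w (Hs i) (x i) (x (Suc i)) I (c i)"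
    and c: "\<And>i. i < m \<Longrightarrow> c i \<noteq> 0" "(\<Sum>i<m. 1 / c i) = 1 / C" "C \<noteq> 0"
  shows "caps n w H (x 0) (x m) I C"
  unfolding caps_def
proof (intro allI)
  fix \<sigma> \<tau> :: real
  \<comment> \<open>Kirchhoff: the same current \<open>C (\<sigma> - \<tau>)\<close> flows through every part\<close>
  define d where "d i = C * (\<sigma> - \<tau>) * (1 / c i)" for i
  define s where "s k = \<sigma> - (\<Sum>i<k. d i)" for k
  have sd: "s i - s (Suc i) = d i" for i by (simp add: s_def)
  have "\<exists>p. (\<forall>i\<le>m. p (x i) = s i) \<and> surplus n w H I p \<le> (\<Sum>i<m. c i * (d i)\<^sup>2)"
  proof (rule series_potential)
    fix i assume i: "i < m"
    show "\<exists>p. p (x i) = s i \<and> p (x (Suc i)) = s (Suc i) \<and> surplus n w (Hs i) I p \<le> c i * (d i)\<^sup>2"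
      using caps[OF i] unfolding caps_def sd[of i, symmetric] by blast
  qed
  then obtain p where p: "\<forall>i\<le>m. p (x i) = s i" "surplus n w H I p \<le> (\<Sum>i<m. c i * (d i)\<^sup>2)" by blast
  have "(\<Sum>i<m. d i) = C * (\<sigma> - \<tau>) * (1 / C)"
    unfolding d_def sum_distrib_left[symmetric] c(2) ..
  then have "s 0 = \<sigma>" "s m = \<tau>" using c(3) by (auto simp: s_def)
  then have "p (x 0) = \<sigma>" "p (x m) = \<tau>" using p(1) by auto
  moreover have "(\<Sum>i<m. c i * (d i)\<^sup>2) = (\<Sum>i<m. C\<^sup>2 * (\<sigma> - \<tau>)\<^sup>2 * (1 / c i))"
    by (intro sum.cong refl) (use c(1) in \<open>simp add: d_def power2_eq_square\<close>)
  then have "(\<Sum>i<m. c i * (d i)\<^sup>2) = C * (\<sigma> - \<tau>)\<^sup>2"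
    unfolding sum_distrib_left[symmetric] c(2) using c(3) by (simp add: power2_eq_square)
  ultimately show "\<exists>p. p (x 0) = \<sigma> \<and> p (x m) = \<tau> \<and> surplus n w H I p \<le> C * (\<sigma> - \<tau>)\<^sup>2" using p(2) by metis
qed

lemma constant_extension:
  assumes "i < m" "s i = s (Suc i)"
  shows "\<exists>p. p (x i) = s i \<and> p (x (Suc i)) = s (Suc i) \<and> surplus n w (Hs i) I p \<le> 0"
  using surplus_const[OF dec[OF assms(1)], of n w I "s i"] assms(2) by (intro exI[of _ "\<lambda>_. s i"]) simp

text \<open>
  All of the difference is put on part \<open>i\<close>; the other parts are constant and contribute
  nothing. Hence one part short of an edge beats any surplus of edges elsewhere.
\<close>
lemma caps_series_one_cut:
  assumes i: "i < m" and cap: "caps n w (Hs i) (x i) (x (Suc i)) I b" and b: "b \<le> C"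
  shows "caps n w H (x 0) (x m) I C"
  unfolding caps_def
proof (intro allI)
  fix \<sigma> \<tau> :: real
  define s where "s k = (if k \<le> i then \<sigma> else \<tau>)" for k
  have "\<exists>p. (\<forall>k\<le>m. p (x k) = s k) \<and> surplus n w H I p \<le> (\<Sum>k<m. if k = i then b * (\<sigma> - \<tau>)\<^sup>2 else 0)"
  proof (rule series_potential)
    fix k assume k: "k < m"
    show "\<exists>p. p (x k) = s k \<and> p (x (Suc k)) = s (Suc k) \<and>
      surplus n w (Hs k) I p \<le> (if k = i then b * (\<sigma> - \<tau>)\<^sup>2 else 0)"
    proof (cases "k = i")
      case True
      then show ?thesis using cap unfolding caps_def by (simp add: s_def)
    next
      case False
      then show ?thesis using constant_extension[OF k, of s] by (auto simp: s_def)
    qed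
  qed
  then obtain p where p: "\<forall>k\<le>m. p (x k) = s k" "surplus n w H I p \<le> b * (\<sigma> - \<tau>)\<^sup>2"
    using i by (auto simp: sum.delta)
  then have "p (x 0) = \<sigma>" "p (x m) = \<tau>" using i by (auto simp: s_def)
  moreover have "b * (\<sigma> - \<tau>)\<^sup>2 \<le> C * (\<sigma> - \<tau>)\<^sup>2" using b by (simp add: mult_right_mono)
  ultimately show "\<exists>p. p (x 0) = \<sigma> \<and> p (x m) = \<tau> \<and> surplus n w H I p \<le> C * (\<sigma> - \<tau>)\<^sup>2"
    using p(2) by force
qed

text \<open>
  The segment between two parts that are both short of an edge is lifted by \<open>1\<close>.
\<close>
lemma collapses_series_two_cuts:
  assumes ij: "i < j" "j < m"
    and cap: "caps n w (Hs i) (x i) (x (Suc i)) I bi" "caps n w (Hs j) (x j) (x (Suc j)) I bj"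
    and b: "bi \<le> 0" "bj \<le> 0"
  shows "collapses n w H (x 0) (x m) I"
proof -
  define s :: "nat \<Rightarrow> real" where "s k = (if i < k \<and> k \<le> j then 1 else 0)" for k
  have "\<exists>p. (\<forall>k\<le>m. p (x k) = s k) \<and> surplus n w H I p \<le> (\<Sum>k<m. 0)"
  proof (rule series_potential)
    fix k assume k: "k < m"
    consider "k = i" | "k = j" | "k \<noteq> i" "k \<noteq> j" by blast
    then show "\<exists>p. p (x k) = s k \<and> p (x (Suc k)) = s (Suc k) \<and> surplus n w (Hs k) I p \<le> 0"
    proof cases
      case 1
      then have "\<exists>p. p (x k) = s k \<and> p (x (Suc k)) = s (Suc k) \<and> surplus n w (Hs k) I p \<le> bi * (s k - s (Suc k))\<^sup>2"
        using cap(1) unfolding caps_def by blast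
      moreover have "bi * (s k - s (Suc k))\<^sup>2 \<le> 0" using b by (simp add: mult_nonpos_nonneg)
      ultimately show ?thesis by force
    next
      case 2
      then have "\<exists>p. p (x k) = s k \<and> p (x (Suc k)) = s (Suc k) \<and> surplus n w (Hs k) I p \<le> bj * (s k - s (Suc k))\<^sup>2"
        using cap(2) unfolding caps_def by blast
      moreover have "bj * (s k - s (Suc k))\<^sup>2 \<le> 0" using b by (simp add: mult_nonpos_nonneg)
      ultimately show ?thesis by force
    next
      case 3
      then show ?thesis using constant_extension[OF k, of s] by (auto simp: s_def)
    qed
  qed
  then obtain p where p: "\<forall>k\<le>m. p (x k) = s k" "surplus n w H I p \<le> 0" by auto
  then have "p (x 0) = 0" "p (x m) = 0" "p (x j) = 1" using ij by (auto simp: s_def)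
  moreover have "x j \<in> verts H" using decomposes_terminals(1)[OF dec[OF ij(2)]] ij(2) unfolding verts by blast
  ultimately show ?thesis using p(2) unfolding collapses_def by (intro exI[of _ p] conjI bexI[of _ "x j"]) auto
qed

end

lemma sum_le_minus_two:
  fixes y :: "'i \<Rightarrow> int"
  assumes "finite S" "sum y S \<le> - 2" "\<And>i. i \<in> S \<Longrightarrow> - 1 \<le> y i"
  shows "\<exists>i\<in>S. \<exists>j\<in>S. i \<noteq> j \<and> y i = - 1 \<and> y j = - 1"
proof (rule ccontr)
  assume no: "\<not> ?thesis"
  obtain i where i: "i \<in> S" "y i < 0" using assms(2) sum_nonneg[of S y] by force
  have "0 \<le> sum y (S - {i})"
  proof (rule sum_nonneg)
    fix j assume j: "j \<in> S - {i}"
    then show "0 \<le> y j" using no i assms(3)[of i] assms(3)[of j] by force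
  qed
  then show False using sum.remove[OF assms(1) i(1), of y] assms(2) assms(3)[OF i(1)] by linarith
qed

lemma dominatedD:
  assumes "dominated n w H l r c" "\<not> collapses n w H l r I"
  shows "card (verts H) \<le> card (I \<inter> edges H) + 2"
    "card (I \<inter> edges H) + 1 \<le> card (verts H) \<Longrightarrow>
      caps n w H l r I (c * (real n - real (card (edges H))))"
    "card (I \<inter> edges H) + 2 \<le> card (verts H) \<Longrightarrow>
      caps n w H l r I (- (c * real (card (edges H))))"
  using assms unfolding dominated_def by auto

lemma dominated_leaf:
  assumes "l \<noteq> r" "verts H = {l, r}" "edges H = {e}" "ends H e = {l, r}" "0 < w e"
  shows "dominated n w H l r (w e)"
unfolding dominated_def
proof (intro allI impI)
  fix I
  have any: "\<exists>p. p l = s \<and> p r = t" for s t :: real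
    using assms(1) by (intro exI[of _ "\<lambda>v. if v = l then s else t"]) auto
  have sur: "surplus n w H I p = (if e \<in> I then real n - 1 else - 1) * w e * (p l - p r)\<^sup>2" for p
    unfolding surplus_def assms(3) using gap_pair_square[of p l r] by (simp add: assms(4))
  have "caps n w H l r I a" if "(if e \<in> I then real n - 1 else - 1) * w e \<le> a" for a
    unfolding caps_def
  proof (intro allI)
    fix s t :: real
    obtain p where p: "p l = s" "p r = t" using any by blast
    have "surplus n w H I p \<le> a * (s - t)\<^sup>2"
      unfolding sur p by (rule mult_right_mono[OF that]) simp
    then show "\<exists>p. p l = s \<and> p r = t \<and> surplus n w H I p \<le> a * (s - t)\<^sup>2" using p by blast
  qed
  note cap = this
  have "card (verts H) = 2" using assms(1,2) by simp
  moreover have "card (I \<inter> edges H) = (if e \<in> I then 1 else 0)" unfolding assms(3) by auto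
  moreover have "caps n w H l r I (w e * (real n - 1))" by (rule cap) (use assms(5) in \<open>auto simp: algebra_simps\<close>)
  moreover have "e \<notin> I \<Longrightarrow> caps n w H l r I (- w e)" by (rule cap) simp
  ultimately show "card (verts H) \<le> card (I \<inter> edges H) + 2 \<and>
      (card (I \<inter> edges H) + 1 \<le> card (verts H) \<longrightarrow>
        caps n w H l r I (w e * (real n - real (card (edges H))))) \<and>
      (card (I \<inter> edges H) + 2 \<le> card (verts H) \<longrightarrow> caps n w H l r I (- (w e * real (card (edges H)))))"
    by (auto simp: assms(3))
qed

text \<open>
  \<open>y i\<close> counts the edges of \<open>I\<close> in part \<open>i\<close> beyond a forest that separates the terminals. It is
  nonnegative unless part \<open>i\<close> collapses, and the sum of the \<open>y i\<close> is at most \<open>1\<close> for sets of the size of a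
  tree, so at most one part can contain a tree.
\<close>
lemma (in parallel_parts) dominated_parallel:
  assumes dom: "\<And>i. i < m \<Longrightarrow> dominated n w (Hs i) l r c"
  shows "dominated n w H l r c"
unfolding dominated_def
proof (intro allI impI)
  fix I assume "\<not> collapses n w H l r I"
  then have nc: "\<not> collapses n w (Hs i) l r I" if "i < m" for i using collapses_parallel that by blast
  define \<mu> where "\<mu> i = real (card (edges (Hs i)))" for i
  define y where "y i = int (card (I \<inter> edges (Hs i))) - int (card (verts (Hs i))) + 2" for i
  have y: "0 \<le> y i" "y i \<le> 1 \<Longrightarrow> caps n w (Hs i) l r I (c * (real n - \<mu> i))"
    "y i \<le> 0 \<Longrightarrow> caps n w (Hs i) l r I (- (c * \<mu> i))" if "i < m" for i
    using dominatedD[OF dom[OF that] nc[OF that]] unfolding y_def \<mu>_def by auto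
  have M: "real (card (edges H)) = (\<Sum>i<m. \<mu> i)" unfolding card_edges by (simp add: \<mu>_def)
  have Y: "int (card (I \<inter> edges H)) - int (card (verts H)) + 2 = (\<Sum>i<m. y i)"
    unfolding card_inter_edges card_verts y_def by (simp add: sum_subtractf sum.distrib)
  have Y0: "0 \<le> (\<Sum>i<m. y i)" by (rule sum_nonneg) (use y in auto)
  have one: "caps n w H l r I (c * (real n - (\<Sum>i<m. \<mu> i)))" if le: "(\<Sum>i<m. y i) \<le> 1"
  proof -
    \<comment> \<open>at most one part connects the terminals\<close>
    obtain k where k: "k < m" "\<And>i. i < m \<Longrightarrow> i \<noteq> k \<Longrightarrow> y i \<le> 0"
    proof (cases "\<exists>k<m. 0 < y k")
      case True
      then obtain k where k: "k < m" "0 < y k" by blast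
      have "y i \<le> 0" if i: "i < m" "i \<noteq> k" for i
      proof -
        have "(\<Sum>j\<in>{i, k}. y j) \<le> (\<Sum>j<m. y j)" by (rule sum_mono2) (use i k y in auto)
        then show ?thesis using i k le by simp
      qed
      then show ?thesis using that k by blast
    next
      case False
      then show ?thesis using that[OF pos] by force
    qed
    have yk: "y k \<le> 1" using member_le_sum[of k "{..<m}" y] y(1) k(1) le by force
    have "caps n w H l r I (\<Sum>i<m. if i = k then c * (real n - \<mu> k) else - (c * \<mu> i))"
      by (rule caps_parallel) (use y k yk in auto)
    also have "(\<Sum>i<m. if i = k then c * (real n - \<mu> k) else - (c * \<mu> i)) =
      (\<Sum>i<m. (if i = k then c * real n else 0) - c * \<mu> i)"
      by (intro sum.cong refl) (auto simp: algebra_simps)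
    also have "\<dots> = c * (real n - (\<Sum>i<m. \<mu> i))"
      using k(1) by (simp add: sum_subtractf sum_distrib_left algebra_simps)
    finally show ?thesis .
  qed
  have zero: "caps n w H l r I (- (c * (\<Sum>i<m. \<mu> i)))" if le: "(\<Sum>i<m. y i) \<le> 0"
  proof -
    have "y i \<le> 0" if "i < m" for i using member_le_sum[of i "{..<m}" y] y(1) that le by force
    then have "caps n w H l r I (\<Sum>i<m. - (c * \<mu> i))" by (intro caps_parallel y(3)) auto
    then show ?thesis by (simp add: sum_negf sum_distrib_left)
  qed
  show "card (verts H) \<le> card (I \<inter> edges H) + 2 \<and>
      (card (I \<inter> edges H) + 1 \<le> card (verts H) \<longrightarrow>
        caps n w H l r I (c * (real n - real (card (edges H))))) \<and>
      (card (I \<inter> edges H) + 2 \<le> card (verts H) \<longrightarrow> caps n w H l r I (- (c * real (card (edges H)))))"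
    unfolding M using Y Y0 one zero by auto
qed

text \<open>
  \<open>y i\<close> counts the edges of \<open>I\<close> in part \<open>i\<close> beyond a tree, and \<open>y i \<ge> - 1\<close> unless part \<open>i\<close>
  collapses. Two parts with \<open>y i = - 1\<close> make the composition collapse. Otherwise either all
  parts have the expected sizes, and the reciprocals add up, or an excess in one part is paid for by
  the only deficient part, and putting the whole difference on that part suffices.
\<close>
lemma (in series_parts) dominated_series:
  assumes c: "0 < c" and mn: "card (edges H) < n"
    and dom: "\<And>i. i < m \<Longrightarrow>
      dominated n w (Hs i) (x i) (x (Suc i)) (c * phi n (card (edges H)) / phi n (card (edges (Hs i))))"
  shows "dominated n w H (x 0) (x m) c"
unfolding dominated_def
proof (intro allI impI)
  fix I assume ncH: "\<not> collapses n w H (x 0) (x m) I"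
  then have nc: "\<not> collapses n w (Hs i) (x i) (x (Suc i)) I" if "i < m" for i using collapses_series that by blast
  define \<mu> where "\<mu> i = real (card (edges (Hs i)))" for i
  define y where "y i = int (card (I \<inter> edges (Hs i))) - int (card (verts (Hs i))) + 1" for i
  have \<mu>: "0 < \<mu> i" "\<mu> i < real n" if "i < m" for i
    using card_part(2)[OF that] card_part_le[OF that] mn by (auto simp: \<mu>_def)
  define M where "M = real (card (edges H))"
  have M: "M = (\<Sum>i<m. \<mu> i)" unfolding M_def card_edges by (simp add: \<mu>_def)
  have M0: "0 < M" unfolding M by (rule sum_pos) (use \<mu> pos in auto)
  have Mn: "M < real n" using mn by (simp add: M_def)
  define K where "K = c * (M * (real n - M))"
  have K: "0 < K" using c M0 Mn by (simp add: K_def)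
  have ci: "c * phi n (card (edges H)) / phi n (card (edges (Hs i))) = K / (\<mu> i * (real n - \<mu> i))" for i
    by (simp add: phi_def K_def \<mu>_def M_def)
  have cin: "c * phi n (card (edges H)) / phi n (card (edges (Hs i))) * (real n - \<mu> i) = K / \<mu> i"
    "c * phi n (card (edges H)) / phi n (card (edges (Hs i))) * \<mu> i = K / (real n - \<mu> i)" if "i < m" for i
    unfolding ci using \<mu>[OF that] by auto
  have y: "- 1 \<le> y i" "y i \<le> 0 \<Longrightarrow> caps n w (Hs i) (x i) (x (Suc i)) I (K / \<mu> i)"
    "y i \<le> - 1 \<Longrightarrow> caps n w (Hs i) (x i) (x (Suc i)) I (- (K / (real n - \<mu> i)))" if "i < m" for i
    using dominatedD[OF dom[OF that] nc[OF that]]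
    unfolding \<mu>_def[symmetric] cin[OF that] y_def by auto
  have neg: "- (K / (real n - \<mu> i)) < 0" if "i < m" for i using K \<mu>[OF that] by simp
  have Y: "int (card (I \<inter> edges H)) - int (card (verts H)) + 1 = (\<Sum>i<m. y i)"
    unfolding card_inter_edges card_verts y_def by (simp add: sum_subtractf sum.distrib)
  have cut: "i = j" if "i < m" "j < m" "y i \<le> - 1" "y j \<le> - 1" for i j
  proof (rule ccontr)
    assume "i \<noteq> j"
    then consider "i < j" | "j < i" by linarith
    then show False
    proof cases
      case 1
      show False using collapses_series_two_cuts[OF 1 that(2) y(3)[OF that(1,3)] y(3)[OF that(2,4)]]
          neg[OF that(1)] neg[OF that(2)] ncH by simp
    next
      case 2
      show False using collapses_series_two_cuts[OF 2 that(1) y(3)[OF that(2,4)] y(3)[OF that(1,3)]]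
          neg[OF that(1)] neg[OF that(2)] ncH by simp
    qed
  qed
  have Y1: "- 1 \<le> (\<Sum>i<m. y i)"
  proof (rule ccontr)
    assume "\<not> - 1 \<le> (\<Sum>i<m. y i)"
    then have "\<exists>i\<in>{..<m}. \<exists>j\<in>{..<m}. i \<noteq> j \<and> y i = - 1 \<and> y j = - 1"
      by (intro sum_le_minus_two) (use y(1) in auto)
    then obtain i j where "i < m" "j < m" "i \<noteq> j" "y i = - 1" "y j = - 1" by blast
    then show False using cut[of i j] by simp
  qed
  have zero: "caps n w H (x 0) (x m) I (c * (real n - M))" if le: "(\<Sum>i<m. y i) \<le> 0"
  proof (cases "\<exists>i<m. y i \<le> - 1")
    case True
    then obtain i where i: "i < m" "y i \<le> - 1" by blast
    have "0 \<le> c * (real n - M)" using c Mn by simp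
    then show ?thesis using caps_series_one_cut[OF i(1) y(3)[OF i]] neg[OF i(1)] by simp
  next
    case False
    then have nn: "0 \<le> y i" if "i < m" for i using that by force
    have "y i \<le> 0" if "i < m" for i using member_le_sum[of i "{..<m}" y] nn that le by force
    then have caps: "caps n w (Hs i) (x i) (x (Suc i)) I (K / \<mu> i)" if "i < m" for i using y(2) that by blast
    show ?thesis
    proof (rule caps_series[OF caps])
      show "K / \<mu> i \<noteq> 0" if "i < m" for i using K \<mu>[OF that] by simp
      have "(\<Sum>i<m. 1 / (K / \<mu> i)) = M / K" unfolding M by (simp add: sum_divide_distrib)
      also have "\<dots> = 1 / (c * (real n - M))" unfolding K_def using M0 by simp
      finally show "(\<Sum>i<m. 1 / (K / \<mu> i)) = 1 / (c * (real n - M))" .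
      show "c * (real n - M) \<noteq> 0" using c Mn by simp
    qed
  qed
  have minus_one: "caps n w H (x 0) (x m) I (- (c * M))" if le: "(\<Sum>i<m. y i) \<le> - 1"
  proof -
    have "\<exists>k<m. y k \<le> - 1"
    proof (rule ccontr)
      assume "\<not> (\<exists>k<m. y k \<le> - 1)"
      then have "0 \<le> (\<Sum>i<m. y i)" by (intro sum_nonneg) force
      then show False using le by simp
    qed
    then obtain k where k: "k < m" "y k \<le> - 1" by blast
    have k': "k \<in> {..<m}" using k by simp
    have nn: "0 \<le> y i" if "i < m" "i \<noteq> k" for i using cut[OF that(1) k(1) _ k(2)] that(2) by force
    have le0: "y i \<le> 0" if i: "i < m" "i \<noteq> k" for i
    proof -
      have "y i \<le> sum y ({..<m} - {k})" by (rule member_le_sum) (use i nn in auto)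
      then show ?thesis using sum.remove[OF finite_lessThan k', of y] le y(1)[OF k(1)] by linarith
    qed
    define c' where "c' i = (if i = k then - (K / (real n - \<mu> k)) else K / \<mu> i)" for i
    show ?thesis
    proof (rule caps_series[of n w I c'])
      show "caps n w (Hs i) (x i) (x (Suc i)) I (c' i)" if "i < m" for i
        using y(2)[OF that] y(3)[OF that] le0[OF that] k(2) by (auto simp: c'_def)
      show "c' i \<noteq> 0" if "i < m" for i using K \<mu>[OF that] by (auto simp: c'_def)
      have "(\<Sum>i<m. 1 / c' i) = 1 / c' k + (\<Sum>i\<in>{..<m} - {k}. 1 / c' i)"
        by (rule sum.remove) (use k in auto)
      also have "(\<Sum>i\<in>{..<m} - {k}. 1 / c' i) = (\<Sum>i\<in>{..<m} - {k}. \<mu> i) / K"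
        unfolding sum_divide_distrib by (intro sum.cong refl) (simp add: c'_def)
      also have "(\<Sum>i\<in>{..<m} - {k}. \<mu> i) = M - \<mu> k"
        unfolding M using sum.remove[OF finite_lessThan k', of \<mu>] by simp
      also have "1 / c' k = (\<mu> k - real n) / K" using K \<mu>[OF k(1)] by (simp add: c'_def field_simps)
      also have "(\<mu> k - real n) / K + (M - \<mu> k) / K = - ((real n - M) / K)"
        by (simp add: add_divide_distrib[symmetric] minus_divide_left)
      also have "\<dots> = 1 / (- (c * M))" using c M0 Mn by (simp add: K_def)
      finally show "(\<Sum>i<m. 1 / c' i) = 1 / (- (c * M))" .
      show "- (c * M) \<noteq> 0" using c M0 by simp
    qed
  qed
  show "card (verts H) \<le> card (I \<inter> edges H) + 2 \<and>
      (card (I \<inter> edges H) + 1 \<le> card (verts H) \<longrightarrow>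
        caps n w H (x 0) (x m) I (c * (real n - real (card (edges H))))) \<and>
      (card (I \<inter> edges H) + 2 \<le> card (verts H) \<longrightarrow>
        caps n w H (x 0) (x m) I (- (c * real (card (edges H)))))"
    unfolding M_def[symmetric] using Y Y1 zero minus_one by auto
qed

lemma calibrated_dominated:
  assumes "decomposes t H l r" "card (edges H) < n" "\<forall>e\<in>edges H. 0 < w e" "calibrated n c t w" "0 < c"
  shows "dominated n w H l r c"
  using assms
proof (induction arbitrary: c rule: decomposes_induct)
  case (leaf l r H e)
  then show ?case using dominated_leaf[of l r H e w n] by simp
next
  case (par ts Hs H l r)
  interpret parallel_parts "length ts" "(!) ts" Hs H l r by fact
  show ?case
  proof (rule dominated_parallel)
    fix i assume i: "i < length ts"
    show "dominated n w (Hs i) l r c"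
      by (rule par.IH[OF i]) (use par.prems card_part_le[OF i] i in \<open>auto simp: edges\<close>)
  qed
next
  case (ser ts Hs H x)
  interpret series_parts "length ts" "(!) ts" Hs H x by fact
  have leaf: "leaf_edges (ts ! i) = edges (Hs i)" if "i < length ts" for i
    using decomposes_leaf_edges[OF dec[OF that]] .
  have leafH: "leaf_edges (Ser ts) = edges H" unfolding edges using leaf by (auto simp: set_conv_nth)
  have phi_pos: "0 < phi n k" if "0 < k" "k < n" for k using that by (simp add: phi_def)
  show ?case
  proof (rule dominated_series)
    fix i assume i: "i < length ts"
    have "card (edges (Hs i)) < n" "0 < card (edges (Hs i))" "0 < card (edges H)"
      using card_part_le[OF i] card_part(2)[OF i] ser.prems(1) by linarith+
    note b = this
    show "dominated n w (Hs i) (x i) (x (Suc i)) (c * phi n (card (edges H)) / phi n (card (edges (Hs i))))"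
    proof (rule ser.IH[OF i])
      show "calibrated n (c * phi n (card (edges H)) / phi n (card (edges (Hs i)))) (ts ! i) w"
        using ser.prems(3) nth_mem[OF i] unfolding calibrated.simps leafH leaf[OF i, symmetric] by blast
      show "0 < c * phi n (card (edges H)) / phi n (card (edges (Hs i)))"
        using ser.prems(1,4) b phi_pos by simp
    qed (use b ser.prems(2) i in \<open>auto simp: edges\<close>)
  qed (use ser.prems in auto)
qed

text \<open>
  At the root \<open>c (n - m) = 0\<close>, so the potential with values \<open>1\<close> and \<open>0\<close> at the terminals has
  no positive surplus, unless a collapsing potential already does the job.
\<close>
theorem calibrated_no_certificate:
  assumes "admissible_tree G l r t" "card (edges G) = n" "\<forall>e\<in>edges G. 0 < w e"
    and "calibrated n c t w" "0 < c" and I: "I \<subseteq> edges G" "card I + 1 = card (verts G)"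
  shows "\<exists>p. surplus n w G I p \<le> 0 \<and> (\<exists>u\<in>verts G. \<exists>v\<in>verts G. p u \<noteq> p v)"
proof -
  obtain ts Hs where t: "t = Par ts" and P: "parallel_parts (length ts) ((!) ts) Hs G l r"
    and lt: "\<And>i. i < length ts \<Longrightarrow> card (edges (Hs i)) < card (edges G)"
    using admissible_tree_parts[OF assms(1)] by metis
  interpret parallel_parts "length ts" "(!) ts" Hs G l r by (rule P)
  have dec: "decomposes t G l r" using assms(1) by (simp add: admissible_tree_def)
  note lr = decomposes_terminals[OF dec]
  have "dominated n w G l r c"
  proof (rule dominated_parallel)
    fix i assume i: "i < length ts"
    show "dominated n w (Hs i) l r c"
    proof (rule calibrated_dominated[OF parts.dec[OF parts_axioms i]])
      show "calibrated n c (ts ! i) w" using assms(4) i unfolding t by simp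
    qed (use lt[OF i] assms i in \<open>auto simp: edges\<close>)
  qed
  moreover have "I \<inter> edges G = I" using I by blast
  ultimately have "collapses n w G l r I \<or> caps n w G l r I 0"
    using dominatedD(2)[of n w G l r c I] I(2) assms(2) by auto
  then show ?thesis
  proof
    assume "collapses n w G l r I"
    then show ?thesis unfolding collapses_def using lr by blast
  next
    assume "caps n w G l r I 0"
    then obtain p where "p l = 1" "p r = 0" "surplus n w G I p \<le> 0 * (1 - 0)\<^sup>2"
      unfolding caps_def by blast
    then show ?thesis using lr(1,2) by (intro exI[of _ p] conjI bexI[of _ l] bexI[of _ r]) auto
  qed
qed

section \<open>Connectedness\<close>

lemma (in parts) gap_zero_parts:
  assumes "\<forall>e\<in>edges H. gap p (ends H e) = 0" "i < m"
  shows "\<forall>e\<in>edges (Hs i). gap p (ends (Hs i) e) = 0"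
proof
  fix e assume e: "e \<in> edges (Hs i)"
  then have "e \<in> edges H" using assms(2) unfolding edges by blast
  then show "gap p (ends (Hs i) e) = 0" using assms(1) unfolding ends[OF assms(2) e, symmetric] by blast
qed

text \<open>
  Two-terminal series-parallel graphs are connected, stated in the form in which it is used:
  zero energy forces a constant potential.
\<close>
lemma gap_zero_constant:
  assumes "decomposes t H l r" "\<forall>e\<in>edges H. gap p (ends H e) = 0"
  shows "\<forall>v\<in>verts H. p v = p l"
  using assms
proof (induction rule: decomposes_induct)
  case (leaf l r H e)
  then show ?case using gap_pair_square[of p l r] by auto
next
  case (par ts Hs H l r)
  interpret parallel_parts "length ts" "(!) ts" Hs H l r by fact
  show ?case using par.IH gap_zero_parts[OF par.prems] unfolding verts by blast
next
  case (ser ts Hs H x)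
  interpret series_parts "length ts" "(!) ts" Hs H x by fact
  have part: "p v = p (x i)" if "i < length ts" "v \<in> verts (Hs i)" for i v
    using ser.IH[OF that(1) gap_zero_parts[OF ser.prems that(1)]] that(2) by blast
  have const: "p (x i) = p (x 0)" if "i \<le> length ts" for i
    using that
  proof (induction i)
    case (Suc i)
    then show ?case using part[of i "x (Suc i)"] decomposes_terminals(2)[OF dec[of i]] by simp
  qed simp
  show ?case
  proof
    fix v assume "v \<in> verts H"
    then obtain i where i: "i < length ts" "v \<in> verts (Hs i)" unfolding verts by blast
    show "p v = p (x 0)" using part[OF i] const[of i] i(1) by simp
  qed
qed

section \<open>Calibrated weights are the graph-induced weights\<close>

lemma chain_edge: "chain t e cs \<Longrightarrow> e \<in> leaf_edges t"
proof (induction rule: chain.induct)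
  case (2 t ts e cs)
  then show ?case unfolding dtree.set by blast
next
  case (3 t ts e cs)
  then show ?case unfolding dtree.set by blast
qed simp

lemma chain_exists: "e \<in> leaf_edges t \<Longrightarrow> \<exists>cs. chain t e cs"
proof (induction t)
  case (Leaf f)
  then show ?case by (auto intro: chain.intros)
next
  case (Ser ts)
  then obtain t cs where "t \<in> set ts" "chain t e cs" unfolding dtree.set by blast
  from chain.intros(2)[OF this] show ?case by blast
next
  case (Par ts)
  then obtain t cs where "t \<in> set ts" "chain t e cs" unfolding dtree.set by blast
  from chain.intros(3)[OF this] show ?case by blast
qed

lemma chain_Ser_iff: "chain (Ser ts) e cs \<longleftrightarrow> (\<exists>t\<in>set ts. \<exists>ds. cs = t # ds \<and> chain t e ds)"
  by (subst chain.simps) auto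

lemma chain_Par_iff: "chain (Par ts) e cs \<longleftrightarrow> (\<exists>t\<in>set ts. \<exists>ds. cs = t # ds \<and> chain t e ds)"
  by (subst chain.simps) auto

lemma (in parts) chain_part_unique:
  assumes "i < m" "j < m" "chain (ts i) e cs" "chain (ts j) e ds"
  shows "i = j"
proof -
  have "e \<in> edges (Hs i)" "e \<in> edges (Hs j)"
    using chain_edge[OF assms(3)] chain_edge[OF assms(4)] decomposes_leaf_edges[OF dec[OF assms(1)]]
      decomposes_leaf_edges[OF dec[OF assms(2)]] by simp_all
  then show ?thesis using disj[OF assms(1,2)] by blast
qed

lemma chain_unique:
  assumes "decomposes t H l r" "chain t e cs" "chain t e cs'"
  shows "cs = cs'"
  using assms
proof (induction arbitrary: cs cs' rule: decomposes_induct)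
  case (leaf l r H f)
  then show ?case by (auto elim: chain.cases)
next
  case (par ts Hs H l r)
  interpret parallel_parts "length ts" "(!) ts" Hs H l r by fact
  obtain i ds where i: "i < length ts" "cs = ts ! i # ds" "chain (ts ! i) e ds"
    using par.prems(1) unfolding chain_Par_iff by (metis in_set_conv_nth)
  obtain j ds' where j: "j < length ts" "cs' = ts ! j # ds'" "chain (ts ! j) e ds'"
    using par.prems(2) unfolding chain_Par_iff by (metis in_set_conv_nth)
  have "i = j" by (rule chain_part_unique[OF i(1) j(1) i(3) j(3)])
  then show ?case using par.IH[OF i(1) i(3)] i j by simp
next
  case (ser ts Hs H x)
  interpret series_parts "length ts" "(!) ts" Hs H x by fact
  obtain i ds where i: "i < length ts" "cs = ts ! i # ds" "chain (ts ! i) e ds"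
    using ser.prems(1) unfolding chain_Ser_iff by (metis in_set_conv_nth)
  obtain j ds' where j: "j < length ts" "cs' = ts ! j # ds'" "chain (ts ! j) e ds'"
    using ser.prems(2) unfolding chain_Ser_iff by (metis in_set_conv_nth)
  have "i = j" by (rule chain_part_unique[OF i(1) j(1) i(3) j(3)])
  then show ?case using ser.IH[OF i(1) i(3)] i j by simp
qed

fun path_weight :: "nat \<Rightarrow> 'e dtree list \<Rightarrow> real" where
  "path_weight n (s # t # cs) = phi n (card (leaf_edges s)) / phi n (card (leaf_edges t)) * path_weight n cs"
| "path_weight n cs = 1"

lemma path_weight_prod:
  "path_weight n cs = (\<Prod>i < length cs div 2.
     phi n (card (leaf_edges (cs ! (2 * i)))) / phi n (card (leaf_edges (cs ! (2 * i + 1)))))"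
  by (induction n cs rule: path_weight.induct) (simp_all add: prod.lessThan_Suc_shift del: prod.lessThan_Suc)

text \<open>
  A chain below a parallel node starts with a series node, so its entries pair up as they stand.
  Below a series node \<open>t\<close> the first quotient of the product still needs \<open>t\<close> itself, which accounts
  for the two forms of the claim.
\<close>
lemma calibrated_iff_path_weight:
  "(alternating_par t \<or> (\<exists>e. t = Leaf e) \<longrightarrow>
     (calibrated n c t w \<longleftrightarrow> (\<forall>e cs. chain t e cs \<longrightarrow> w e = c * path_weight n cs))) \<and>
   (alternating_ser t \<longrightarrow>
     (calibrated n c t w \<longleftrightarrow> (\<forall>e cs. chain t e cs \<longrightarrow> w e = c * path_weight n (t # cs))))"
proof (induction t arbitrary: c)
  case (Leaf e)
  have "chain (Leaf e) f cs \<longleftrightarrow> f = e \<and> cs = []" for f cs by (auto elim: chain.cases intro: chain.intros)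
  then show ?case by simp
next
  case (Ser ts)
  have ch: "(\<forall>e cs. chain (Ser ts) e cs \<longrightarrow> Q e cs) \<longleftrightarrow> (\<forall>t\<in>set ts. \<forall>e ds. chain t e ds \<longrightarrow> Q e (t # ds))" for Q
    using chain_Ser_iff[of ts] by metis
  show ?case
  proof (intro conjI impI)
    assume "alternating_ser (Ser ts)"
    then have "calibrated n k t w \<longleftrightarrow> (\<forall>e cs. chain t e cs \<longrightarrow> w e = k * path_weight n cs)" if "t \<in> set ts" for t k
      using Ser.IH[OF that, of k] that by auto
    then show "calibrated n c (Ser ts) w \<longleftrightarrow> (\<forall>e cs. chain (Ser ts) e cs \<longrightarrow> w e = c * path_weight n (Ser ts # cs))"
      unfolding ch calibrated.simps path_weight.simps by (simp add: mult.assoc del: dtree.set)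
  qed auto
next
  case (Par ts)
  have ch: "(\<forall>e cs. chain (Par ts) e cs \<longrightarrow> Q e cs) \<longleftrightarrow> (\<forall>t\<in>set ts. \<forall>e ds. chain t e ds \<longrightarrow> Q e (t # ds))" for Q
    using chain_Par_iff[of ts] by metis
  show ?case
  proof (intro conjI impI)
    assume "alternating_par (Par ts) \<or> (\<exists>e. Par ts = Leaf e)"
    then have "calibrated n c t w \<longleftrightarrow> (\<forall>e cs. chain t e cs \<longrightarrow> w e = c * path_weight n (t # cs))" if "t \<in> set ts" for t
      using Par.IH[OF that, of c] that by auto
    then show "calibrated n c (Par ts) w \<longleftrightarrow> (\<forall>e cs. chain (Par ts) e cs \<longrightarrow> w e = c * path_weight n cs)"
      unfolding ch calibrated.simps by simp
  qed auto
qed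

lemma calibrated_iff_induced:
  assumes "admissible_tree G l r t" "card (edges G) = n"
  shows "calibrated n c t w \<longleftrightarrow> (\<forall>e\<in>edges G. w e = c * induced_weight t e)"
proof -
  have dec: "decomposes t G l r" and alt: "alternating_par t" using assms(1) by (auto simp: admissible_tree_def)
  have leaves: "leaf_edges t = edges G" by (rule decomposes_leaf_edges[OF dec])
  have ind: "induced_weight t e = path_weight n cs" if "chain t e cs" for e cs
  proof -
    have "(THE ds. chain t e ds) = cs" using that chain_unique[OF dec] by (intro the_equality) auto
    then show ?thesis unfolding induced_weight_def Let_def path_weight_prod leaves assms(2) by simp
  qed
  have "calibrated n c t w \<longleftrightarrow> (\<forall>e cs. chain t e cs \<longrightarrow> w e = c * path_weight n cs)"
    using calibrated_iff_path_weight[of t n c w] alt by blast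
  also have "\<dots> \<longleftrightarrow> (\<forall>e\<in>edges G. w e = c * induced_weight t e)"
    using ind chain_edge chain_exists unfolding leaves[symmetric] by metis
  finally show ?thesis .
qed

section \<open>Every 2-sp-graph has an admissible tree\<close>

lemma union_of_parts_cong:
  assumes "union_of_parts Hs H" "verts H' = verts H" "edges H' = edges H" "\<forall>e\<in>edges H. ends H' e = ends H e"
  shows "union_of_parts Hs H'"
  using assms unfolding union_of_parts_def by auto

lemma decomposes_cong:
  assumes "decomposes t H l r" "verts H' = verts H" "edges H' = edges H" "\<forall>e\<in>edges H. ends H' e = ends H e"
  shows "decomposes t H' l r"
  using assms(1)
proof cases
  case (single_edge e)
  then show ?thesis using assms by (auto intro: decomposes.single_edge)
next
  case (parallel_composition ts Hs)
  then show ?thesis using union_of_parts_cong[OF _ assms(2-4)] by (auto intro: decomposes.parallel_composition)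
next
  case (series_composition ts Hs xs)
  have "decomposes (Ser ts) H' l r"
    by (rule decomposes.series_composition[of ts Hs H' xs])
      (use series_composition union_of_parts_cong[OF _ assms(2-4)] in blast)+
  then show ?thesis using series_composition by simp
qed

text \<open>
  \<open>H'\<close> is \<open>H\<close> with the edge \<open>e\<close> replaced by \<open>K\<close>, which meets \<open>H\<close> exactly in the ends of \<open>e\<close>. Both kinds
  of extension have this form. As in the extensions, \<open>K\<close> may reuse the name \<open>e\<close>.
\<close>
definition replaces_edge :: "('v, 'e) mgraph \<Rightarrow> 'e \<Rightarrow> ('v, 'e) mgraph \<Rightarrow> ('v, 'e) mgraph \<Rightarrow> bool" where
  "replaces_edge H e K H' \<longleftrightarrow> verts H \<inter> verts K = ends H e \<and> (edges H - {e}) \<inter> edges K = {} \<and>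
     verts H' = verts H \<union> verts K \<and> edges H' = (edges H - {e}) \<union> edges K \<and>
     (\<forall>d\<in>edges H - {e}. ends H' d = ends H d) \<and> (\<forall>d\<in>edges K. ends H' d = ends K d)"

text \<open>
  The edge \<open>e\<close> belongs to one part only, and \<open>K\<close> meets the other parts at most in the ends of \<open>e\<close>,
  which that part contains already. Therefore the incidences between parts do not change.
\<close>
lemma union_of_parts_update:
  assumes U: "union_of_parts Hs H" and i: "i < length Hs" "e \<in> edges (Hs ! i)"
    and R: "replaces_edge H e K H'"
    and e: "ends H e \<subseteq> verts (Hs ! i)"
  defines "K' \<equiv> \<lparr>verts = verts (Hs ! i) \<union> verts K, edges = (edges (Hs ! i) - {e}) \<union> edges K, ends = ends H'\<rparr>"
  shows "replaces_edge (Hs ! i) e K K'" "union_of_parts (Hs[i := K']) H'"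
    "\<And>j. j < length Hs \<Longrightarrow> j \<noteq> i \<Longrightarrow> verts K' \<inter> verts (Hs ! j) = verts (Hs ! i) \<inter> verts (Hs ! j)"
proof -
  note u = union_of_parts_nth[OF U refl]
  have sub: "verts (Hs ! j) \<subseteq> verts H" "edges (Hs ! j) \<subseteq> edges H" if "j < length Hs" for j
    using that u(1,2) by auto
  have KH: "verts H \<inter> verts K = ends H e" "(edges H - {e}) \<inter> edges K = {}"
    "verts H' = verts H \<union> verts K" "edges H' = (edges H - {e}) \<union> edges K"
    "\<And>d. d \<in> edges H \<Longrightarrow> d \<noteq> e \<Longrightarrow> ends H' d = ends H d"
    "\<And>d. d \<in> edges K \<Longrightarrow> ends H' d = ends K d"
    using R unfolding replaces_edge_def by auto
  have e_only: "e \<notin> edges (Hs ! j)" if "j < length Hs" "j \<noteq> i" for j using u(4)[OF that(1) i(1) that(2)] i(2) by blast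
  have ends_i: "ends H' d = ends (Hs ! j) d" if "j < length Hs" "d \<in> edges (Hs ! j)" "d \<noteq> e" for j d
    using KH(5)[of d] sub(2)[OF that(1)] that u(3)[OF that(1,2)] by auto
  show "replaces_edge (Hs ! i) e K K'"
    unfolding replaces_edge_def K'_def using KH sub[OF i(1)] e u(3)[OF i] ends_i[OF i(1)] by auto
  show vert: "verts K' \<inter> verts (Hs ! j) = verts (Hs ! i) \<inter> verts (Hs ! j)" if "j < length Hs" "j \<noteq> i" for j
    using KH(1) sub(1)[OF that(1)] e unfolding K'_def by auto
  have len: "length (Hs[i := K']) = length Hs" by simp
  have nth: "Hs[i := K'] ! j = (if j = i then K' else Hs ! j)" if "j < length Hs" for j using that by simp
  have img: "(\<Union>M\<in>set (Hs[i := K']). f M) = (\<Union>j<length Hs. f (if j = i then K' else Hs ! j))"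
    for f :: "('a, 'b) mgraph \<Rightarrow> 'c set"
  proof -
    have "set (Hs[i := K']) = (!) (Hs[i := K']) ` {..<length (Hs[i := K'])}" by (auto simp: set_conv_nth)
    also have "\<dots> = (\<lambda>j. if j = i then K' else Hs ! j) ` {..<length Hs}"
      unfolding len by (intro image_cong refl) (use nth in simp)
    finally show ?thesis by (simp only: image_image)
  qed
  have "verts H' = (\<Union>M\<in>set (Hs[i := K']). verts M)"
  proof -
    have "v \<in> verts H \<or> v \<in> verts K \<longleftrightarrow> (\<exists>j<length Hs. v \<in> verts (if j = i then K' else Hs ! j))" for v
    proof
      assume "v \<in> verts H \<or> v \<in> verts K"
      then show "\<exists>j<length Hs. v \<in> verts (if j = i then K' else Hs ! j)"
      proof
        assume "v \<in> verts H"
        then obtain j where "j < length Hs" "v \<in> verts (Hs ! j)" unfolding u(1) by blast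
        then show ?thesis by (intro exI[of _ j]) (auto simp: K'_def)
      next
        assume "v \<in> verts K"
        then show ?thesis using i(1) by (intro exI[of _ i]) (simp add: K'_def)
      qed
    next
      assume "\<exists>j<length Hs. v \<in> verts (if j = i then K' else Hs ! j)"
      then obtain j where j: "j < length Hs" "v \<in> verts (if j = i then K' else Hs ! j)" by blast
      then have "v \<in> verts (Hs ! j) \<or> v \<in> verts K" by (cases "j = i") (simp_all add: K'_def)
      then show "v \<in> verts H \<or> v \<in> verts K" using sub(1)[OF j(1)] by blast
    qed
    then show ?thesis unfolding img KH(3) by blast
  qed
  moreover have "edges H' = (\<Union>M\<in>set (Hs[i := K']). edges M)"
  proof -
    have "d \<in> edges H \<and> d \<noteq> e \<or> d \<in> edges K \<longleftrightarrow> (\<exists>j<length Hs. d \<in> edges (if j = i then K' else Hs ! j))" for d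
    proof
      assume "d \<in> edges H \<and> d \<noteq> e \<or> d \<in> edges K"
      then show "\<exists>j<length Hs. d \<in> edges (if j = i then K' else Hs ! j)"
      proof
        assume d: "d \<in> edges H \<and> d \<noteq> e"
        then obtain j where "j < length Hs" "d \<in> edges (Hs ! j)" unfolding u(2) by blast
        then show ?thesis using d by (intro exI[of _ j]) (auto simp: K'_def)
      next
        assume "d \<in> edges K"
        then show ?thesis using i(1) by (intro exI[of _ i]) (simp add: K'_def)
      qed
    next
      assume "\<exists>j<length Hs. d \<in> edges (if j = i then K' else Hs ! j)"
      then obtain j where j: "j < length Hs" "d \<in> edges (if j = i then K' else Hs ! j)" by blast
      then have "d \<in> edges (Hs ! j) \<and> d \<noteq> e \<or> d \<in> edges K"
        using e_only[OF j(1)] by (cases "j = i") (auto simp: K'_def)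
      then show "d \<in> edges H \<and> d \<noteq> e \<or> d \<in> edges K" using sub(2)[OF j(1)] by blast
    qed
    then show ?thesis unfolding img KH(4) by blast
  qed
  moreover have "\<forall>M\<in>set (Hs[i := K']). \<forall>d\<in>edges M. ends H' d = ends M d"
  proof (intro ballI)
    fix M d assume "M \<in> set (Hs[i := K'])" "d \<in> edges M"
    then obtain j where j': "j < length (Hs[i := K'])" "M = Hs[i := K'] ! j" "d \<in> edges M"
      unfolding in_set_conv_nth by blast
    then have j: "j < length Hs" "M = (if j = i then K' else Hs ! j)" "d \<in> edges M"
      using nth[of j] len by simp_all
    show "ends H' d = ends M d"
    proof (cases "j = i")
      case True
      then show ?thesis using j by (simp add: K'_def)
    next
      case False
      then show ?thesis using j ends_i[OF j(1), of d] e_only[OF j(1)] by auto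
    qed
  qed
  moreover have "edges (Hs[i := K'] ! a) \<inter> edges (Hs[i := K'] ! b) = {}" if "b < length Hs" "a < b" for a b
  proof -
    have iK: "edges K' \<inter> edges (Hs ! j) = {}" if j: "j < length Hs" "j \<noteq> i" for j
      using u(4)[OF i(1) j(1)] j(2) KH(2) sub(2)[OF j(1)] e_only[OF j] unfolding K'_def by auto
    show ?thesis
    proof (cases "a = i \<or> b = i")
      case True
      then show ?thesis using iK[of a] iK[of b] nth[of a] nth[of b] that by (auto simp: Int_commute)
    next
      case False
      then show ?thesis using u(4)[of a b] nth[of a] nth[of b] that by simp
    qed
  qed
  ultimately show "union_of_parts (Hs[i := K']) H'"
    unfolding union_of_parts_def len by (intro conjI allI impI) assumption+
qed

text \<open>
  Leaves occur below series nodes only, where they may be exchanged for parallel nodes. The root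
  has to keep its number of parts.
\<close>
definition keeps_alternation :: "'e dtree \<Rightarrow> 'e dtree \<Rightarrow> bool" where
  "keeps_alternation t t' \<longleftrightarrow> (alternating_ser t \<longrightarrow> alternating_ser t') \<and>
     (alternating_par t \<or> (\<exists>f. t = Leaf f) \<longrightarrow> alternating_par t') \<and>
     (\<forall>ts. t = Par ts \<longrightarrow> (\<exists>ts'. t' = Par ts' \<and> length ts' = length ts))"

lemma keeps_alternation_Par:
  assumes "i < length ts" "keeps_alternation (ts ! i) s"
  shows "keeps_alternation (Par ts) (Par (ts[i := s]))"
proof -
  have "alternating_ser t" if "\<forall>t\<in>set ts. alternating_ser t" "t \<in> set (ts[i := s])" for t
  proof -
    have "t = s \<or> t \<in> set ts" using that(2) set_update_subset_insert[of ts i s] by blast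
    then show ?thesis using that(1) nth_mem[OF assms(1)] assms(2) unfolding keeps_alternation_def by metis
  qed
  then show ?thesis unfolding keeps_alternation_def alternating_par.simps alternating_ser.simps by simp
qed

lemma keeps_alternation_Ser:
  assumes "i < length ts" "keeps_alternation (ts ! i) s"
  shows "keeps_alternation (Ser ts) (Ser (ts[i := s]))"
proof -
  have "(\<exists>f. t = Leaf f) \<or> alternating_par t"
    if "\<forall>t\<in>set ts. (\<exists>f. t = Leaf f) \<or> alternating_par t" "t \<in> set (ts[i := s])" for t
  proof -
    have "t = s \<or> t \<in> set ts" using that(2) set_update_subset_insert[of ts i s] by blast
    then show ?thesis using that(1) nth_mem[OF assms(1)] assms(2) unfolding keeps_alternation_def by metis
  qed
  then show ?thesis unfolding keeps_alternation_def by simp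
qed

text \<open>
  The induction step shared by the two kinds of composition.
\<close>
lemma replace_in_part:
  assumes U: "union_of_parts Hs H" and len: "length Hs = length ts"
    and e: "e \<in> edges H" and R: "replaces_edge H e K H'"
    and trees: "\<forall>x y. ends H e = {x, y} \<longrightarrow> x \<noteq> y \<longrightarrow> (\<exists>s. decomposes s K x y \<and> alternating_par s)"
    and dec: "\<And>i. i < length ts \<Longrightarrow> decomposes (ts ! i) (Hs ! i) (a i) (b i)"
    and IH: "\<And>i H'. i < length ts \<Longrightarrow> e \<in> edges (Hs ! i) \<Longrightarrow> replaces_edge (Hs ! i) e K H' \<Longrightarrow>
      \<forall>x y. ends (Hs ! i) e = {x, y} \<longrightarrow> x \<noteq> y \<longrightarrow> (\<exists>s. decomposes s K x y \<and> alternating_par s) \<Longrightarrow>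
      \<exists>t'. decomposes t' H' (a i) (b i) \<and> keeps_alternation (ts ! i) t'"
  obtains i s K' where "i < length ts" "keeps_alternation (ts ! i) s"
    "\<forall>j<length ts. decomposes (ts[i := s] ! j) (Hs[i := K'] ! j) (a j) (b j)"
    "union_of_parts (Hs[i := K']) H'"
    "\<And>j k. j < length ts \<Longrightarrow> k < length ts \<Longrightarrow> k \<noteq> j \<Longrightarrow>
      verts (Hs[i := K'] ! k) \<inter> verts (Hs[i := K'] ! j) = verts (Hs ! k) \<inter> verts (Hs ! j)"
proof -
  note u = union_of_parts_nth[OF U len]
  obtain i where i: "i < length ts" "e \<in> edges (Hs ! i)" using e unfolding u(2) by blast
  then have i': "i < length Hs" using len by simp
  have eH: "ends (Hs ! i) e = ends H e" using u(3)[OF i] by simp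
  have "ends H e \<subseteq> verts (Hs ! i)" by (rule decomposes_ends[OF dec[OF i(1)] i(2)]) (simp add: eH)
  note upd = union_of_parts_update[OF U i' i(2) R this]
  define K' where "K' = \<lparr>verts = verts (Hs ! i) \<union> verts K, edges = (edges (Hs ! i) - {e}) \<union> edges K, ends = ends H'\<rparr>"
  note upd = upd[folded K'_def]
  obtain s where s: "decomposes s K' (a i) (b i)" "keeps_alternation (ts ! i) s"
    using IH[OF i upd(1) trees[folded eH]] by blast
  have nth: "ts[i := s] ! j = (if j = i then s else ts ! j)" "Hs[i := K'] ! j = (if j = i then K' else Hs ! j)"
    if "j < length ts" for j using that len by auto
  have "verts (Hs[i := K'] ! k) \<inter> verts (Hs[i := K'] ! j) = verts (Hs ! k) \<inter> verts (Hs ! j)"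
    if jk: "j < length ts" "k < length ts" "k \<noteq> j" for j k
  proof (cases "k = i \<or> j = i")
    case True
    then show ?thesis using nth(2)[OF jk(1)] nth(2)[OF jk(2)] upd(3)[of j] upd(3)[of k] jk len by (metis Int_commute)
  next
    case False
    then show ?thesis using nth(2)[OF jk(1)] nth(2)[OF jk(2)] by simp
  qed
  moreover have "\<forall>j<length ts. decomposes (ts[i := s] ! j) (Hs[i := K'] ! j) (a j) (b j)"
    using nth s(1) dec by simp
  ultimately show thesis using that[OF i(1) s(2) _ upd(2)] by blast
qed

text \<open>
  A leaf fixes its terminals only up to their order within \<open>ends H e\<close>, which explains why trees
  of \<open>K\<close> are required for both orders.
\<close>
lemma decomposes_replace:
  assumes "decomposes t H l r" "e \<in> edges H" "replaces_edge H e K H'"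
    and "\<forall>x y. ends H e = {x, y} \<longrightarrow> x \<noteq> y \<longrightarrow> (\<exists>s. decomposes s K x y \<and> alternating_par s)"
  shows "\<exists>t'. decomposes t' H' l r \<and> keeps_alternation t t'"
  using assms
proof (induction arbitrary: H' rule: decomposes.induct)
  case (single_edge l r H f)
  then have e: "ends H e = {l, r}" "edges H - {e} = {}" by simp_all
  obtain s where s: "decomposes s K l r" "alternating_par s"
    using single_edge.prems(3) e(1) \<open>l \<noteq> r\<close> by metis
  have "{l, r} \<subseteq> verts K" using decomposes_terminals(1,2)[OF s(1)] by simp
  then have "verts H' = verts K" "edges H' = edges K" "\<forall>d\<in>edges K. ends H' d = ends K d"
    using single_edge.prems(2) e(2) \<open>verts H = {l, r}\<close> unfolding replaces_edge_def by auto
  then have "decomposes s H' l r" by (rule decomposes_cong[OF s(1)])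
  moreover have "keeps_alternation (Leaf f) s" using s(2) by (simp add: keeps_alternation_def)
  ultimately show ?case by blast
next
  case (parallel_composition ts Hs H l r)
  obtain i s K' where i: "i < length ts" "keeps_alternation (ts ! i) s"
    and dec: "\<forall>j<length ts. decomposes (ts[i := s] ! j) (Hs[i := K'] ! j) l r"
    and U: "union_of_parts (Hs[i := K']) H'"
    and meet: "\<And>j k. j < length ts \<Longrightarrow> k < length ts \<Longrightarrow> k \<noteq> j \<Longrightarrow>
      verts (Hs[i := K'] ! k) \<inter> verts (Hs[i := K'] ! j) = verts (Hs ! k) \<inter> verts (Hs ! j)"
  proof (rule replace_in_part[OF parallel_composition.hyps(3,2) parallel_composition.prems])
    show "decomposes (ts ! i) (Hs ! i) l r" if "i < length ts" for i using parallel_composition.IH that by blast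
    show "\<exists>t'. decomposes t' H' l r \<and> keeps_alternation (ts ! i) t'"
      if "i < length ts" "e \<in> edges (Hs ! i)" "replaces_edge (Hs ! i) e K H'"
        "\<forall>x y. ends (Hs ! i) e = {x, y} \<longrightarrow> x \<noteq> y \<longrightarrow> (\<exists>s. decomposes s K x y \<and> alternating_par s)" for i H'
      using parallel_composition.IH that by meson
  qed blast
  have "decomposes (Par (ts[i := s])) H' l r"
    by (rule decomposes.parallel_composition[OF _ _ U]) (use parallel_composition.hyps dec meet in auto)
  then show ?case using keeps_alternation_Par[OF i] by blast
next
  case (series_composition ts Hs H xs l r)
  obtain i s K' where i: "i < length ts" "keeps_alternation (ts ! i) s"
    and dec: "\<forall>j<length ts. decomposes (ts[i := s] ! j) (Hs[i := K'] ! j) (xs ! j) (xs ! (j + 1))"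
    and U: "union_of_parts (Hs[i := K']) H'"
    and meet: "\<And>j k. j < length ts \<Longrightarrow> k < length ts \<Longrightarrow> k \<noteq> j \<Longrightarrow>
      verts (Hs[i := K'] ! k) \<inter> verts (Hs[i := K'] ! j) = verts (Hs ! k) \<inter> verts (Hs ! j)"
  proof (rule replace_in_part[OF series_composition.hyps(3,2) series_composition.prems])
    show "decomposes (ts ! i) (Hs ! i) (xs ! i) (xs ! (i + 1))" if "i < length ts" for i using series_composition.IH that by blast
    show "\<exists>t'. decomposes t' H' (xs ! i) (xs ! (i + 1)) \<and> keeps_alternation (ts ! i) t'"
      if "i < length ts" "e \<in> edges (Hs ! i)" "replaces_edge (Hs ! i) e K H'"
        "\<forall>x y. ends (Hs ! i) e = {x, y} \<longrightarrow> x \<noteq> y \<longrightarrow> (\<exists>s. decomposes s K x y \<and> alternating_par s)" for i H'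
      using series_composition.IH that by meson
  qed blast
  have "decomposes (Ser (ts[i := s])) H' l r"
    by (rule decomposes.series_composition[OF _ _ U]) (use series_composition.hyps dec meet in auto)
  then show ?case using keeps_alternation_Ser[OF i] by blast
qed

lemma admissible_tree_replace:
  assumes t: "admissible_tree G l r t" and R: "e \<in> edges G" "replaces_edge G e K G'"
    and trees: "\<And>x y. ends G e = {x, y} \<Longrightarrow> x \<noteq> y \<Longrightarrow> \<exists>s. decomposes s K x y \<and> alternating_par s"
  shows "\<exists>t'. admissible_tree G' l r t'"
proof -
  have dec: "decomposes t G l r" using t by (simp add: admissible_tree_def)
  obtain t' where "decomposes t' G' l r" "keeps_alternation t t'"
    using decomposes_replace[OF dec R] trees by blast
  then show ?thesis using t unfolding admissible_tree_def keeps_alternation_def by metis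
qed

lemma decomposes_Ser_single:
  assumes "decomposes t H l r"
  shows "decomposes (Ser [t]) H l r"
  by (rule decomposes.series_composition[where Hs = "[H]" and xs = "[l, r]"])
    (use assms in \<open>auto simp: union_of_parts_def\<close>)

lemma decomposes_Par_single:
  assumes "decomposes t H l r"
  shows "decomposes (Par [t]) H l r"
  by (rule decomposes.parallel_composition[where Hs = "[H]"])
    (use assms in \<open>auto simp: union_of_parts_def\<close>)

lemma two_parallel_edges_tree:
  assumes "x \<noteq> y" "e \<noteq> f" "verts K = {x, y}" "edges K = {e, f}" "ends K e = {x, y}" "ends K f = {x, y}"
  shows "decomposes (Par [Ser [Leaf e], Ser [Leaf f]]) K x y"
proof (rule decomposes.parallel_composition)
  let ?Hs = "[\<lparr>verts = {x, y}, edges = {e}, ends = ends K\<rparr>, \<lparr>verts = {x, y}, edges = {f}, ends = ends K\<rparr>]"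
  have "decomposes (Ser [Leaf g]) \<lparr>verts = {x, y}, edges = {g}, ends = ends K\<rparr> x y" if "g \<in> {e, f}" for g
    by (rule decomposes_Ser_single, rule decomposes.single_edge) (use assms that in auto)
  then show "\<forall>i<length [Ser [Leaf e], Ser [Leaf f]]. decomposes ([Ser [Leaf e], Ser [Leaf f]] ! i) (?Hs ! i) x y"
    by (auto simp: less_Suc_eq)
qed (use assms in \<open>auto simp: union_of_parts_def less_Suc_eq\<close>)

lemma two_series_edges_tree:
  assumes "x \<noteq> y" "z \<noteq> x" "z \<noteq> y" "f \<noteq> g" "verts K = {x, z, y}" "edges K = {f, g}"
    "ends K f = {x, z}" "ends K g = {z, y}"
  shows "decomposes (Par [Ser [Leaf f, Leaf g]]) K x y"
proof (rule decomposes_Par_single, rule decomposes.series_composition)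
  let ?Hs = "[\<lparr>verts = {x, z}, edges = {f}, ends = ends K\<rparr>, \<lparr>verts = {z, y}, edges = {g}, ends = ends K\<rparr>]"
  have "decomposes (Leaf f) (?Hs ! 0) x z" "decomposes (Leaf g) (?Hs ! 1) z y"
    by (rule decomposes.single_edge; use assms in simp)+
  then show "\<forall>i<length [Leaf f, Leaf g]. decomposes ([Leaf f, Leaf g] ! i) (?Hs ! i) ([x, z, y] ! i) ([x, z, y] ! (i + 1))"
    by (auto simp: less_Suc_eq)
qed (use assms in \<open>auto simp: union_of_parts_def less_Suc_eq\<close>)

text \<open>
  A leaf hangs below a series node. A series extension exchanges it for a dummy parallel node with
  one series node of two leaves, a parallel extension for a parallel node of two dummy series nodes;
  both preserve the alternation.
\<close>
theorem two_sp_admissible_tree: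
  assumes "two_sp G"
  shows "\<exists>l r t. admissible_tree G l r t"
  using assms
proof induction
  case (base G)
  then obtain u v e f where G: "u \<noteq> v" "e \<noteq> f" "verts G = {u, v}" "edges G = {e, f}" "ends G e = {u, v}" "ends G f = {u, v}"
    unfolding two_cycle_def by blast
  have "admissible_tree G u v (Par [Ser [Leaf e], Ser [Leaf f]])"
    unfolding admissible_tree_def using two_parallel_edges_tree[OF G] by simp
  then show ?case by blast
next
  case (series G G')
  then obtain l r t where t: "admissible_tree G l r t" by blast
  then have dec: "decomposes t G l r" by (simp add: admissible_tree_def)
  obtain e u v z f g where s: "e \<in> edges G" "ends G e = {u, v}" "z \<notin> verts G" "f \<noteq> g"
    "f \<notin> edges G - {e}" "g \<notin> edges G - {e}" "verts G' = insert z (verts G)"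
    "edges G' = (edges G - {e}) \<union> {f, g}" "ends G' f = {u, z}" "ends G' g = {z, v}"
    "\<forall>d\<in>edges G - {e}. ends G' d = ends G d"
    using series.hyps(2) unfolding series_extension_def by (elim exE conjE) (rule that; assumption)
  obtain a b where ab: "a \<noteq> b" "a \<in> verts G" "b \<in> verts G" "ends G e = {a, b}"
    using decomposes_ends[OF dec s(1)] by blast
  have uv: "u \<noteq> v" "u \<in> verts G" "v \<in> verts G" using ab s(2) by (auto simp: doubleton_eq_iff)
  let ?K = "\<lparr>verts = {u, z, v}, edges = {f, g}, ends = ends G'\<rparr>"
  have "\<exists>t'. admissible_tree G' l r t'"
  proof (rule admissible_tree_replace[OF t s(1), of ?K])
    show "replaces_edge G e ?K G'" unfolding replaces_edge_def using s uv by auto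
    fix x y assume xy: "ends G e = {x, y}" "x \<noteq> y"
    then consider "x = u" "y = v" | "x = v" "y = u" using s(2) by (auto simp: doubleton_eq_iff)
    then show "\<exists>s. decomposes s ?K x y \<and> alternating_par s"
    proof cases
      case 1
      have "decomposes (Par [Ser [Leaf f, Leaf g]]) ?K u v"
        by (rule two_series_edges_tree[where z = z]) (use s uv in auto)
      then show ?thesis unfolding 1 by (intro exI conjI) auto
    next
      case 2
      have "decomposes (Par [Ser [Leaf g, Leaf f]]) ?K v u"
        by (rule two_series_edges_tree[where z = z]) (use s uv in auto)
      then show ?thesis unfolding 2 by (intro exI conjI) auto
    qed
  qed
  then show ?case by blast
next
  case (parallel G G')
  then obtain l r t where t: "admissible_tree G l r t" by blast
  then have dec: "decomposes t G l r" by (simp add: admissible_tree_def)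
  obtain e f where s: "e \<in> edges G" "f \<notin> edges G" "verts G' = verts G" "edges G' = insert f (edges G)"
    "ends G' f = ends G e" "\<forall>d\<in>edges G. ends G' d = ends G d"
    using parallel.hyps(2) unfolding parallel_extension_def by (elim exE conjE) (rule that; assumption)
  have sub: "ends G e \<subseteq> verts G" using decomposes_ends[OF dec s(1)] by (metis empty_subsetI insert_subset)
  let ?K = "\<lparr>verts = ends G e, edges = {e, f}, ends = ends G'\<rparr>"
  have "\<exists>t'. admissible_tree G' l r t'"
  proof (rule admissible_tree_replace[OF t s(1), of ?K])
    show "replaces_edge G e ?K G'" unfolding replaces_edge_def using s sub by auto
    fix x y assume xy: "ends G e = {x, y}" "x \<noteq> y"
    have "decomposes (Par [Ser [Leaf e], Ser [Leaf f]]) ?K x y"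
      by (rule two_parallel_edges_tree) (use s xy in auto)
    then show "\<exists>s. decomposes s ?K x y \<and> alternating_par s" by (intro exI conjI) auto
  qed
  then show ?case by blast
qed

section \<open>The smallest eigenvalue of a symmetric matrix\<close>

lemma real_vec_square_nonneg: "0 \<le> x \<bullet> (x :: real vec)"
  unfolding scalar_prod_def by (simp add: sum_nonneg)

lemma real_vec_square_eq_0:
  assumes "x \<in> carrier_vec d"
  shows "x \<bullet> (x :: real vec) = 0 \<longleftrightarrow> x = 0\<^sub>v d"
proof
  assume "x \<bullet> x = 0"
  then have "\<forall>i\<in>{0..<d}. x $ i * x $ i = 0"
    unfolding scalar_prod_def using assms by (subst (asm) sum_nonneg_eq_0_iff) auto
  then show "x = 0\<^sub>v d" using assms by (intro eq_vecI) auto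
qed (use assms in simp)

lemma real_vec_square_pos:
  assumes "x \<in> carrier_vec d" "x \<noteq> 0\<^sub>v d"
  shows "0 < x \<bullet> (x :: real vec)"
  using real_vec_square_nonneg[of x] real_vec_square_eq_0[OF assms(1)] assms(2) by linarith

lemma mult_mat_zero_vec: "M \<in> carrier_mat a b \<Longrightarrow> M *\<^sub>v 0\<^sub>v b = (0\<^sub>v a :: real vec)"
  by (intro eq_vecI) auto

lemma vec_eq_if_diff_zero:
  assumes "u \<in> carrier_vec d" "v \<in> carrier_vec d" "u - v = 0\<^sub>v d"
  shows "u = (v :: real vec)"
proof (rule eq_vecI)
  fix i assume "i < dim_vec v"
  then show "u $ i = v $ i" using assms(1,2) arg_cong[OF assms(3), of "\<lambda>w. w $ i"] by simp
qed (use assms in simp)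

lemma quadratic_form_bounded:
  fixes A :: "real mat"
  assumes A: "A \<in> carrier_mat d d"
  obtains K where "0 < K" "\<And>z. z \<in> carrier_vec d \<Longrightarrow> z \<bullet> (A *\<^sub>v z) \<le> K * (z \<bullet> z)"
proof
  let ?K = "1 + (\<Sum>i\<in>{0..<d}. \<Sum>j\<in>{0..<d}. \<bar>A $$ (i, j)\<bar>)"
  show "0 < ?K" by (intro add_pos_nonneg sum_nonneg) auto
  fix z :: "real vec" assume z: "z \<in> carrier_vec d"
  have le: "(z $ i)\<^sup>2 \<le> z \<bullet> z" if "i < d" for i
    unfolding scalar_prod_def using z that
    by (simp add: power2_eq_square member_le_sum[of i "{0..<d}" "\<lambda>i. z $ i * z $ i"])
  have "z \<bullet> (A *\<^sub>v z) = (\<Sum>i\<in>{0..<d}. z $ i * (\<Sum>j\<in>{0..<d}. A $$ (i, j) * z $ j))"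
    using z A unfolding scalar_prod_def mult_mat_vec_def by (intro sum.cong) auto
  also have "\<dots> = (\<Sum>i\<in>{0..<d}. \<Sum>j\<in>{0..<d}. A $$ (i, j) * (z $ i * z $ j))"
    by (simp add: sum_distrib_left mult_ac)
  also have "\<dots> \<le> (\<Sum>i\<in>{0..<d}. \<Sum>j\<in>{0..<d}. \<bar>A $$ (i, j)\<bar> * (z \<bullet> z))"
  proof (intro sum_mono)
    fix i j assume ij: "i \<in> {0..<d}" "j \<in> {0..<d}"
    have "2 * \<bar>z $ i * z $ j\<bar> \<le> (z $ i)\<^sup>2 + (z $ j)\<^sup>2"
      using sum_squares_bound[of "\<bar>z $ i\<bar>" "\<bar>z $ j\<bar>"] by (simp add: abs_mult)
    then have "\<bar>z $ i * z $ j\<bar> \<le> z \<bullet> z" using le[of i] le[of j] ij by simp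
    then have "\<bar>A $$ (i, j)\<bar> * \<bar>z $ i * z $ j\<bar> \<le> \<bar>A $$ (i, j)\<bar> * (z \<bullet> z)" by (rule mult_left_mono) simp
    then show "A $$ (i, j) * (z $ i * z $ j) \<le> \<bar>A $$ (i, j)\<bar> * (z \<bullet> z)"
      using abs_ge_self[of "A $$ (i, j) * (z $ i * z $ j)"] unfolding abs_mult by linarith
  qed
  also have "\<dots> \<le> ?K * (z \<bullet> z)"
    using real_vec_square_nonneg[of z] unfolding sum_distrib_right[symmetric] distrib_right by simp
  finally show "z \<bullet> (A *\<^sub>v z) \<le> ?K * (z \<bullet> z)" .
qed

lemma injective_mat_inverse:
  fixes A :: "real mat"
  assumes A: "A \<in> carrier_mat d d" and inj: "\<And>v. v \<in> carrier_vec d \<Longrightarrow> A *\<^sub>v v = 0\<^sub>v d \<Longrightarrow> v = 0\<^sub>v d"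
  obtains B where "B \<in> carrier_mat d d" "A * B = 1\<^sub>m d" "B * A = 1\<^sub>m d"
proof -
  have "det A \<noteq> 0" using det_0_iff_vec_prod_zero[OF A] inj by blast
  from det_non_zero_imp_unit[OF A this, of undefined]
  show thesis using that unfolding Units_def ring_mat_def by auto
qed

lemma symmetric_form:
  fixes A :: "real mat"
  assumes "A \<in> carrier_mat d d" "transpose_mat A = A" "x \<in> carrier_vec d" "y \<in> carrier_vec d"
  shows "y \<bullet> (A *\<^sub>v x) = x \<bullet> (A *\<^sub>v y)"
proof -
  have "y \<bullet> (A *\<^sub>v x) = (A *\<^sub>v y) \<bullet> x"
    using transpose_vec_mult_scalar[OF assms(1,3,4)] assms(2) by simp
  also have "\<dots> = x \<bullet> (A *\<^sub>v y)" by (rule comm_scalar_prod[of _ d]) (use assms in auto)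
  finally show ?thesis .
qed

text \<open>
  Let \<open>\<mu>\<close> be the largest number with \<open>\<mu> (z \<bullet> z) \<le> z \<bullet> A z\<close> for all \<open>z\<close>, so that \<open>S = A - \<mu>\<close> is positive
  semidefinite. If \<open>S\<close> were invertible, positivity at \<open>z - S\<^sup>-\<^sup>1 z / K\<close>, with \<open>K\<close> a bound of the form of
  \<open>S\<^sup>-\<^sup>1\<close>, would show \<open>z \<bullet> S z \<ge> (z \<bullet> z) / K\<close>, and \<open>\<mu>\<close> could be increased. So \<open>\<mu>\<close> is an eigenvalue. This
  argument avoids compactness of the sphere.
\<close>
lemma symmetric_least_eigenvalue:
  fixes A :: "real mat"
  assumes A: "A \<in> carrier_mat d d" and sym: "transpose_mat A = A" and d: "0 < d"
  shows "\<exists>\<mu>\<in>spectrum A. \<forall>z\<in>carrier_vec d. \<mu> * (z \<bullet> z) \<le> z \<bullet> (A *\<^sub>v z)"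
proof -
  define C where "C = {c. \<forall>z\<in>carrier_vec d. c * (z \<bullet> z) \<le> z \<bullet> (A *\<^sub>v z)}"
  define \<mu> where "\<mu> = Sup C"
  have ne: "C \<noteq> {}"
  proof -
    obtain K where K: "\<And>z. z \<in> carrier_vec d \<Longrightarrow> z \<bullet> (- A *\<^sub>v z) \<le> K * (z \<bullet> z)"
      using quadratic_form_bounded[of "- A" d] A by auto
    have "- K * (z \<bullet> z) \<le> z \<bullet> (A *\<^sub>v z)" if z: "z \<in> carrier_vec d" for z
    proof -
      have "z \<bullet> (- A *\<^sub>v z) = - (z \<bullet> (A *\<^sub>v z))" using A z by (simp add: uminus_mult_mat_vec)
      then show ?thesis using K[OF z] by simp
    qed
    then have "- K \<in> C" unfolding C_def by blast
    then show ?thesis by blast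
  qed
  have "c \<le> unit_vec d 0 \<bullet> (A *\<^sub>v unit_vec d 0)" if "c \<in> C" for c
  proof -
    have "c * (unit_vec d 0 \<bullet> unit_vec d 0) \<le> unit_vec d 0 \<bullet> (A *\<^sub>v unit_vec d 0)"
      using that unfolding C_def by simp
    then show ?thesis using d by simp
  qed
  then have bdd: "bdd_above C" by (rule bdd_aboveI)
  have \<mu>: "\<mu> * (z \<bullet> z) \<le> z \<bullet> (A *\<^sub>v z)" if z: "z \<in> carrier_vec d" for z
  proof (cases "z \<bullet> z = 0")
    case True
    then have "z = 0\<^sub>v d" using real_vec_square_eq_0[OF z] by simp
    then show ?thesis using A by simp
  next
    case False
    then have p: "0 < z \<bullet> z" using real_vec_square_nonneg[of z] by simp
    have "\<mu> \<le> z \<bullet> (A *\<^sub>v z) / (z \<bullet> z)" unfolding \<mu>_def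
    proof (rule cSup_least[OF ne])
      fix c assume "c \<in> C"
      then have "c * (z \<bullet> z) \<le> z \<bullet> (A *\<^sub>v z)" using z unfolding C_def by blast
      then show "c \<le> z \<bullet> (A *\<^sub>v z) / (z \<bullet> z)" using p by (simp add: field_simps)
    qed
    then show ?thesis using p by (simp add: field_simps)
  qed
  define S where "S = A - \<mu> \<cdot>\<^sub>m 1\<^sub>m d"
  have S: "S \<in> carrier_mat d d" unfolding S_def by (rule minus_carrier_mat) simp
  have Sv: "S *\<^sub>v z = A *\<^sub>v z - \<mu> \<cdot>\<^sub>v z" if z: "z \<in> carrier_vec d" for z
    unfolding S_def using A z by (subst minus_mult_distrib_mat_vec[of _ d d]) auto
  have Ssym: "transpose_mat S = S" unfolding S_def using A sym
    by (subst transpose_minus[of _ d d]) (auto intro!: arg_cong2[where f = minus] eq_matI)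
  have Sq: "z \<bullet> (S *\<^sub>v z) = z \<bullet> (A *\<^sub>v z) - \<mu> * (z \<bullet> z)" if z: "z \<in> carrier_vec d" for z
    unfolding Sv[OF z] using A z by (subst scalar_prod_minus_distrib[of _ d]) auto
  have "\<exists>v. v \<in> carrier_vec d \<and> v \<noteq> 0\<^sub>v d \<and> S *\<^sub>v v = 0\<^sub>v d"
  proof (rule ccontr)
    assume "\<not> ?thesis"
    then obtain B where B: "B \<in> carrier_mat d d" "S * B = 1\<^sub>m d"
      using injective_mat_inverse[OF S] by metis
    obtain K where K: "0 < K" "\<And>z. z \<in> carrier_vec d \<Longrightarrow> z \<bullet> (B *\<^sub>v z) \<le> K * (z \<bullet> z)"
      using quadratic_form_bounded[OF B(1)] by blast
    have "(\<mu> + 1 / K) * (z \<bullet> z) \<le> z \<bullet> (A *\<^sub>v z)" if z: "z \<in> carrier_vec d" for z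
    proof -
      \<comment> \<open>positivity of the form at \<open>z - u / K\<close> with \<open>S u = z\<close>\<close>
      define u where "u = B *\<^sub>v z"
      have u: "u \<in> carrier_vec d" using B z by (simp add: u_def)
      have Su: "S *\<^sub>v u = z" unfolding u_def using assoc_mult_mat_vec[OF S B(1) z] B(2) z by simp
      define t where "t = 1 / K"
      define y where "y = z - t \<cdot>\<^sub>v u"
      have y: "y \<in> carrier_vec d" using z u by (simp add: y_def)
      have Sy: "S *\<^sub>v y = S *\<^sub>v z - t \<cdot>\<^sub>v z"
        unfolding y_def using mult_minus_distrib_mat_vec[OF S z, of "t \<cdot>\<^sub>v u"] mult_mat_vec[OF S u] u Su by simp
      have Sz: "S *\<^sub>v z \<in> carrier_vec d" using S z by simp
      have "y \<bullet> (S *\<^sub>v y) = y \<bullet> (S *\<^sub>v z) - t * (y \<bullet> z)"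
        unfolding Sy using y z Sz by (subst scalar_prod_minus_distrib[of _ d]) auto
      also have "y \<bullet> (S *\<^sub>v z) = z \<bullet> (S *\<^sub>v z) - t * (u \<bullet> (S *\<^sub>v z))"
        unfolding y_def using z u Sz by (subst minus_scalar_prod_distrib[of _ d]) auto
      also have "u \<bullet> (S *\<^sub>v z) = z \<bullet> z" using symmetric_form[OF S Ssym z u] Su by simp
      also have "y \<bullet> z = z \<bullet> z - t * (u \<bullet> z)"
        unfolding y_def using z u by (subst minus_scalar_prod_distrib[of _ d]) auto
      also have "u \<bullet> z = z \<bullet> (B *\<^sub>v z)" unfolding u_def[symmetric] by (rule comm_scalar_prod[OF u z])
      finally have "y \<bullet> (S *\<^sub>v y) = z \<bullet> (S *\<^sub>v z) - 2 * t * (z \<bullet> z) + t\<^sup>2 * (z \<bullet> (B *\<^sub>v z))"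
        by (simp add: algebra_simps power2_eq_square)
      moreover have "0 \<le> y \<bullet> (S *\<^sub>v y)" using Sq[OF y] \<mu>[OF y] by simp
      moreover have "t\<^sup>2 * (z \<bullet> (B *\<^sub>v z)) \<le> t\<^sup>2 * (K * (z \<bullet> z))" using K(2)[OF z] by (simp add: mult_left_mono)
      moreover have "t\<^sup>2 * (K * (z \<bullet> z)) = t * (z \<bullet> z)" using K(1) by (simp add: t_def power2_eq_square)
      ultimately have "t * (z \<bullet> z) \<le> z \<bullet> (S *\<^sub>v z)" by linarith
      then show ?thesis unfolding Sq[OF z] t_def by (simp add: algebra_simps)
    qed
    then have "\<mu> + 1 / K \<in> C" unfolding C_def by blast
    then have "\<mu> + 1 / K \<le> \<mu>" unfolding \<mu>_def by (rule cSup_upper[OF _ bdd])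
    then show False using K(1) by simp
  qed
  then obtain v where v: "v \<in> carrier_vec d" "v \<noteq> 0\<^sub>v d" "S *\<^sub>v v = 0\<^sub>v d" by blast
  have "A *\<^sub>v v = \<mu> \<cdot>\<^sub>v v"
    by (rule vec_eq_if_diff_zero[of _ d]) (use A v Sv[OF v(1)] in auto)
  then have "\<mu> \<in> spectrum A" unfolding spectrum_def eigenvalue_def eigenvector_def using v A by auto
  then show ?thesis using \<mu> by blast
qed

lemma lambda_min_symmetric:
  fixes A :: "real mat"
  assumes A: "A \<in> carrier_mat d d" and sym: "transpose_mat A = A" and d: "0 < d"
  shows "eigenvalue A (lambda_min A)"
    and "z \<in> carrier_vec d \<Longrightarrow> lambda_min A * (z \<bullet> z) \<le> z \<bullet> (A *\<^sub>v z)"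
proof -
  obtain \<mu> where \<mu>: "\<mu> \<in> spectrum A" "\<And>z. z \<in> carrier_vec d \<Longrightarrow> \<mu> * (z \<bullet> z) \<le> z \<bullet> (A *\<^sub>v z)"
    using symmetric_least_eigenvalue[OF assms] by blast
  have fin: "finite (spectrum A)" by (rule card_finite_spectrum(1)[OF A])
  have "lambda_min A \<in> spectrum A" unfolding lambda_min_def by (rule Min_in[OF fin]) (use \<mu> in blast)
  then show "eigenvalue A (lambda_min A)" by (simp add: spectrum_def)
  assume z: "z \<in> carrier_vec d"
  have "lambda_min A \<le> \<mu>" unfolding lambda_min_def by (rule Min_le[OF fin \<mu>(1)])
  then have "lambda_min A * (z \<bullet> z) \<le> \<mu> * (z \<bullet> z)" by (rule mult_right_mono[OF _ real_vec_square_nonneg])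
  then show "lambda_min A * (z \<bullet> z) \<le> z \<bullet> (A *\<^sub>v z)" using \<mu>(2)[OF z] by linarith
qed

section \<open>The Moore--Penrose inverse\<close>

text \<open>
  The usual argument: \<open>A X = A Y A X = (A X A Y)\<^sup>T = A Y\<close> and likewise \<open>X A = Y A\<close>.
\<close>
lemma moore_penrose_unique:
  fixes A :: "real mat"
  assumes A: "A \<in> carrier_mat m m" and X: "X \<in> carrier_mat m m" and Y: "Y \<in> carrier_mat m m"
    and x: "A * X * A = A" "X * A * X = X" "transpose_mat (A * X) = A * X" "transpose_mat (X * A) = X * A"
    and y: "A * Y * A = A" "Y * A * Y = Y" "transpose_mat (A * Y) = A * Y" "transpose_mat (Y * A) = Y * A"
  shows "X = Y"
proof -
  have [simp]: "A * X \<in> carrier_mat m m" "X * A \<in> carrier_mat m m" "A * Y \<in> carrier_mat m m" "Y * A \<in> carrier_mat m m"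
    using A X Y by auto
  have 1: "A * X = A * Y"
  proof -
    have "A * X = (A * Y) * (A * X)" using assoc_mult_mat[of "A * Y" m m A m X m] y(1) A X by simp
    also have "\<dots> = transpose_mat ((A * X) * (A * Y))"
      using transpose_mult[of "A * X" m m "A * Y" m] x(3) y(3) by simp
    also have "(A * X) * (A * Y) = A * Y" using assoc_mult_mat[of "A * X" m m A m Y m] x(1) A Y by simp
    finally show ?thesis using y(3) by simp
  qed
  have 2: "X * A = Y * A"
  proof -
    have "X * A = (X * A) * (Y * A)"
      using assoc_mult_mat[of X m m A m "Y * A" m] assoc_mult_mat[of A m m Y m A m] y(1) A X Y by simp
    also have "\<dots> = transpose_mat ((Y * A) * (X * A))"
      using transpose_mult[of "Y * A" m m "X * A" m] x(4) y(4) by simp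
    also have "(Y * A) * (X * A) = Y * A"
      using assoc_mult_mat[of Y m m A m "X * A" m] assoc_mult_mat[of A m m X m A m] x(1) A X Y by simp
    finally show ?thesis using y(4) by simp
  qed
  have "X = X * (A * X)" using x(2) A X by simp
  also have "\<dots> = (X * A) * Y" unfolding 1 using A X Y by simp
  also have "\<dots> = Y" unfolding 2 using y(2) .
  finally show ?thesis .
qed

lemma moore_penrose_eqI:
  fixes A :: "real mat"
  assumes A: "A \<in> carrier_mat m m" and X: "X \<in> carrier_mat m m"
    and x: "A * X * A = A" "X * A * X = X" "transpose_mat (A * X) = A * X" "transpose_mat (X * A) = X * A"
  shows "moore_penrose A = X"
  unfolding moore_penrose_def
proof (rule the_equality)
  show "X \<in> carrier_mat (dim_col A) (dim_row A) \<and> A * X * A = A \<and> X * A * X = X \<and>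
    transpose_mat (A * X) = A * X \<and> transpose_mat (X * A) = X * A"
    using A X x by simp
next
  fix Y
  assume "Y \<in> carrier_mat (dim_col A) (dim_row A) \<and> A * Y * A = A \<and> Y * A * Y = Y \<and>
    transpose_mat (A * Y) = A * Y \<and> transpose_mat (Y * A) = Y * A"
  then show "Y = X" using A by (intro moore_penrose_unique[OF A _ X _ _ _ _ x]) simp_all
qed

text \<open>
  If the kernel of \<open>L\<close> consists of the constant vectors and \<open>Q\<close> is the projection onto them, then
  \<open>L + Q\<close> is invertible and the Moore--Penrose inverse of \<open>L\<close> is \<open>(L + Q)\<^sup>-\<^sup>1 - Q\<close>.
\<close>
lemma moore_penrose_constant_kernel:
  fixes L :: "real mat"
  assumes L: "L \<in> carrier_mat m m" and sym: "transpose_mat L = L" and m: "0 < m"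
    and ones: "L *\<^sub>v vec m (\<lambda>_. 1) = 0\<^sub>v m"
    and ker: "\<And>p. p \<in> carrier_vec m \<Longrightarrow> L *\<^sub>v p = 0\<^sub>v m \<Longrightarrow> \<exists>c. p = vec m (\<lambda>_. c)"
  shows "moore_penrose L \<in> carrier_mat m m \<and> L * moore_penrose L * L = L \<and>
    transpose_mat (L * moore_penrose L) = L * moore_penrose L"
proof -
  define Q :: "real mat" where "Q = mat m m (\<lambda>_. 1 / real m)"
  have Q: "Q \<in> carrier_mat m m" "transpose_mat Q = Q" "Q * Q = Q"
    using m by (auto simp: Q_def scalar_prod_def)
  have LQ: "L * Q = 0\<^sub>m m m"
  proof (rule eq_matI)
    fix i j assume "i < dim_row (0\<^sub>m m m :: real mat)" "j < dim_col (0\<^sub>m m m :: real mat)"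
    then have ij: "i < m" "j < m" by auto
    have "(L *\<^sub>v vec m (\<lambda>_. 1)) $ i = 0" unfolding ones using ij by simp
    then have "(\<Sum>k\<in>{0..<m}. L $$ (i, k)) = 0" using ij L by (simp add: scalar_prod_def)
    then show "(L * Q) $$ (i, j) = 0\<^sub>m m m $$ (i, j)"
      using ij L by (simp add: Q_def scalar_prod_def sum_divide_distrib[symmetric])
  qed (use L Q in auto)
  have QL: "Q * L = 0\<^sub>m m m"
    using arg_cong[OF LQ, of transpose_mat] transpose_mult[OF L Q(1)] sym Q(2) by simp
  define M where "M = L + Q"
  have M: "M \<in> carrier_mat m m" using L Q by (simp add: M_def)
  have MQ: "M * Q = Q" "Q * M = Q"
    unfolding M_def using add_mult_distrib_mat[OF L Q(1) Q(1)] mult_add_distrib_mat[OF Q(1) L Q(1)] LQ QL Q by simp_all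
  obtain B where B: "B \<in> carrier_mat m m" "M * B = 1\<^sub>m m" "B * M = 1\<^sub>m m"
  proof (rule injective_mat_inverse[OF M])
    fix p assume p: "p \<in> carrier_vec m" and Mp: "M *\<^sub>v p = 0\<^sub>v m"
    have "Q *\<^sub>v p = Q *\<^sub>v (M *\<^sub>v p)" using assoc_mult_mat_vec[OF Q(1) M p] MQ by simp
    then have Qp: "Q *\<^sub>v p = 0\<^sub>v m" unfolding Mp using Q(1) by (intro eq_vecI) auto
    have "L *\<^sub>v p = 0\<^sub>v m" using Mp Qp add_mult_distrib_mat_vec[OF L Q(1) p] L p unfolding M_def by simp
    then obtain c where c: "p = vec m (\<lambda>_. c)" using ker[OF p] by blast
    have "(Q *\<^sub>v p) $ 0 = c" unfolding c using m by (simp add: Q_def scalar_prod_def)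
    then show "p = 0\<^sub>v m" using Qp m c by auto
  qed blast
  have BQ: "B * Q = Q" "Q * B = Q"
  proof -
    have "B * Q = B * (M * Q)" using MQ by simp
    also have "\<dots> = Q" using assoc_mult_mat[OF B(1) M Q(1)] B(3) Q(1) by simp
    finally show "B * Q = Q" .
    have "Q * B = Q * M * B" using MQ by simp
    also have "\<dots> = Q" using assoc_mult_mat[OF Q(1) M B(1)] B(2) Q(1) by simp
    finally show "Q * B = Q" .
  qed
  define X where "X = B - Q"
  have X: "X \<in> carrier_mat m m" unfolding X_def by (rule minus_carrier_mat[OF Q(1)])
  have Lm: "L = M - Q" unfolding M_def using L Q(1) by (intro eq_matI) auto
  have QQ: "Q - Q = 0\<^sub>m m m" using Q(1) by simp
  have LX: "L * X = 1\<^sub>m m - Q"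
  proof -
    have "L * X = (M * B - M * Q) - (Q * B - Q * Q)"
      unfolding Lm X_def using minus_mult_distrib_mat[OF M Q(1), of "B - Q" m]
        mult_minus_distrib_mat[OF M B(1) Q(1)] mult_minus_distrib_mat[OF Q(1) B(1) Q(1)]
        minus_carrier_mat[OF Q(1), of B] by simp
    also have "\<dots> = 1\<^sub>m m - Q" using MQ BQ Q B by (intro eq_matI) auto
    finally show ?thesis .
  qed
  have XL: "X * L = 1\<^sub>m m - Q"
  proof -
    have "X * L = (B * M - B * Q) - (Q * M - Q * Q)"
      unfolding Lm X_def using minus_mult_distrib_mat[OF B(1) Q(1), of "M - Q" m]
        mult_minus_distrib_mat[OF B(1) M Q(1)] mult_minus_distrib_mat[OF Q(1) M Q(1)]
        minus_carrier_mat[OF Q(1), of M] by simp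
    also have "\<dots> = 1\<^sub>m m - Q" using MQ BQ Q B by (intro eq_matI) auto
    finally show ?thesis .
  qed
  have minus0: "Z - 0\<^sub>m m m = Z" if "Z \<in> carrier_mat m m" for Z :: "real mat"
    using that by (intro eq_matI) auto
  have symQ: "transpose_mat (1\<^sub>m m - Q) = 1\<^sub>m m - Q" using Q transpose_minus[of "1\<^sub>m m" m m Q] by simp
  have LXL: "L * X * L = L" unfolding LX using minus_mult_distrib_mat[of "1\<^sub>m m" m m Q L m] Q L QL minus0[OF L] by simp
  have QX: "Q * X = 0\<^sub>m m m" unfolding X_def using mult_minus_distrib_mat[OF Q(1) B(1) Q(1)] BQ Q by simp
  have XLX: "X * L * X = X" unfolding XL using minus_mult_distrib_mat[of "1\<^sub>m m" m m Q X m] Q X QX minus0[OF X] by simp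
  have "moore_penrose L = X"
    by (rule moore_penrose_eqI[OF L X LXL XLX]) (simp_all add: LX XL symQ)
  then show ?thesis using X LXL LX symQ by simp
qed

section \<open>The orthogonal projection onto the cut space\<close>

text \<open>
  \<open>A\<close> stands for \<open>B W\<^sup>1\<^sup>/\<^sup>2\<close> of a connected graph on \<open>k + 1\<close> vertices. The last two assumptions say
  that the potentials with vanishing cut vector \<open>A\<^sup>T q\<close> are exactly the constants.
\<close>
locale cut_space =
  fixes A :: "real mat" and k n :: nat
  assumes A: "A \<in> carrier_mat (Suc k) n" and k: "0 < k"
    and ones: "transpose_mat A *\<^sub>v vec (Suc k) (\<lambda>_. 1) = 0\<^sub>v n"
    and ker: "\<And>q. q \<in> carrier_vec (Suc k) \<Longrightarrow> transpose_mat A *\<^sub>v q = 0\<^sub>v n \<Longrightarrow> \<exists>c. q = vec (Suc k) (\<lambda>_. c)"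
begin

definition L where "L = A * transpose_mat A"
definition X where "X = moore_penrose L"
definition P where "P = transpose_mat A * X * A"

lemma At: "transpose_mat A \<in> carrier_mat n (Suc k)" using A by simp
lemma L: "L \<in> carrier_mat (Suc k) (Suc k)" unfolding L_def by (rule mult_carrier_mat[OF A At])

lemma L_sym: "transpose_mat L = L" unfolding L_def using transpose_mult[OF A At] by simp

lemma L_mult: "q \<in> carrier_vec (Suc k) \<Longrightarrow> L *\<^sub>v q = A *\<^sub>v (transpose_mat A *\<^sub>v q)"
  unfolding L_def by (rule assoc_mult_mat_vec[OF A At])

lemma L_kernel:
  assumes q: "q \<in> carrier_vec (Suc k)" and "L *\<^sub>v q = 0\<^sub>v (Suc k)"
  shows "transpose_mat A *\<^sub>v q = 0\<^sub>v n"
proof -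
  have Aq: "transpose_mat A *\<^sub>v q \<in> carrier_vec n" by (rule mult_mat_vec_carrier[OF At q])
  have "(transpose_mat A *\<^sub>v q) \<bullet> (transpose_mat A *\<^sub>v q) = q \<bullet> (L *\<^sub>v q)"
    unfolding L_mult[OF q] by (rule transpose_vec_mult_scalar[OF A Aq q])
  also have "\<dots> = 0" using assms by simp
  finally show ?thesis using real_vec_square_eq_0[OF Aq] by simp
qed

lemma L_cancel:
  assumes "p \<in> carrier_vec (Suc k)" "q \<in> carrier_vec (Suc k)" "L *\<^sub>v p = L *\<^sub>v q"
  shows "transpose_mat A *\<^sub>v p = transpose_mat A *\<^sub>v q"
proof (rule vec_eq_if_diff_zero)
  have "L *\<^sub>v (p - q) = 0\<^sub>v (Suc k)"
    using mult_minus_distrib_mat_vec[OF L assms(1,2)] assms(3) mult_mat_vec_carrier[OF L assms(2)] by simp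
  then have "transpose_mat A *\<^sub>v (p - q) = 0\<^sub>v n" by (intro L_kernel) (use assms in auto)
  then show "transpose_mat A *\<^sub>v p - transpose_mat A *\<^sub>v q = 0\<^sub>v n"
    using mult_minus_distrib_mat_vec[OF At assms(1,2)] by simp
qed (rule mult_mat_vec_carrier[OF At assms(1)] mult_mat_vec_carrier[OF At assms(2)])+

lemma X_props:
  "X \<in> carrier_mat (Suc k) (Suc k)" "L * X * L = L" "transpose_mat (L * X) = L * X"
proof -
  have "moore_penrose L \<in> carrier_mat (Suc k) (Suc k) \<and> L * moore_penrose L * L = L \<and>
    transpose_mat (L * moore_penrose L) = L * moore_penrose L"
  proof (rule moore_penrose_constant_kernel[OF L L_sym])
    show "L *\<^sub>v vec (Suc k) (\<lambda>_. 1) = 0\<^sub>v (Suc k)"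
      unfolding L_mult[OF vec_carrier] ones using A by (intro eq_vecI) auto
  qed (use L_kernel ker in blast)+
  then show "X \<in> carrier_mat (Suc k) (Suc k)" "L * X * L = L" "transpose_mat (L * X) = L * X"
    unfolding X_def by blast+
qed

lemma P: "P \<in> carrier_mat n n"
  unfolding P_def using mult_carrier_mat[OF mult_carrier_mat[OF At X_props(1)] A] .

lemma P_mult: "x \<in> carrier_vec n \<Longrightarrow> P *\<^sub>v x = transpose_mat A *\<^sub>v (X *\<^sub>v (A *\<^sub>v x))"
  unfolding P_def using assoc_mult_mat_vec[OF mult_carrier_mat[OF At X_props(1)] A]
    assoc_mult_mat_vec[OF At X_props(1) mult_mat_vec_carrier[OF A]] by simp

lemma P_fixes:
  assumes q: "q \<in> carrier_vec (Suc k)"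
  shows "P *\<^sub>v (transpose_mat A *\<^sub>v q) = transpose_mat A *\<^sub>v q"
proof -
  have Lq: "L *\<^sub>v q \<in> carrier_vec (Suc k)" by (rule mult_mat_vec_carrier[OF L q])
  have XLq: "X *\<^sub>v (L *\<^sub>v q) \<in> carrier_vec (Suc k)" by (rule mult_mat_vec_carrier[OF X_props(1) Lq])
  have "L *\<^sub>v (X *\<^sub>v (L *\<^sub>v q)) = L *\<^sub>v q"
    using X_props(2) assoc_mult_mat_vec[OF mult_carrier_mat[OF L X_props(1)] L q]
      assoc_mult_mat_vec[OF L X_props(1) Lq] by simp
  then have "transpose_mat A *\<^sub>v (X *\<^sub>v (L *\<^sub>v q)) = transpose_mat A *\<^sub>v q"
    by (rule L_cancel[OF XLq q])
  then show ?thesis using P_mult[OF mult_mat_vec_carrier[OF At q]] L_mult[OF q] by simp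
qed

text \<open>
  By the symmetry of \<open>L X\<close> also \<open>L (L X) = L\<close>, so \<open>L X\<close> changes vectors only by elements of the kernel
  of \<open>L\<close>, which \<open>A\<^sup>T\<close> annihilates.
\<close>
lemma A_P:
  assumes x: "x \<in> carrier_vec n"
  shows "A *\<^sub>v (P *\<^sub>v x) = A *\<^sub>v x"
proof -
  note X = X_props(1)
  have LX: "L * X \<in> carrier_mat (Suc k) (Suc k)" by (rule mult_carrier_mat[OF L X])
  have LLX: "L * (L * X) = L"
    using transpose_mult[OF LX L] X_props(2,3) L_sym by simp
  define u where "u = A *\<^sub>v x"
  have u: "u \<in> carrier_vec (Suc k)" unfolding u_def by (rule mult_mat_vec_carrier[OF A x])
  have Xu: "X *\<^sub>v u \<in> carrier_vec (Suc k)" by (rule mult_mat_vec_carrier[OF X u])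
  define v where "v = (L * X) *\<^sub>v u"
  have v: "v \<in> carrier_vec (Suc k)" unfolding v_def by (rule mult_mat_vec_carrier[OF LX u])
  have vA: "v = A *\<^sub>v (P *\<^sub>v x)"
    unfolding v_def P_mult[OF x] u_def[symmetric] assoc_mult_mat_vec[OF L X u] L_mult[OF Xu] ..
  \<comment> \<open>both sides have the same inner product with every vector\<close>
  have inner: "z \<bullet> v = z \<bullet> u" if z: "z \<in> carrier_vec (Suc k)" for z
  proof -
    define y where "y = (L * X) *\<^sub>v z"
    have y: "y \<in> carrier_vec (Suc k)" unfolding y_def by (rule mult_mat_vec_carrier[OF LX z])
    have "L *\<^sub>v y = L *\<^sub>v z" unfolding y_def using assoc_mult_mat_vec[OF L LX z] LLX by simp
    then have "transpose_mat A *\<^sub>v y = transpose_mat A *\<^sub>v z" by (rule L_cancel[OF y z])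
    then have "y \<bullet> u = z \<bullet> u"
      using transpose_vec_mult_scalar[OF A x y] transpose_vec_mult_scalar[OF A x z] unfolding u_def by simp
    moreover have "z \<bullet> v = y \<bullet> u"
      unfolding v_def y_def using transpose_vec_mult_scalar[OF LX u z] X_props(3) by simp
    ultimately show ?thesis by simp
  qed
  have "(v - u) \<bullet> (v - u) = 0"
    using inner[of "v - u"] scalar_prod_minus_distrib[of "v - u" "Suc k" v u] u v by simp
  then have "v - u = 0\<^sub>v (Suc k)" using real_vec_square_eq_0[of "v - u" "Suc k"] u v by simp
  then have "v = u" by (rule vec_eq_if_diff_zero[OF v u])
  then show ?thesis unfolding vA u_def .
qed

text \<open>
  Together with \<open>P_fixes\<close> this says that \<open>P\<close> is the orthogonal projection onto the range of \<open>A\<^sup>T\<close>.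
\<close>
lemma P_inner:
  assumes x: "x \<in> carrier_vec n" and y: "y \<in> carrier_vec n"
  shows "(P *\<^sub>v x) \<bullet> (P *\<^sub>v y) = (P *\<^sub>v x) \<bullet> y" "(P *\<^sub>v x) \<bullet> y = x \<bullet> (P *\<^sub>v y)"
proof -
  have main: "(P *\<^sub>v x) \<bullet> (P *\<^sub>v y) = (P *\<^sub>v x) \<bullet> y" if x: "x \<in> carrier_vec n" and y: "y \<in> carrier_vec n" for x y
  proof -
    define r where "r = X *\<^sub>v (A *\<^sub>v x)"
    have r: "r \<in> carrier_vec (Suc k)"
      unfolding r_def by (rule mult_mat_vec_carrier[OF X_props(1) mult_mat_vec_carrier[OF A x]])
    show ?thesis unfolding P_mult[OF x] r_def[symmetric]
      using transpose_vec_mult_scalar[OF A mult_mat_vec_carrier[OF P y] r]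
        transpose_vec_mult_scalar[OF A y r] A_P[OF y] by simp
  qed
  show "(P *\<^sub>v x) \<bullet> (P *\<^sub>v y) = (P *\<^sub>v x) \<bullet> y" by (rule main[OF x y])
  have c: "P *\<^sub>v x \<in> carrier_vec n" "P *\<^sub>v y \<in> carrier_vec n" using P x y by auto
  have "(P *\<^sub>v x) \<bullet> y = (P *\<^sub>v y) \<bullet> (P *\<^sub>v x)" using main[OF x y] comm_scalar_prod[OF c] by simp
  also have "\<dots> = x \<bullet> (P *\<^sub>v y)" using main[OF y x] comm_scalar_prod[OF c(2) x] by simp
  finally show "(P *\<^sub>v x) \<bullet> y = x \<bullet> (P *\<^sub>v y)" .
qed

lemma P_sym: "transpose_mat P = P"
proof (rule eq_matI)
  fix i j assume "i < dim_row P" "j < dim_col P"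
  then have ij: "i < n" "j < n" using P by auto
  have "P $$ (j, i) = (P *\<^sub>v unit_vec n i) $ j" "P $$ (i, j) = (P *\<^sub>v unit_vec n j) $ i"
    using ij P by (auto simp: scalar_prod_right_unit)
  moreover have "(P *\<^sub>v unit_vec n i) $ j = (P *\<^sub>v unit_vec n i) \<bullet> unit_vec n j"
    "(P *\<^sub>v unit_vec n j) $ i = unit_vec n i \<bullet> (P *\<^sub>v unit_vec n j)"
    using ij P by (auto simp: scalar_prod_right_unit scalar_prod_left_unit)
  moreover have "(P *\<^sub>v unit_vec n i) \<bullet> unit_vec n j = unit_vec n i \<bullet> (P *\<^sub>v unit_vec n j)"
    by (rule P_inner(2)) auto
  ultimately have "P $$ (j, i) = P $$ (i, j)" by simp
  then show "transpose_mat P $$ (i, j) = P $$ (i, j)" using ij P by simp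
qed (use P in auto)

text \<open>
  The columns of \<open>N\<close> are a basis of the cut space: potentials that vanish at the first vertex. With
  this parametrisation, restricting cut vectors to \<open>k\<close> edges becomes a square matrix.
\<close>

definition N where "N = mat n k (\<lambda>(j, i). A $$ (Suc i, j))"

lemma N: "N \<in> carrier_mat n k" by (simp add: N_def)

lemma N_grounded:
  assumes q: "q \<in> carrier_vec (Suc k)"
  shows "transpose_mat A *\<^sub>v q = N *\<^sub>v vec k (\<lambda>i. q $ Suc i - q $ 0)"
proof (rule eq_vecI)
  fix j assume "j < dim_vec (N *\<^sub>v vec k (\<lambda>i. q $ Suc i - q $ 0))"
  then have j: "j < n" by (simp add: N_def)
  have "(transpose_mat A *\<^sub>v vec (Suc k) (\<lambda>_. 1)) $ j = 0" unfolding ones using j by simp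
  then have "(\<Sum>i\<in>{0..<Suc k}. A $$ (i, j)) = 0" using A j by (simp add: scalar_prod_def)
  then have z: "A $$ (0, j) = - (\<Sum>i\<in>{0..<k}. A $$ (Suc i, j))"
    unfolding sum.atLeast0_lessThan_Suc_shift by (simp add: eq_neg_iff_add_eq_0)
  have "(transpose_mat A *\<^sub>v q) $ j = (\<Sum>i\<in>{0..<Suc k}. A $$ (i, j) * q $ i)"
    using A j q by (simp add: scalar_prod_def)
  also have "\<dots> = A $$ (0, j) * q $ 0 + (\<Sum>i\<in>{0..<k}. A $$ (Suc i, j) * q $ Suc i)"
    unfolding sum.atLeast0_lessThan_Suc_shift by simp
  also have "\<dots> = (\<Sum>i\<in>{0..<k}. A $$ (Suc i, j) * (q $ Suc i - q $ 0))"
    unfolding z by (simp add: right_diff_distrib sum_subtractf sum_distrib_right)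
  also have "\<dots> = (N *\<^sub>v vec k (\<lambda>i. q $ Suc i - q $ 0)) $ j"
    using j by (simp add: N_def scalar_prod_def)
  finally show "(transpose_mat A *\<^sub>v q) $ j = (N *\<^sub>v vec k (\<lambda>i. q $ Suc i - q $ 0)) $ j" .
qed (use A in \<open>simp add: N_def\<close>)

lemma N_potential:
  assumes p: "p \<in> carrier_vec k"
  obtains q where "q \<in> carrier_vec (Suc k)" "N *\<^sub>v p = transpose_mat A *\<^sub>v q" "q $ 0 = 0"
    "p = vec k (\<lambda>i. q $ Suc i)"
proof
  let ?q = "vec (Suc k) (\<lambda>i. if i = 0 then 0 else p $ (i - 1))"
  show "?q \<in> carrier_vec (Suc k)" by simp
  show p': "p = vec k (\<lambda>i. ?q $ Suc i)" using p by (intro eq_vecI) auto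
  have "p = vec k (\<lambda>i. ?q $ Suc i - ?q $ 0)" using p by (intro eq_vecI) auto
  then show "N *\<^sub>v p = transpose_mat A *\<^sub>v ?q" using N_grounded[of ?q] by simp
qed simp

lemma N_injective:
  assumes p: "p \<in> carrier_vec k" and "N *\<^sub>v p = 0\<^sub>v n"
  shows "p = 0\<^sub>v k"
proof -
  obtain q where q: "q \<in> carrier_vec (Suc k)" "N *\<^sub>v p = transpose_mat A *\<^sub>v q" "q $ 0 = 0"
    "p = vec k (\<lambda>i. q $ Suc i)" using N_potential[OF p] by blast
  then obtain c where "q = vec (Suc k) (\<lambda>_. c)" using ker assms(2) by metis
  then show ?thesis using q(3,4) by (intro eq_vecI) auto
qed

lemma P_N: "p \<in> carrier_vec k \<Longrightarrow> P *\<^sub>v (N *\<^sub>v p) = N *\<^sub>v p"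
  using N_potential P_fixes by metis

lemma P_range:
  assumes "x \<in> carrier_vec n"
  obtains p where "p \<in> carrier_vec k" "P *\<^sub>v x = N *\<^sub>v p"
  using P_mult[OF assms] N_grounded[OF mult_mat_vec_carrier[OF X_props(1) mult_mat_vec_carrier[OF A assms]]]
  by (intro that[of "vec k _"]) auto

text \<open>
  \<open>R\<close> stands for the restriction to \<open>k\<close> coordinates and \<open>C\<close> for the principal submatrix of \<open>P\<close> on them.
\<close>
context
  fixes R :: "real mat"
  assumes R: "R \<in> carrier_mat k n"
begin

definition C where "C = R * P * transpose_mat R"

lemma Rt: "transpose_mat R \<in> carrier_mat n k" using R by simp

lemma C: "C \<in> carrier_mat k k"
  unfolding C_def by (rule mult_carrier_mat[OF mult_carrier_mat[OF R P] Rt])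

lemma C_sym: "transpose_mat C = C"
  unfolding C_def using transpose_mult[OF mult_carrier_mat[OF R P] Rt] transpose_mult[OF R P] P_sym
    assoc_mult_mat[OF R P Rt] by simp

lemma C_mult: "y \<in> carrier_vec k \<Longrightarrow> C *\<^sub>v y = R *\<^sub>v (P *\<^sub>v (transpose_mat R *\<^sub>v y))"
  unfolding C_def using assoc_mult_mat_vec[OF mult_carrier_mat[OF R P] Rt]
    assoc_mult_mat_vec[OF R P mult_mat_vec_carrier[OF Rt]] by simp

text \<open>
  If \<open>R\<close> is injective on the cut space, it maps it onto all vectors of length \<open>k\<close>, and \<open>C = R R\<^sup>T\<close>
  has the same eigenvalues as \<open>R\<^sup>T R\<close> on the cut space, where \<open>R\<^sup>T\<close> is the adjoint \<open>y \<mapsto> P (R\<^sup>T y)\<close>. For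
  an eigenvector \<open>x\<close> of the latter, the eigenvalue is the ratio of the squared norms of \<open>R x\<close> and \<open>x\<close>.
\<close>
lemma eigenvalue_is_ratio:
  assumes inj: "\<And>p. p \<in> carrier_vec k \<Longrightarrow> R *\<^sub>v (N *\<^sub>v p) = 0\<^sub>v k \<Longrightarrow> p = 0\<^sub>v k"
    and ev: "eigenvalue C \<kappa>"
  obtains p where "p \<in> carrier_vec k" "p \<noteq> 0\<^sub>v k"
    "\<kappa> * ((N *\<^sub>v p) \<bullet> (N *\<^sub>v p)) = (R *\<^sub>v (N *\<^sub>v p)) \<bullet> (R *\<^sub>v (N *\<^sub>v p))"
proof -
  have RN: "R * N \<in> carrier_mat k k" by (rule mult_carrier_mat[OF R N])
  have RN_mult: "(R * N) *\<^sub>v p = R *\<^sub>v (N *\<^sub>v p)" if "p \<in> carrier_vec k" for p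
    by (rule assoc_mult_mat_vec[OF R N that])
  obtain B where B: "B \<in> carrier_mat k k" "R * N * B = 1\<^sub>m k"
    using injective_mat_inverse[OF RN] inj RN_mult by metis
  obtain y where y: "y \<in> carrier_vec k" "y \<noteq> 0\<^sub>v k" "C *\<^sub>v y = \<kappa> \<cdot>\<^sub>v y"
    using ev C unfolding eigenvalue_def eigenvector_def by auto
  define p where "p = B *\<^sub>v y"
  have p: "p \<in> carrier_vec k" unfolding p_def by (rule mult_mat_vec_carrier[OF B(1) y(1)])
  have Np: "N *\<^sub>v p \<in> carrier_vec n" by (rule mult_mat_vec_carrier[OF N p])
  have "(R * N) *\<^sub>v p = y"
    unfolding p_def assoc_mult_mat_vec[OF RN B(1) y(1), symmetric] B(2) using y(1) by simp
  then have yp: "y = R *\<^sub>v (N *\<^sub>v p)" using RN_mult[OF p] by simp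
  define z where "z = transpose_mat R *\<^sub>v y"
  have z: "z \<in> carrier_vec n" unfolding z_def by (rule mult_mat_vec_carrier[OF Rt y(1)])
  obtain q where q: "q \<in> carrier_vec k" "P *\<^sub>v z = N *\<^sub>v q" using P_range[OF z] by blast
  have "R *\<^sub>v (N *\<^sub>v q) = \<kappa> \<cdot>\<^sub>v (R *\<^sub>v (N *\<^sub>v p))" using y(3) C_mult[OF y(1)] q(2) yp z_def by simp
  then have eq: "(R * N) *\<^sub>v q = (R * N) *\<^sub>v (\<kappa> \<cdot>\<^sub>v p)"
    unfolding mult_mat_vec[OF RN p] RN_mult[OF q(1)] RN_mult[OF p] .
  have kp: "\<kappa> \<cdot>\<^sub>v p \<in> carrier_vec k" using p by simp
  have "(R * N) *\<^sub>v (q - \<kappa> \<cdot>\<^sub>v p) = 0\<^sub>v k"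
    unfolding mult_minus_distrib_mat_vec[OF RN q(1) kp] eq
    using mult_mat_vec_carrier[OF RN kp] by (rule minus_cancel_vec)
  moreover have qkp: "q - \<kappa> \<cdot>\<^sub>v p \<in> carrier_vec k" using kp q(1) by simp
  ultimately have "R *\<^sub>v (N *\<^sub>v (q - \<kappa> \<cdot>\<^sub>v p)) = 0\<^sub>v k" unfolding RN_mult[OF qkp] by simp
  then have "q - \<kappa> \<cdot>\<^sub>v p = 0\<^sub>v k" by (rule inj[OF qkp])
  then have "q = \<kappa> \<cdot>\<^sub>v p" by (rule vec_eq_if_diff_zero[OF q(1) kp])
  then have Pz: "P *\<^sub>v z = \<kappa> \<cdot>\<^sub>v (N *\<^sub>v p)" using q(2) mult_mat_vec[OF N p] by simp
  have "\<kappa> * ((N *\<^sub>v p) \<bullet> (N *\<^sub>v p)) = (N *\<^sub>v p) \<bullet> (P *\<^sub>v z)" unfolding Pz using Np by simp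
  also have "\<dots> = (N *\<^sub>v p) \<bullet> z" using P_inner(2)[OF Np z] P_N[OF p] by simp
  also have "\<dots> = z \<bullet> (N *\<^sub>v p)" by (rule comm_scalar_prod[OF Np z])
  also have "\<dots> = y \<bullet> (R *\<^sub>v (N *\<^sub>v p))" unfolding z_def by (rule transpose_vec_mult_scalar[OF R Np y(1)])
  finally have "\<kappa> * ((N *\<^sub>v p) \<bullet> (N *\<^sub>v p)) = (R *\<^sub>v (N *\<^sub>v p)) \<bullet> (R *\<^sub>v (N *\<^sub>v p))"
    unfolding yp[symmetric] .
  moreover have "p \<noteq> 0\<^sub>v k"
  proof
    assume "p = 0\<^sub>v k"
    then have "y = (R * N) *\<^sub>v 0\<^sub>v k" using yp RN_mult[OF p] by simp
    also have "\<dots> = 0\<^sub>v k" by (rule mult_mat_zero_vec[OF RN])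
    finally show False using y(2) by simp
  qed
  ultimately show thesis using that p by blast
qed

text \<open>
  Since \<open>C\<close> is positive definite, every cut vector is \<open>x = P (R\<^sup>T y)\<close> for some \<open>y\<close>, and then \<open>R x = C y\<close>
  and \<open>x \<bullet> x = y \<bullet> C y \<ge> \<mu> (y \<bullet> y)\<close>. Expanding the square of \<open>R x - \<mu> y\<close> gives \<open>R x \<bullet> R x \<ge> \<mu> (x \<bullet> x)\<close>.
\<close>
lemma restriction_lower_bound:
  assumes c: "0 < c" and min: "c < lambda_min C" and p: "p \<in> carrier_vec k" "p \<noteq> 0\<^sub>v k"
  shows "c * ((N *\<^sub>v p) \<bullet> (N *\<^sub>v p)) < (R *\<^sub>v (N *\<^sub>v p)) \<bullet> (R *\<^sub>v (N *\<^sub>v p))"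
proof -
  define \<mu> where "\<mu> = lambda_min C"
  have \<mu>: "0 < \<mu>" "c < \<mu>" using c min by (auto simp: \<mu>_def)
  have low: "\<mu> * (y \<bullet> y) \<le> y \<bullet> (C *\<^sub>v y)" if "y \<in> carrier_vec k" for y
    unfolding \<mu>_def by (rule lambda_min_symmetric(2)[OF C C_sym k that])
  have RN: "R * N \<in> carrier_mat k k" by (rule mult_carrier_mat[OF R N])
  have Nt: "transpose_mat N \<in> carrier_mat k n" using N by simp
  define K where "K = transpose_mat (R * N)"
  have K: "K \<in> carrier_mat k k" using RN by (simp add: K_def)
  have K_mult: "K *\<^sub>v y = transpose_mat N *\<^sub>v (transpose_mat R *\<^sub>v y)" if "y \<in> carrier_vec k" for y
    unfolding K_def transpose_mult[OF R N] by (rule assoc_mult_mat_vec[OF Nt Rt that])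
  have kerN: "P *\<^sub>v x = 0\<^sub>v n" if x: "x \<in> carrier_vec n" and "transpose_mat N *\<^sub>v x = 0\<^sub>v k" for x
  proof -
    obtain q where q: "q \<in> carrier_vec k" "P *\<^sub>v x = N *\<^sub>v q" using P_range[OF x] by blast
    have Px: "P *\<^sub>v x \<in> carrier_vec n" by (rule mult_mat_vec_carrier[OF P x])
    have "(P *\<^sub>v x) \<bullet> (P *\<^sub>v x) = (P *\<^sub>v x) \<bullet> x" by (rule P_inner(1)[OF x x])
    also have "\<dots> = x \<bullet> (N *\<^sub>v q)" unfolding q(2)[symmetric] by (rule comm_scalar_prod[OF Px x])
    also have "\<dots> = (transpose_mat N *\<^sub>v x) \<bullet> q" by (rule transpose_vec_mult_scalar[OF N q(1) x, symmetric])
    also have "\<dots> = 0" using that(2) q(1) by simp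
    finally show ?thesis using real_vec_square_eq_0[OF Px] by simp
  qed
  obtain B where B: "B \<in> carrier_mat k k" "K * B = 1\<^sub>m k"
  proof (rule injective_mat_inverse[OF K])
    fix y assume y: "y \<in> carrier_vec k" and Ky: "K *\<^sub>v y = 0\<^sub>v k"
    have "P *\<^sub>v (transpose_mat R *\<^sub>v y) = 0\<^sub>v n"
      by (rule kerN) (use K_mult[OF y] Ky mult_mat_vec_carrier[OF Rt y] in auto)
    then have "C *\<^sub>v y = 0\<^sub>v k" unfolding C_mult[OF y] using R by (intro eq_vecI) auto
    then have "\<mu> * (y \<bullet> y) \<le> 0" using low[OF y] y by simp
    then have "y \<bullet> y = 0" using \<mu>(1) real_vec_square_nonneg[of y] by (simp add: mult_le_0_iff)
    then show "y = 0\<^sub>v k" using real_vec_square_eq_0[OF y] by simp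
  qed blast
  define x where "x = N *\<^sub>v p"
  have x: "x \<in> carrier_vec n" unfolding x_def by (rule mult_mat_vec_carrier[OF N p(1)])
  have x0: "x \<noteq> 0\<^sub>v n" using N_injective[OF p(1)] p(2) unfolding x_def by blast
  have Ntx: "transpose_mat N *\<^sub>v x \<in> carrier_vec k" by (rule mult_mat_vec_carrier[OF Nt x])
  define y where "y = B *\<^sub>v (transpose_mat N *\<^sub>v x)"
  have y: "y \<in> carrier_vec k" unfolding y_def by (rule mult_mat_vec_carrier[OF B(1) Ntx])
  define z where "z = transpose_mat R *\<^sub>v y"
  have z: "z \<in> carrier_vec n" unfolding z_def by (rule mult_mat_vec_carrier[OF Rt y])
  have "K *\<^sub>v y = transpose_mat N *\<^sub>v x"
    unfolding y_def using assoc_mult_mat_vec[OF K B(1) Ntx] B(2) Ntx by simp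
  then have "transpose_mat N *\<^sub>v (z - x) = 0\<^sub>v k"
    using mult_minus_distrib_mat_vec[OF Nt z x] K_mult[OF y] Ntx unfolding z_def by simp
  then have "P *\<^sub>v (z - x) = 0\<^sub>v n" by (intro kerN) (use z x in auto)
  then have d0: "P *\<^sub>v z - x = 0\<^sub>v n"
    using mult_minus_distrib_mat_vec[OF P z x] P_N[OF p(1)] unfolding x_def by simp
  have Pz: "P *\<^sub>v z = x" by (rule vec_eq_if_diff_zero[OF mult_mat_vec_carrier[OF P z] x d0])
  define u where "u = R *\<^sub>v x"
  have u: "u \<in> carrier_vec k" unfolding u_def by (rule mult_mat_vec_carrier[OF R x])
  have Cy: "C *\<^sub>v y = u" using C_mult[OF y] Pz unfolding z_def u_def by simp
  have s: "x \<bullet> x = y \<bullet> u"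
  proof -
    have "x \<bullet> x = x \<bullet> z" using P_inner(1)[OF z z] Pz by simp
    also have "\<dots> = z \<bullet> x" by (rule comm_scalar_prod[OF x z])
    also have "\<dots> = y \<bullet> u" unfolding z_def u_def by (rule transpose_vec_mult_scalar[OF R x y])
    finally show ?thesis .
  qed
  define v where "v = u - \<mu> \<cdot>\<^sub>v y"
  have v: "v \<in> carrier_vec k" using u y by (simp add: v_def)
  have "v \<bullet> v = v \<bullet> u - \<mu> * (v \<bullet> y)"
    using scalar_prod_minus_distrib[OF v u, of "\<mu> \<cdot>\<^sub>v y"] v u y by (simp add: v_def[symmetric])
  also have "v \<bullet> u = u \<bullet> u - \<mu> * (y \<bullet> u)"
    unfolding v_def using u y by (subst minus_scalar_prod_distrib[of _ k]) auto
  also have "v \<bullet> y = u \<bullet> y - \<mu> * (y \<bullet> y)"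
    unfolding v_def using u y by (subst minus_scalar_prod_distrib[of _ k]) auto
  also have "u \<bullet> y = y \<bullet> u" by (rule comm_scalar_prod[OF u y])
  finally have "v \<bullet> v = u \<bullet> u - 2 * \<mu> * (y \<bullet> u) + \<mu> * (\<mu> * (y \<bullet> y))" by (simp add: algebra_simps)
  moreover have "0 \<le> v \<bullet> v" by (rule real_vec_square_nonneg)
  moreover have "\<mu> * (\<mu> * (y \<bullet> y)) \<le> \<mu> * (y \<bullet> u)" using low[OF y] \<mu>(1) unfolding Cy by (simp add: mult_left_mono)
  ultimately have "\<mu> * (y \<bullet> u) \<le> u \<bullet> u" by linarith
  moreover have "c * (x \<bullet> x) < \<mu> * (x \<bullet> x)" using \<mu>(2) real_vec_square_pos[OF x x0] by simp
  ultimately show ?thesis unfolding x_def[symmetric] u_def[symmetric] using s by simp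
qed

lemma cut_space_cut:
  assumes "q \<in> carrier_vec (Suc k)"
  obtains p where "p \<in> carrier_vec k" "transpose_mat A *\<^sub>v q = N *\<^sub>v p"
  using N_grounded[OF assms] by (intro that[of "vec k _"]) auto

theorem lambda_min_gt_imp:
  assumes "0 < c" "c < lambda_min C" and q: "q \<in> carrier_vec (Suc k)" "transpose_mat A *\<^sub>v q \<noteq> 0\<^sub>v n"
  defines "x \<equiv> transpose_mat A *\<^sub>v q"
  shows "c * (x \<bullet> x) < (R *\<^sub>v x) \<bullet> (R *\<^sub>v x)"
proof -
  obtain p where p: "p \<in> carrier_vec k" "x = N *\<^sub>v p" unfolding x_def using cut_space_cut[OF q(1)] by blast
  have "p \<noteq> 0\<^sub>v k"
  proof
    assume "p = 0\<^sub>v k"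
    then have "x = 0\<^sub>v n" unfolding p(2) using N by (intro eq_vecI) auto
    then show False using q(2) by (simp add: x_def)
  qed
  then show ?thesis unfolding p(2) using restriction_lower_bound[OF assms(1,2) p(1)] by blast
qed

text \<open>
  The lower bound makes \<open>R\<close> injective on the cut space, so the least eigenvalue is a ratio of
  squared norms as in \<open>eigenvalue_is_ratio\<close>.
\<close>
theorem lambda_min_attained:
  assumes "0 < c"
    and low: "\<And>q. q \<in> carrier_vec (Suc k) \<Longrightarrow> c * ((transpose_mat A *\<^sub>v q) \<bullet> (transpose_mat A *\<^sub>v q))
      \<le> (R *\<^sub>v (transpose_mat A *\<^sub>v q)) \<bullet> (R *\<^sub>v (transpose_mat A *\<^sub>v q))"
  obtains q where "q \<in> carrier_vec (Suc k)" "0 < (transpose_mat A *\<^sub>v q) \<bullet> (transpose_mat A *\<^sub>v q)"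
    "lambda_min C * ((transpose_mat A *\<^sub>v q) \<bullet> (transpose_mat A *\<^sub>v q))
      = (R *\<^sub>v (transpose_mat A *\<^sub>v q)) \<bullet> (R *\<^sub>v (transpose_mat A *\<^sub>v q))"
proof -
  have inj: "p = 0\<^sub>v k" if p: "p \<in> carrier_vec k" and z: "R *\<^sub>v (N *\<^sub>v p) = 0\<^sub>v k" for p
  proof -
    obtain q where q: "q \<in> carrier_vec (Suc k)" "N *\<^sub>v p = transpose_mat A *\<^sub>v q" using N_potential[OF p] by blast
    have "c * ((N *\<^sub>v p) \<bullet> (N *\<^sub>v p)) \<le> 0" using low[OF q(1)] unfolding q(2)[symmetric] z by simp
    then have "(N *\<^sub>v p) \<bullet> (N *\<^sub>v p) = 0"
      using assms(1) real_vec_square_nonneg[of "N *\<^sub>v p"] by (simp add: mult_le_0_iff)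
    then show ?thesis using N_injective[OF p] real_vec_square_eq_0[OF mult_mat_vec_carrier[OF N p]] by simp
  qed
  obtain p where p: "p \<in> carrier_vec k" "p \<noteq> 0\<^sub>v k"
    "lambda_min C * ((N *\<^sub>v p) \<bullet> (N *\<^sub>v p)) = (R *\<^sub>v (N *\<^sub>v p)) \<bullet> (R *\<^sub>v (N *\<^sub>v p))"
    using eigenvalue_is_ratio[OF inj lambda_min_symmetric(1)[OF C C_sym k]] by blast
  obtain q where q: "q \<in> carrier_vec (Suc k)" "N *\<^sub>v p = transpose_mat A *\<^sub>v q" using N_potential[OF p(1)] by blast
  have "0 < (N *\<^sub>v p) \<bullet> (N *\<^sub>v p)"
    by (rule real_vec_square_pos[OF mult_mat_vec_carrier[OF N p(1)]]) (use N_injective[OF p(1)] p(2) in blast)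
  then show thesis using that[OF q(1)] p(3) unfolding q(2) by blast
qed

end

end

section \<open>From edge sets to eigenvalues\<close>

lemma bij_betw_pick: "bij_betw (pick J) {..<card J} J" if "finite J"
proof -
  have inj: "inj_on (pick J) {..<card J}"
  proof (rule linorder_inj_onI)
    fix i j assume "i < j" "i \<in> {..<card J}" "j \<in> {..<card J}"
    then have "pick J i < pick J j" by (intro pick_mono_le) auto
    then show "pick J i \<noteq> pick J j" by simp
  qed auto
  have "pick J ` {..<card J} \<subseteq> J" using pick_in_set_le by blast
  moreover have "card (pick J ` {..<card J}) = card J" using card_image[OF inj] by simp
  ultimately have "pick J ` {..<card J} = J" using card_subset_eq[OF that] by blast
  then show ?thesis using inj unfolding bij_betw_def by blast
qed

lemma mult_unit_vec_index:
  assumes "M \<in> carrier_mat a b" "i < a" "j < b"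
  shows "(M *\<^sub>v unit_vec b j) $ i = (M $$ (i, j) :: real)"
  using assms by (auto simp: scalar_prod_right_unit)

locale weighted_network =
  fixes G :: "('v, 'e) mgraph" and w :: "'e \<Rightarrow> real" and n k :: nat
    and h :: "'e \<Rightarrow> 'v" and vs :: "'v list" and es :: "'e list" and t :: "'e dtree" and l r :: 'v
  assumes dec: "decomposes t G l r"
    and card_edges: "card (edges G) = n" and card_verts: "card (verts G) = k + 1"
    and w: "\<And>e. e \<in> edges G \<Longrightarrow> 0 < w e"
    and orient: "orientation G h"
    and vs: "distinct vs" "set vs = verts G" and es: "distinct es" "set es = edges G"
begin

lemma length_vs: "length vs = Suc k" using distinct_card[OF vs(1)] vs(2) card_verts by simp
lemma length_es: "length es = n" using distinct_card[OF es(1)] es(2) card_edges by simp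

definition B where "B = incidence_mat G h vs es"
definition S where "S = weight_sqrt_mat w es"
definition A where "A = B * S"

lemma B: "B \<in> carrier_mat (Suc k) n" unfolding B_def incidence_mat_def by (simp add: length_vs length_es)
lemma S: "S \<in> carrier_mat n n" unfolding S_def weight_sqrt_mat_def using length_es by simp
lemma A: "A \<in> carrier_mat (Suc k) n" unfolding A_def by (rule mult_carrier_mat[OF B S])

lemma A_index: "i < Suc k \<Longrightarrow> j < n \<Longrightarrow> A $$ (i, j) = B $$ (i, j) * sqrt (w (es ! j))"
  unfolding A_def S_def weight_sqrt_mat_def length_es by (subst mat_diag_mult_right[OF B]) simp

definition pvec :: "('v \<Rightarrow> real) \<Rightarrow> real vec" where "pvec p = vec (Suc k) (\<lambda>i. p (vs ! i))"

lemma pvec: "pvec p \<in> carrier_vec (Suc k)" by (simp add: pvec_def)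

lemma pvec_surj:
  assumes "q \<in> carrier_vec (Suc k)"
  obtains p where "q = pvec p"
proof
  let ?i = "inv_into {..<length vs} ((!) vs)"
  have "inj_on ((!) vs) {..<length vs}" by (rule inj_on_nth[OF vs(1)]) simp
  then have "?i (vs ! i) = i" if "i < length vs" for i using that by (intro inv_into_f_f) auto
  then show "q = pvec (\<lambda>v. q $ ?i v)" using assms length_vs unfolding pvec_def by (intro eq_vecI) auto
qed

text \<open>
  The coefficients of the incidence matrix at the two ends have opposite signs, whatever the
  orientation, and the square removes the overall sign.
\<close>
lemma cut_vector_square:
  assumes j: "j < n"
  shows "((transpose_mat A *\<^sub>v pvec p) $ j)\<^sup>2 = w (es ! j) * (gap p (ends G (es ! j)))\<^sup>2"
proof -
  have e: "es ! j \<in> edges G" using j length_es es(2) nth_mem by metis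
  obtain u v where uv: "u \<noteq> v" "u \<in> verts G" "v \<in> verts G" "ends G (es ! j) = {u, v}"
    using decomposes_ends[OF dec e] by blast
  have head: "h (es ! j) \<in> {u, v}" using orient e uv(4) unfolding orientation_def by blast
  define c where "c x = (if x \<notin> {u, v} then 0 else if x = h (es ! j) then 1 else - 1 :: real)" for x
  have "(transpose_mat A *\<^sub>v pvec p) $ j = (\<Sum>i\<in>{0..<Suc k}. A $$ (i, j) * p (vs ! i))"
    using A j by (simp add: pvec_def scalar_prod_def)
  also have "\<dots> = (\<Sum>i\<in>{0..<Suc k}. sqrt (w (es ! j)) * (c (vs ! i) * p (vs ! i)))"
  proof (rule sum.cong[OF refl])
    fix i assume "i \<in> {0..<Suc k}"
    then have i: "i < Suc k" by simp
    then have "B $$ (i, j) = c (vs ! i)"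
      unfolding B_def incidence_mat_def c_def uv(4)[symmetric] using j by (simp add: length_vs length_es)
    then show "A $$ (i, j) * p (vs ! i) = sqrt (w (es ! j)) * (c (vs ! i) * p (vs ! i))"
      using A_index[OF i j] by simp
  qed
  also have "\<dots> = sqrt (w (es ! j)) * (\<Sum>i\<in>{0..<Suc k}. c (vs ! i) * p (vs ! i))"
    by (rule sum_distrib_left[symmetric])
  also have "(\<Sum>i\<in>{0..<Suc k}. c (vs ! i) * p (vs ! i)) = (\<Sum>x\<in>verts G. c x * p x)"
    by (rule sum.reindex_bij_betw[OF bij_betw_nth]) (use vs length_vs in auto)
  also have "\<dots> = (\<Sum>x\<in>{u, v}. c x * p x)"
    by (rule sum.mono_neutral_right) (use uv decomposes_finite[OF dec] in \<open>auto simp: c_def\<close>)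
  also have "\<dots> = c u * p u + c v * p v" using uv(1) by simp
  finally have "((transpose_mat A *\<^sub>v pvec p) $ j)\<^sup>2 = (sqrt (w (es ! j)))\<^sup>2 * (c u * p u + c v * p v)\<^sup>2"
    by (simp add: power_mult_distrib)
  also have "(sqrt (w (es ! j)))\<^sup>2 = w (es ! j)" using w[OF e] by simp
  also have "(c u * p u + c v * p v)\<^sup>2 = (gap p (ends G (es ! j)))\<^sup>2"
    using head uv(1) unfolding uv(4) gap_pair_square by (auto simp: c_def power2_commute)
  finally show ?thesis .
qed

lemma cut_vector_zero_iff:
  "transpose_mat A *\<^sub>v pvec p = 0\<^sub>v n \<longleftrightarrow> (\<forall>v\<in>verts G. p v = p l)"
proof
  assume z: "transpose_mat A *\<^sub>v pvec p = 0\<^sub>v n"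
  have "gap p (ends G e) = 0" if e: "e \<in> edges G" for e
  proof -
    obtain j where j: "j < n" "es ! j = e" using e es(2) length_es by (metis in_set_conv_nth)
    have "w e * (gap p (ends G e))\<^sup>2 = 0" using cut_vector_square[OF j(1), of p] z j by simp
    then show ?thesis using w[OF e] by simp
  qed
  then show "\<forall>v\<in>verts G. p v = p l" using gap_zero_constant[OF dec] by blast
next
  assume c: "\<forall>v\<in>verts G. p v = p l"
  show "transpose_mat A *\<^sub>v pvec p = 0\<^sub>v n"
  proof (rule eq_vecI)
    fix j assume "j < dim_vec (0\<^sub>v n :: real vec)"
    then have j: "j < n" by simp
    have e: "es ! j \<in> edges G" using j length_es es(2) nth_mem by metis
    obtain u v where uv: "u \<in> verts G" "v \<in> verts G" "ends G (es ! j) = {u, v}"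
      using decomposes_ends[OF dec e] by blast
    have "(gap p (ends G (es ! j)))\<^sup>2 = 0" unfolding uv(3) gap_pair_square using c uv by simp
    then have "((transpose_mat A *\<^sub>v pvec p) $ j)\<^sup>2 = 0" using cut_vector_square[OF j] by simp
    then show "(transpose_mat A *\<^sub>v pvec p) $ j = 0\<^sub>v n $ j" using j by simp
  qed (use A in simp)
qed

sublocale cut_space A k n
proof
  show "A \<in> carrier_mat (Suc k) n" by (rule A)
  show "0 < k" using decomposes_card_verts[OF dec] card_verts by simp
  have "vec (Suc k) (\<lambda>_. 1) = pvec (\<lambda>_. 1)" by (simp add: pvec_def)
  then show "transpose_mat A *\<^sub>v vec (Suc k) (\<lambda>_. 1) = 0\<^sub>v n" using cut_vector_zero_iff[of "\<lambda>_. 1"] by simp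
  fix q assume q: "q \<in> carrier_vec (Suc k)" "transpose_mat A *\<^sub>v q = 0\<^sub>v n"
  obtain p where p: "q = pvec p" using pvec_surj[OF q(1)] .
  have const: "\<forall>v\<in>verts G. p v = p l" using q(2) cut_vector_zero_iff unfolding p by blast
  have "vs ! i \<in> verts G" if "i < Suc k" for i using that length_vs vs(2) nth_mem by metis
  then have "q = vec (Suc k) (\<lambda>_. p l)" unfolding p pvec_def using const by (intro eq_vecI) auto
  then show "\<exists>c. q = vec (Suc k) (\<lambda>_. c)" by blast
qed

lemma proj_mat_eq: "proj_mat G h vs es w = P"
proof -
  have St: "transpose_mat S = S"
    unfolding S_def weight_sqrt_mat_def mat_diag_def by (intro eq_matI) auto
  have Bt: "transpose_mat B \<in> carrier_mat n (Suc k)" using B by simp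
  have W: "weight_mat w es = S * S"
  proof (rule eq_matI)
    fix i j assume "i < dim_row (S * S)" "j < dim_col (S * S)"
    then have ij: "i < n" "j < n" using S by auto
    have e: "es ! j \<in> edges G" using ij length_es es(2) nth_mem by metis
    have "(S * S) $$ (i, j) = S $$ (i, j) * sqrt (w (es ! j))"
      unfolding S_def weight_sqrt_mat_def length_es using ij by (subst mat_diag_mult_right[of _ n n]) auto
    also have "\<dots> = weight_mat w es $$ (i, j)"
      unfolding S_def weight_sqrt_mat_def weight_mat_def length_es mat_diag_def using ij w[OF e] by simp
    finally show "weight_mat w es $$ (i, j) = (S * S) $$ (i, j)" by simp
  qed (use S length_es in \<open>auto simp: weight_mat_def mat_diag_def\<close>)
  have At: "transpose_mat A = S * transpose_mat B" unfolding A_def transpose_mult[OF B S] St ..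
  have "B * weight_mat w es * transpose_mat B = A * transpose_mat A"
    unfolding W At using assoc_mult_mat[OF B S S] assoc_mult_mat[OF A S Bt] by (simp add: A_def)
  then have L: "B * weight_mat w es * transpose_mat B = L" by (simp only: L_def)
  have "proj_mat G h vs es w = S * transpose_mat B * X * B * S"
    unfolding proj_mat_def Let_def B_def[symmetric] S_def[symmetric] L X_def ..
  also have "\<dots> = S * transpose_mat B * X * (B * S)"
    by (rule assoc_mult_mat[OF _ B S]) (use mult_carrier_mat[OF mult_carrier_mat[OF S Bt] X_props(1)] in simp)
  also have "\<dots> = P" by (simp only: P_def At[symmetric] A_def[symmetric])
  finally show ?thesis .
qed

definition position_set where "position_set I = {j. j < n \<and> es ! j \<in> I}"
definition selection :: "'e set \<Rightarrow> real mat" where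
  "selection I = mat k n (\<lambda>(i, j). if pick (position_set I) i = j then 1 else 0)"

context
  fixes I assumes I: "I \<subseteq> edges G" "card I = k"
begin

lemma positions: "finite (position_set I)" "position_set I \<subseteq> {..<n}" "bij_betw ((!) es) (position_set I) I"
proof -
  show "finite (position_set I)" "position_set I \<subseteq> {..<n}" unfolding position_set_def by auto
  have "inj_on ((!) es) (position_set I)" by (rule inj_on_nth[OF es(1)]) (auto simp: position_set_def length_es)
  moreover have "(!) es ` position_set I = I"
  proof
    show "I \<subseteq> (!) es ` position_set I"
    proof
      fix e assume e: "e \<in> I"
      then have "e \<in> set es" using I(1) es(2) by blast
      then obtain j where "j < n" "es ! j = e" using length_es by (metis in_set_conv_nth)
      then show "e \<in> (!) es ` position_set I" using e unfolding position_set_def by blast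
    qed
  qed (auto simp: position_set_def)
  ultimately show "bij_betw ((!) es) (position_set I) I" unfolding bij_betw_def by blast
qed

lemma card_positions: "card (position_set I) = k" using bij_betw_same_card[OF positions(3)] I(2) by simp

lemma pick_position: "i < k \<Longrightarrow> pick (position_set I) i < n"
  using pick_in_set_le[of i "position_set I"] card_positions positions(2) by auto

lemma selection: "selection I \<in> carrier_mat k n" by (simp add: selection_def)

lemma selection_mult:
  assumes "x \<in> carrier_vec n"
  shows "selection I *\<^sub>v x = vec k (\<lambda>i. x $ pick (position_set I) i)"
proof (rule eq_vecI)
  fix i assume "i < dim_vec (vec k (\<lambda>i. x $ pick (position_set I) i))"
  then have i: "i < k" by simp
  have "(selection I *\<^sub>v x) $ i = (\<Sum>j\<in>{0..<n}. (if pick (position_set I) i = j then 1 else 0) * x $ j)"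
    using i assms by (simp add: selection_def scalar_prod_def)
  also have "\<dots> = x $ pick (position_set I) i"
    using pick_position[OF i] by (simp add: if_distrib[of "\<lambda>z. z * _"] cong: if_cong)
  finally show "(selection I *\<^sub>v x) $ i = vec k (\<lambda>i. x $ pick (position_set I) i) $ i" using i by simp
qed (simp add: selection_def)

lemma principal_submat_eq:
  "principal_submat es (proj_mat G h vs es w) I = selection I * P * transpose_mat (selection I)"
proof -
  have J: "{j. j < length es \<and> es ! j \<in> I} = position_set I" by (simp add: position_set_def length_es)
  have dims: "{i. i < n \<and> i \<in> position_set I} = position_set I" using positions(2) by auto
  have Rt: "transpose_mat (selection I) \<in> carrier_mat n k" using selection by simp
  have RP: "selection I * P \<in> carrier_mat k n" by (rule mult_carrier_mat[OF selection P])
  have col_Rt: "P *\<^sub>v col (transpose_mat (selection I)) j = col P (pick (position_set I) j)" if j: "j < k" for j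
  proof (rule eq_vecI)
    fix i assume "i < dim_vec (col P (pick (position_set I) j))"
    then have i: "i < n" using P by simp
    have "(P *\<^sub>v col (transpose_mat (selection I)) j) $ i =
        (\<Sum>a\<in>{0..<n}. P $$ (i, a) * (if pick (position_set I) j = a then 1 else 0))"
      using i j P selection by (simp add: selection_def scalar_prod_def)
    also have "\<dots> = P $$ (i, pick (position_set I) j)"
      using pick_position[OF j] by (simp add: if_distrib[of "\<lambda>z. _ * z"] cong: if_cong)
    finally show "(P *\<^sub>v col (transpose_mat (selection I)) j) $ i = col P (pick (position_set I) j) $ i"
      using i j P pick_position[OF j] by simp
  qed (use P in simp)
  have "submatrix P (position_set I) (position_set I) = selection I * P * transpose_mat (selection I)"
  proof (rule eq_matI)
    fix i j
    assume "i < dim_row (selection I * P * transpose_mat (selection I))"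
      "j < dim_col (selection I * P * transpose_mat (selection I))"
    then have ij: "i < k" "j < k" using selection by auto
    have "(selection I * P * transpose_mat (selection I)) $$ (i, j) =
        ((selection I * P * transpose_mat (selection I)) *\<^sub>v unit_vec k j) $ i"
      by (rule mult_unit_vec_index[OF mult_carrier_mat[OF RP Rt] ij, symmetric])
    also have "(selection I * P * transpose_mat (selection I)) *\<^sub>v unit_vec k j =
        selection I *\<^sub>v (P *\<^sub>v (transpose_mat (selection I) *\<^sub>v unit_vec k j))"
      using assoc_mult_mat_vec[OF RP Rt, of "unit_vec k j"]
        assoc_mult_mat_vec[OF selection P mult_mat_vec_carrier[OF Rt, of "unit_vec k j"]] by simp
    also have "transpose_mat (selection I) *\<^sub>v unit_vec k j = col (transpose_mat (selection I)) j"
      using ij Rt by (intro eq_vecI) (auto simp: scalar_prod_right_unit)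
    also have "selection I *\<^sub>v (P *\<^sub>v col (transpose_mat (selection I)) j) =
        vec k (\<lambda>i. col P (pick (position_set I) j) $ pick (position_set I) i)"
      unfolding col_Rt[OF ij(2)] by (rule selection_mult) (use P in \<open>simp add: col_def\<close>)
    finally show "submatrix P (position_set I) (position_set I) $$ (i, j) =
        (selection I * P * transpose_mat (selection I)) $$ (i, j)"
      using ij P pick_position by (simp add: submatrix_index dims card_positions)
  qed (use P selection in \<open>auto simp: dim_submatrix dims card_positions\<close>)
  then show ?thesis unfolding principal_submat_def Let_def J proj_mat_eq .
qed

lemma surplus_eq:
  defines "x p \<equiv> transpose_mat A *\<^sub>v pvec p"
  shows "surplus n w G I p = real n * ((selection I *\<^sub>v x p) \<bullet> (selection I *\<^sub>v x p)) - x p \<bullet> x p"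
proof -
  have x: "x p \<in> carrier_vec n" unfolding x_def by (rule mult_mat_vec_carrier[OF At pvec])
  define g where "g e = w e * (gap p (ends G e))\<^sup>2" for e
  have sq: "x p $ j * x p $ j = g (es ! j)" if "j < n" for j
    using cut_vector_square[OF that, of p] unfolding x_def g_def power2_eq_square .
  have "x p \<bullet> x p = (\<Sum>j\<in>{0..<n}. g (es ! j))" unfolding scalar_prod_def using x sq by simp
  also have "\<dots> = sum g (edges G)"
    by (rule sum.reindex_bij_betw[OF bij_betw_nth]) (use es length_es in auto)
  finally have xx: "x p \<bullet> x p = sum g (edges G)" .
  have "(selection I *\<^sub>v x p) \<bullet> (selection I *\<^sub>v x p) = (\<Sum>i\<in>{0..<k}. g (es ! pick (position_set I) i))"
    unfolding selection_mult[OF x] scalar_prod_def using sq pick_position by simp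
  also have "\<dots> = (\<Sum>j\<in>position_set I. g (es ! j))"
    by (rule sum.reindex_bij_betw) (use bij_betw_pick[OF positions(1)] card_positions in \<open>simp add: atLeast0LessThan\<close>)
  also have "\<dots> = sum g I" by (rule sum.reindex_bij_betw[OF positions(3)])
  finally have RR: "(selection I *\<^sub>v x p) \<bullet> (selection I *\<^sub>v x p) = sum g I" .
  have "surplus n w G I p = (\<Sum>e\<in>edges G. (if e \<in> I then real n * g e else 0) - g e)"
    unfolding surplus_def g_def by (intro sum.cong refl) (auto simp: algebra_simps)
  also have "\<dots> = (\<Sum>e\<in>edges G. if e \<in> I then real n * g e else 0) - sum g (edges G)" by (rule sum_subtractf)
  also have "(\<Sum>e\<in>edges G. if e \<in> I then real n * g e else 0) = (\<Sum>e\<in>I. real n * g e)"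
    using I(1) decomposes_finite(2)[OF dec] by (simp add: sum.If_cases Int_absorb1)
  finally show ?thesis unfolding xx RR by (simp add: sum_distrib_left)
qed

abbreviation lmin where "lmin \<equiv> lambda_min (principal_submat es (proj_mat G h vs es w) I)"

lemma n_pos: "0 < real n" using decomposes_card_edges_pos[OF dec] card_edges by simp

text \<open>
  Otherwise every nonconstant potential would have positive surplus.
\<close>
lemma lambda_min_le:
  assumes "surplus n w G I p \<le> 0" "u \<in> verts G" "v \<in> verts G" "p u \<noteq> p v"
  shows "lmin \<le> 1 / real n"
proof (rule ccontr)
  assume "\<not> lmin \<le> 1 / real n"
  then have gt: "1 / real n < lambda_min (C (selection I))"
    unfolding principal_submat_eq C_def[OF selection] by simp
  define x where "x = transpose_mat A *\<^sub>v pvec p"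
  have "x \<noteq> 0\<^sub>v n" using cut_vector_zero_iff[of p] assms(2-4) unfolding x_def by metis
  then have "1 / real n * (x \<bullet> x) < (selection I *\<^sub>v x) \<bullet> (selection I *\<^sub>v x)"
    unfolding x_def using n_pos gt by (intro lambda_min_gt_imp[OF selection _ gt pvec]) auto
  then have "x \<bullet> x < real n * ((selection I *\<^sub>v x) \<bullet> (selection I *\<^sub>v x))"
    using n_pos by (simp add: field_simps)
  then show False using assms(1) surplus_eq[of p] unfolding x_def by simp
qed

lemma lambda_min_certified:
  assumes cert: "certifies n w G l r I 1 a" and a: "0 \<le> a"
  shows "1 / real n \<le> lmin" "0 < a \<Longrightarrow> 1 / real n < lmin"
proof -
  have nn: "0 \<le> surplus n w G I p" for p
  proof -
    have "0 \<le> a * (p l - p r)\<^sup>2" using a by simp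
    also have "\<dots> \<le> surplus n w G I p" using cert unfolding certifies_def by blast
    finally show ?thesis .
  qed
  obtain q where q: "q \<in> carrier_vec (Suc k)" "0 < (transpose_mat A *\<^sub>v q) \<bullet> (transpose_mat A *\<^sub>v q)"
    "lambda_min (C (selection I)) * ((transpose_mat A *\<^sub>v q) \<bullet> (transpose_mat A *\<^sub>v q))
      = (selection I *\<^sub>v (transpose_mat A *\<^sub>v q)) \<bullet> (selection I *\<^sub>v (transpose_mat A *\<^sub>v q))"
  proof (rule lambda_min_attained[OF selection, of "1 / real n"])
    fix q :: "real vec" assume "q \<in> carrier_vec (Suc k)"
    then obtain p where p: "q = pvec p" using pvec_surj by blast
    show "1 / real n * ((transpose_mat A *\<^sub>v q) \<bullet> (transpose_mat A *\<^sub>v q))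
      \<le> (selection I *\<^sub>v (transpose_mat A *\<^sub>v q)) \<bullet> (selection I *\<^sub>v (transpose_mat A *\<^sub>v q))"
      using nn[of p] surplus_eq[of p] n_pos unfolding p by (simp add: field_simps)
  qed (use n_pos in auto)
  obtain p where p: "q = pvec p" using pvec_surj[OF q(1)] by blast
  define x where "x = transpose_mat A *\<^sub>v pvec p"
  have xx: "0 < x \<bullet> x" using q(2) unfolding p x_def .
  have eq: "surplus n w G I p = (real n * lmin - 1) * (x \<bullet> x)"
    using surplus_eq[of p] q(3) unfolding principal_submat_eq C_def[OF selection, symmetric] p x_def[symmetric]
    by (simp add: algebra_simps)
  then have "0 \<le> real n * lmin - 1" using nn[of p] xx by (simp add: zero_le_mult_iff)
  then show "1 / real n \<le> lmin" using n_pos by (simp add: field_simps)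
  assume a0: "0 < a"
  have "0 < surplus n w G I p"
  proof (rule ccontr)
    assume "\<not> 0 < surplus n w G I p"
    then have le: "surplus n w G I p \<le> 0" by simp
    moreover have "a * (p l - p r)\<^sup>2 \<le> surplus n w G I p" using cert unfolding certifies_def by blast
    ultimately have "a * (p l - p r)\<^sup>2 \<le> 0" by linarith
    then have "p l = p r" using a0 by (simp add: mult_le_0_iff)
    then have "\<forall>v\<in>verts G. p v = p l" using cert le unfolding certifies_def by blast
    then have "x = 0\<^sub>v n" using cut_vector_zero_iff unfolding x_def by blast
    then show False using xx by simp
  qed
  then have "0 < real n * lmin - 1" unfolding eq using xx by (simp add: zero_less_mult_iff)
  then show "1 / real n < lmin" using n_pos by (simp add: field_simps)
qed

end

text \<open>
  The maximum is at least \<open>1/n\<close> by the certified spanning set, which exceeds \<open>1/n\<close> unless the weights are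
  calibrated; for calibrated weights no edge set of size \<open>k\<close> exceeds \<open>1/n\<close>.
\<close>
theorem alpha_eq_iff:
  assumes t: "admissible_tree G l r t"
  shows "alpha G h vs es w = 1 / real n \<longleftrightarrow> proportional_to_induced G t w"
proof -
  let ?J = "{I. I \<subseteq> edges G \<and> card I = card (verts G) - 1}"
  let ?f = "\<lambda>I. lambda_min (principal_submat es (proj_mat G h vs es w) I)"
  have finJ: "finite (?f ` ?J)"
    using decomposes_finite(2)[OF dec] by (intro finite_imageI) (auto intro: finite_subset[of _ "Pow (edges G)"])
  have J: "I \<in> ?J \<longleftrightarrow> I \<subseteq> edges G \<and> card I = k" for I using card_verts by simp
  have alpha: "alpha G h vs es w = Max (?f ` ?J)" by (simp add: alpha_def)
  have le_alpha: "?f I \<le> alpha G h vs es w" if "I \<subseteq> edges G" "card I = k" for I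
    unfolding alpha by (rule Max_ge[OF finJ]) (use that J in blast)
  have certI: "I \<subseteq> edges G" "card I = k" if "certifies n w G l r I 1 a" for I a
    using that card_verts unfolding certifies_def by auto
  have wpos: "\<forall>e\<in>edges G. 0 < w e" using w by blast
  have cal: "calibrated n c t w \<longleftrightarrow> (\<forall>e\<in>edges G. w e = c * induced_weight t e)" for c
    by (rule calibrated_iff_induced[OF t card_edges])
  show ?thesis
  proof
    assume eq: "alpha G h vs es w = 1 / real n"
    show "proportional_to_induced G t w"
    proof (rule spanning_set_with_certificate[OF t card_edges wpos])
      fix T a assume T: "certifies n w G l r T 1 a" and a: "0 < a"
      have "1 / real n < ?f T" by (rule lambda_min_certified(2)[OF certI[OF T] T]) (use a in auto)
      then show ?thesis using le_alpha[OF certI[OF T]] eq by linarith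
    next
      fix T c assume "0 < c" "calibrated n c t w"
      then show ?thesis unfolding proportional_to_induced_def cal by blast
    qed
  next
    assume "proportional_to_induced G t w"
    then obtain c where c: "0 < c" "calibrated n c t w" unfolding proportional_to_induced_def cal by blast
    have ub: "?f I \<le> 1 / real n" if I: "I \<subseteq> edges G" "card I = k" for I
    proof -
      have "card I + 1 = card (verts G)" using I(2) card_verts by simp
      then obtain p u v where "surplus n w G I p \<le> 0" "u \<in> verts G" "v \<in> verts G" "p u \<noteq> p v"
        using calibrated_no_certificate[OF t card_edges wpos c(2,1) I(1)] by blast
      then show ?thesis by (rule lambda_min_le[OF I])
    qed
    obtain T a where T: "certifies n w G l r T 1 a" "0 \<le> a"
      by (rule spanning_set_with_certificate[OF t card_edges wpos]) (use less_imp_le in blast)+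
    have lb: "1 / real n \<le> ?f T" by (rule lambda_min_certified(1)[OF certI[OF T(1)] T])
    have "?J \<noteq> {}" using certI[OF T(1)] J by blast
    then have "alpha G h vs es w \<le> 1 / real n"
      unfolding alpha using finJ ub J by (subst Max_le_iff) auto
    then show "alpha G h vs es w = 1 / real n" using lb le_alpha[OF certI[OF T(1)]] by linarith
  qed
qed

end

theorem theorem4p1:
  fixes G :: "('v, 'e) mgraph" and w :: "'e \<Rightarrow> real" and n k :: nat
    and h :: "'e \<Rightarrow> 'v" and vs :: "'v list" and es :: "'e list"
  assumes "two_sp G"
    and "card (edges G) = n" and "card (verts G) = k + 1"
    and "\<forall>e \<in> edges G. w e > 0"
    and "orientation G h"
    and "distinct vs" and "set vs = verts G"
    and "distinct es" and "set es = edges G"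
  shows "(alpha G h vs es w = 1 / real n \<longleftrightarrow>
            (\<exists>l r t. admissible_tree G l r t \<and> proportional_to_induced G t w)) \<and>
         (\<forall>l r t. admissible_tree G l r t \<longrightarrow>
            (alpha G h vs es w = 1 / real n \<longleftrightarrow> proportional_to_induced G t w))"
proof -
  have iff: "alpha G h vs es w = 1 / real n \<longleftrightarrow> proportional_to_induced G t w"
    if t: "admissible_tree G l r t" for l r t
  proof -
    interpret weighted_network G w n k h vs es t l r
      by unfold_locales (use assms t in \<open>auto simp: admissible_tree_def\<close>)
    show ?thesis by (rule alpha_eq_iff[OF t])
  qed
  moreover have "\<exists>l r t. admissible_tree G l r t" by (rule two_sp_admissible_tree[OF assms(1)])
  ultimately show ?thesis by blast
qed

end
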